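(* For every analytic map $\phi\colon\mathbb{D}\to\mathbb{D}$ and every Orlicz function $\Psi$, the composition operator $C_\phi\colon\mathfrak{B}^\Psi\to\mathfrak{B}^\Psi$, $C_\phi(f)=f\circ\phi$, is compact if and only if $$\lim_{h\to 0^+}\frac{\Psi^{-1}(1/h^2)}{\Psi^{-1}\big(1/\rho_{\phi,2}(h)\big)}=0.$$
   Context: $\mathbb{D}$ is the open unit disk, $\mathbb{T}$ the unit circle, $\mathcal{A}$ the normalized area measure $dx\,dy/\pi$ on $\mathbb{D}$. An Orlicz function is a nonnegative increasing convex function $\Psi\colon[0,\infty)\to[0,\infty)$ with $\Psi(0)=0$, $\Psi(x)>0$ for $x>0$, $\Psi(x)\to\infty$ as $x\to\infty$; $\Psi^{-1}$ is its inverse (with $\Psi^{-1}(\infty)=\infty$, so the ratio is $0$ when $\rho_{\phi,2}(h)=0$). The Bergman–Orlicz space $\mathfrak{B}^\Psi$ is the space of analytic $f$ on $\mathbb{D}$ with $\int_{\mathbb{D}}\Psi(|f|/C)\,d\mathcal{A}<\infty$ for some $C>0$, with norm $\inf\{C>0:\int_{\mathbb{D}}\Psi(|f|/C)\,d\mathcal{A}\le1\}$; $C_\phi$ is always bounded on it. For $\xi\in\mathbb{T}$ and $0<h<1$, the Carleson window is $W(\xi,h)=\{z\in\mathbb{D}: |z|\ge1-h,\ |\arg(z\bar\xi)|\le\pi h\}$. $\mathcal{A}_\phi$ is the pull-back measure $\mathcal{A}_\phi(E)=\mathcal{A}(\phi^{-1}(E))$, and $\rho_{\phi,2}(h)=\sup_{\xi\in\mathbb{T}}\mathcal{A}_\phi(W(\xi,h))$.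 *)

theory Defs
  imports "HOL-Analysis.Analysis"
begin

definition unit_disk :: "complex set" where
  "unit_disk = ball 0 1"

definition areaD :: "complex measure" where
  "areaD = scale_measure (ennreal (1 / pi)) (restrict_space lborel unit_disk)"

definition orlicz_function :: "(real \<Rightarrow> real) \<Rightarrow> bool" where
  "orlicz_function \<Psi> \<longleftrightarrow>
     (\<forall>x\<ge>0. \<Psi> x \<ge> 0) \<and> mono_on {0..} \<Psi> \<and> convex_on {0..} \<Psi> \<and> \<Psi> 0 = 0 \<and>
     (\<forall>x>0. \<Psi> x > 0) \<and> filterlim \<Psi> at_top at_top"

definition orlicz_inv :: "(real \<Rightarrow> real) \<Rightarrow> real \<Rightarrow> real" where
  "orlicz_inv \<Psi> = inv_into {0..} \<Psi>"

definition orlicz_modular :: "(real \<Rightarrow> real) \<Rightarrow> (complex \<Rightarrow> complex) \<Rightarrow> real \<Rightarrow> ennreal" where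
  "orlicz_modular \<Psi> f C = (\<integral>\<^sup>+ z. ennreal (\<Psi> (norm (f z) / C)) \<partial>areaD)"

definition bergman_orlicz :: "(real \<Rightarrow> real) \<Rightarrow> (complex \<Rightarrow> complex) set" where
  "bergman_orlicz \<Psi> =
     {f. f holomorphic_on unit_disk \<and> (\<exists>C>0. orlicz_modular \<Psi> f C < \<infinity>)}"

definition bo_norm :: "(real \<Rightarrow> real) \<Rightarrow> (complex \<Rightarrow> complex) \<Rightarrow> real" where
  "bo_norm \<Psi> f = Inf {C. C > 0 \<and> orlicz_modular \<Psi> f C \<le> 1}"

definition compact_comp_op :: "(real \<Rightarrow> real) \<Rightarrow> (complex \<Rightarrow> complex) \<Rightarrow> bool" where
  "compact_comp_op \<Psi> \<phi> \<longleftrightarrow>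
     (\<forall>fs :: nat \<Rightarrow> complex \<Rightarrow> complex.
        (\<forall>n. fs n \<in> bergman_orlicz \<Psi>) \<and> bounded (range (\<lambda>n. bo_norm \<Psi> (fs n))) \<longrightarrow>
        (\<exists>r g. strict_mono r \<and> g \<in> bergman_orlicz \<Psi> \<and>
           (\<lambda>n. bo_norm \<Psi> (\<lambda>z. fs (r n) (\<phi> z) - g z)) \<longlonglongrightarrow> 0))"

definition carleson_window :: "complex \<Rightarrow> real \<Rightarrow> complex set" where
  "carleson_window \<xi> h =
     {z. norm z < 1 \<and> norm z \<ge> 1 - h \<and> \<bar>Arg (z * cnj \<xi>)\<bar> \<le> pi * h}"

definition pullback_area :: "(complex \<Rightarrow> complex) \<Rightarrow> complex set \<Rightarrow> real" where
  "pullback_area \<phi> E = measure areaD (\<phi> -` E \<inter> unit_disk)"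

definition rho_phi2 :: "(complex \<Rightarrow> complex) \<Rightarrow> real \<Rightarrow> real" where
  "rho_phi2 \<phi> h = (SUP \<xi>\<in>sphere 0 1. pullback_area \<phi> (carleson_window \<xi> h))"

text \<open>The ratio Psi^{-1}(1/h^2) / Psi^{-1}(1/rho(h)), with value 0 when rho(h) = 0
  (convention Psi^{-1}(infinity) = infinity).\<close>
definition compactness_ratio :: "(real \<Rightarrow> real) \<Rightarrow> (complex \<Rightarrow> complex) \<Rightarrow> real \<Rightarrow> real" where
  "compactness_ratio \<Psi> \<phi> h =
     (if rho_phi2 \<phi> h = 0 then 0
      else orlicz_inv \<Psi> (1 / h^2) / orlicz_inv \<Psi> (1 / rho_phi2 \<phi> h))"

end

theory Submission
  imports Defs "HOL-Complex_Analysis.Complex_Analysis"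
begin

text \<open>
  The condition on \<open>\<Psi>\<close> only bounds \<open>\<rho>(h)\<close> scale by scale, whereas compactness requires control of
  \<open>\<rho>(t) / t\<^sup>2\<close> uniformly for \<open>t \<le> h\<close>. The bridge is the homogeneity \<open>\<rho>(\<epsilon> h) \<le> K \<epsilon>\<^sup>2 \<rho>(h)\<close>.
  It is a statement about holomorphic \<open>f\<close> from the disk into the right half plane (take
  \<open>f = c / (1 - cnj \<xi> * \<phi>)\<close>) with \<open>\<bar>f 0\<bar>\<close> small: \<open>{\<bar>f\<bar> > \<Lambda>}\<close> has at most \<open>C / \<Lambda>\<^sup>2\<close> times the area of
  \<open>{\<bar>f\<bar> \<ge> 1}\<close>. If \<open>\<bar>f z\<bar> > \<Lambda>\<close>, then \<open>\<bar>f\<bar>\<close> is comparable to 1 on a Whitney ball around some point \<open>w\<close>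
  of the radius to \<open>z\<close> (Schwarz-Pick); near \<open>w\<close> the set \<open>{\<bar>f\<bar> > \<Lambda>}\<close> lies in a thin annulus, where the
  positive harmonic function \<open>Re (f / (\<Lambda> + f))\<close> exceeds 1/2 and has Poisson mass of order
  \<open>\<bar>f w\<bar> / \<Lambda>\<close>. Averaging over \<open>w\<close> with weight \<open>(1 - \<bar>w\<bar>)\<^sup>-\<^sup>2\<close> replaces a covering argument.

  For sufficiency, let \<open>I z\<close> be the integral of \<open>\<Psi> \<bar>F\<bar>\<close> over the Whitney ball at \<open>z\<close>, so that
  \<open>\<Psi> \<bar>F z\<bar> (1 - \<bar>z\<bar>)\<^sup>2 \<le> 4 I z\<close>. Homogeneity turns the hypothesis into
  \<open>\<Psi> (A \<bar>F z\<bar>) \<rho>(3 (1 - \<bar>z\<bar>)) \<le> K I z\<close> wherever \<open>\<bar>F z\<bar>\<close> is large, and integrating this against the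
  pull-back measure, with the order of integration exchanged, bounds \<open>\<Psi> (A \<bar>F \<circ> \<phi>\<bar>)\<close> there by a
  constant that does not depend on \<open>A\<close>. Necessity follows by testing on
  \<open>\<Psi>\<^sup>-\<^sup>1(1 / h\<^sup>2) (h / (1 - (1 - h) cnj \<xi> z)) ^ 4\<close>.
\<close>

subsection \<open>Rotation invariance and the Poisson formula\<close>

lemma nn_integral_lborel_translate:
  fixes H :: "'a::euclidean_space \<Rightarrow> ennreal"
  assumes [measurable]: "H \<in> borel_measurable borel"
  shows "(\<integral>\<^sup>+x. H (a + x) \<partial>lborel) = (\<integral>\<^sup>+x. H x \<partial>lborel)"
proof -
  have "(\<integral>\<^sup>+x. H x \<partial>lborel) = (\<integral>\<^sup>+x. H x \<partial>distr lborel borel ((+) a))"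
    by (simp add: lborel_distr_plus)
  then show ?thesis
    by (simp add: nn_integral_distr)
qed

lemma emeasure_lborel_ball_complex:
  "r \<ge> 0 \<Longrightarrow> emeasure lborel (ball (z::complex) r) = ennreal (pi * r\<^sup>2)"
  by (simp add: emeasure_ball unit_ball_vol_2)

text \<open>Averaging over translates of the rotation-invariant unit disk, as in the uniqueness proof of
  Haar measure.\<close>
lemma nn_integral_lborel_rotate:
  fixes H :: "complex \<Rightarrow> ennreal"
  assumes [measurable]: "H \<in> borel_measurable borel" and c: "norm c = 1"
  shows "(\<integral>\<^sup>+x. H (c * x) \<partial>lborel) = (\<integral>\<^sup>+x. H x \<partial>lborel)"
proof -
  define g :: "complex \<Rightarrow> ennreal" where "g = indicator (ball 0 1)"
  have [measurable]: "g \<in> borel_measurable borel" unfolding g_def by (intro borel_measurable_indicator borel_open open_ball)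
  have c0: "c \<noteq> 0" using c by auto
  have vol: "(\<integral>\<^sup>+y. g y \<partial>lborel) = ennreal pi"
    by (simp add: g_def emeasure_lborel_ball_complex)
  have "ennreal pi * (\<integral>\<^sup>+x. H (c * x) \<partial>lborel) = (\<integral>\<^sup>+y. g y * (\<integral>\<^sup>+x. H (c * x) \<partial>lborel) \<partial>lborel)"
    by (simp add: nn_integral_multc vol)
  \<comment> \<open>Translating \<open>x\<close> by \<open>y / c\<close> shifts \<open>c * x\<close>
    by \<open>y\<close>, so a translate may be inserted for every \<open>y\<close>.\<close>
  also have "\<dots> = (\<integral>\<^sup>+y. g y * (\<integral>\<^sup>+x. H (y + c * x) \<partial>lborel) \<partial>lborel)"
  proof (rule nn_integral_cong)
    fix y
    show "g y * (\<integral>\<^sup>+x. H (c * x) \<partial>lborel) = g y * (\<integral>\<^sup>+x. H (y + c * x) \<partial>lborel)"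
      using nn_integral_lborel_translate[of "\<lambda>x. H (c * x)" "y / c"] c0
      by (simp add: distrib_left)
  qed
  also have "\<dots> = (\<integral>\<^sup>+y. \<integral>\<^sup>+x. g y * H (y + c * x) \<partial>lborel \<partial>lborel)"
    by (simp add: nn_integral_cmult)
  also have "\<dots> = (\<integral>\<^sup>+x. \<integral>\<^sup>+y. g y * H (y + c * x) \<partial>lborel \<partial>lborel)"
    by (rule lborel_pair.Fubini') measurable
  also have "\<dots> = (\<integral>\<^sup>+x. \<integral>\<^sup>+y. g (y - c * x) * H y \<partial>lborel \<partial>lborel)"
  proof (rule nn_integral_cong)
    fix x
    show "(\<integral>\<^sup>+y. g y * H (y + c * x) \<partial>lborel) = (\<integral>\<^sup>+y. g (y - c * x) * H y \<partial>lborel)"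
      using nn_integral_lborel_translate[of "\<lambda>y. g (y - c * x) * H y" "c * x"]
      by (simp add: add.commute)
  qed
  also have "\<dots> = (\<integral>\<^sup>+y. \<integral>\<^sup>+x. g (y - c * x) * H y \<partial>lborel \<partial>lborel)"
    by (rule lborel_pair.Fubini') measurable
  also have "\<dots> = (\<integral>\<^sup>+y. (\<integral>\<^sup>+x. g (y - c * x) \<partial>lborel) * H y \<partial>lborel)"
    by (simp add: nn_integral_multc)
  also have "\<dots> = (\<integral>\<^sup>+y. ennreal pi * H y \<partial>lborel)"
  proof (rule nn_integral_cong)
    fix y
    \<comment> \<open>Since |c| = 1, the \<open>x\<close> with \<open>y - c * x\<close> in the unit
      disk form a unit disk again, centred at \<open>y / c\<close>, and its area does not depend on
      \<open>y\<close>.\<close>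
    have "norm (y - c * x) = norm (y / c - x)" for x
      using c c0 by (metis diff_divide_distrib div_by_1 nonzero_mult_div_cancel_left norm_divide)
    then have "g (y - c * x) = indicator (ball (y / c) 1) x" for x
      by (simp add: g_def indicator_def dist_norm norm_minus_commute[of "c * x" y])
    then show "(\<integral>\<^sup>+x. g (y - c * x) \<partial>lborel) * H y = ennreal pi * H y"
      by (simp add: emeasure_lborel_ball_complex)
  qed
  also have "\<dots> = ennreal pi * (\<integral>\<^sup>+y. H y \<partial>lborel)"
    by (simp add: nn_integral_cmult)
  finally show ?thesis
    by (simp add: ennreal_mult_cancel_left)
qed

text \<open>Fubini together with rotation invariance. This takes the place of polar coordinates:
  what holds for the mean over every circle around 0 passes to the area integral.\<close>

lemma nn_integral_lborel_rotation_average: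
  fixes H :: "complex \<Rightarrow> ennreal"
  assumes [measurable]: "H \<in> borel_measurable borel"
  shows "(\<integral>\<^sup>+z. H z \<partial>lborel) = (\<integral>\<^sup>+z. (\<integral>\<^sup>+t. H (cis (2 * pi * t) * z) * indicator {0..1} t \<partial>lborel) \<partial>lborel)"
proof -
  have [measurable]: "cis \<in> borel_measurable borel"
    by (intro borel_measurable_continuous_onI continuous_intros)
  have "(\<integral>\<^sup>+z. (\<integral>\<^sup>+t. H (cis (2 * pi * t) * z) * indicator {0..1} t \<partial>lborel) \<partial>lborel)
      = (\<integral>\<^sup>+t. (\<integral>\<^sup>+z. H (cis (2 * pi * t) * z) * indicator {0..1} t \<partial>lborel) \<partial>lborel)"
    by (rule lborel_pair.Fubini') measurable
  also have "\<dots> = (\<integral>\<^sup>+t. (\<integral>\<^sup>+z. H z \<partial>lborel) * indicator {0..1} (t::real) \<partial>lborel)"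
    by (simp add: nn_integral_multc nn_integral_lborel_rotate)
  also have "\<dots> = (\<integral>\<^sup>+z. H z \<partial>lborel)"
    by (simp add: nn_integral_cmult)
  finally show ?thesis ..
qed

text \<open>On the circle |z| = r this is the Poisson kernel of the disk of radius r at the interior
  point \<open>r\<^sup>2 * w\<close>. A single formula serves all radii, so it can be integrated
  over an annulus.\<close>

definition poisson :: "complex \<Rightarrow> complex \<Rightarrow> real" where
  "poisson w z = (1 - (norm w)\<^sup>2 * (norm z)\<^sup>2) / (norm (1 - cnj w * z))\<^sup>2"

lemma one_minus_cnj_mult_nonzero: "norm w < 1 \<Longrightarrow> norm z < 1 \<Longrightarrow> 1 - cnj w * z \<noteq> 0"
proof
  assume "norm w < 1" "norm z < 1" "1 - cnj w * z = 0"
  then have "norm (cnj w * z) = 1" by simp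
  then have "norm w * norm z = 1" by (simp add: norm_mult)
  moreover have "norm w * norm z < 1 * 1"
    using \<open>norm w < 1\<close> \<open>norm z < 1\<close> by (intro mult_strict_mono) auto
  ultimately show False by simp
qed

lemma poisson_pos: "norm w < 1 \<Longrightarrow> norm z < 1 \<Longrightarrow> poisson w z > 0"
proof -
  assume wz: "norm w < 1" "norm z < 1"
  have "(norm w)\<^sup>2 < 1" "(norm z)\<^sup>2 < 1" using wz by (simp_all add: abs_square_less_1)
  then have "(norm w)\<^sup>2 * (norm z)\<^sup>2 < 1 * 1" by (intro mult_strict_mono) auto
  then show ?thesis
    unfolding poisson_def using one_minus_cnj_mult_nonzero[OF wz] by (intro divide_pos_pos) auto
qed

text \<open>Cauchy's formula at \<open>r\<^sup>2 * w\<close> for \<open>G\<close> times an auxiliary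
  factor. The pole \<open>1 / cnj w\<close> of that factor is the reflection of
  \<open>r\<^sup>2 * w\<close> in the circle, so the factor is 1 at \<open>r\<^sup>2 * w\<close> and
  turns the Cauchy kernel into the Poisson kernel on the circle.\<close>

lemma poisson_formula_circle:
  fixes r :: real and w :: complex
  assumes G: "G holomorphic_on ball 0 1" and w: "norm w < 1" and r: "0 < r" "r < 1"
  shows "((\<lambda>t. G (r * cis (2 * pi * t)) * of_real (poisson w (r * cis (2 * pi * t))))
    has_integral G (r\<^sup>2 * w)) {0..1}"
proof -
  define f where "f u = G u * (1 - (norm w)\<^sup>2 * r\<^sup>2) / (1 - cnj w * u)" for u
  have hol: "f holomorphic_on cball 0 r"
    unfolding f_def using r w
    by (intro holomorphic_intros holomorphic_on_subset[OF G] one_minus_cnj_mult_nonzero) auto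
  have "norm (r\<^sup>2 * w) < r"
  proof -
    have "r * norm w < 1 * 1" using r w by (intro mult_strict_mono) auto
    then have "r * (r * norm w) < r * 1" using r by (intro mult_strict_left_mono) auto
    then show ?thesis by (simp add: norm_mult norm_power power2_eq_square mult.assoc)
  qed
  then have "((\<lambda>u. f u / (u - r\<^sup>2 * w)) has_contour_integral (2 * of_real pi * \<i> * f (r\<^sup>2 * w))) (circlepath 0 r)"
    by (intro Cauchy_integral_circlepath_simple hol) auto
  then have "((\<lambda>t. f (circlepath 0 r t) / (circlepath 0 r t - r\<^sup>2 * w) * (2 * pi * \<i> * r * exp (2 * of_real pi * \<i> * t)))
     has_integral (2 * of_real pi * \<i> * f (r\<^sup>2 * w))) {0..1}"
    unfolding has_contour_integral_def
    by (rule has_integral_eq[rotated]) (simp add: vector_derivative_circlepath01)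
  from has_integral_mult_right[OF this, of "1 / (2 * of_real pi * \<i>)"]
  have *: "((\<lambda>t. f (circlepath 0 r t) / (circlepath 0 r t - r\<^sup>2 * w) * (r * exp (2 * of_real pi * \<i> * t)))
     has_integral f (r\<^sup>2 * w)) {0..1}"
    by (simp add: field_simps)
  have fG: "f (r\<^sup>2 * w) = G (r\<^sup>2 * w)"
  proof -
    have "1 - cnj w * (r\<^sup>2 * w) = 1 - (norm w)\<^sup>2 * r\<^sup>2"
      using complex_norm_square[of w] by (simp add: algebra_simps)
    moreover have "1 - cnj w * (r\<^sup>2 * w) \<noteq> 0"
      using \<open>norm (r\<^sup>2 * w) < r\<close> r w by (intro one_minus_cnj_mult_nonzero) auto
    ultimately show ?thesis
      unfolding f_def by (metis nonzero_mult_div_cancel_right)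
  qed
  show ?thesis
    unfolding fG[symmetric]
  proof (rule has_integral_eq[OF _ *])
    fix t :: real
    define z where "z = r * cis (2 * pi * t)"
    have z: "circlepath 0 r t = z" "r * exp (2 * of_real pi * \<i> * t) = z"
      by (simp_all add: circlepath z_def cis_conv_exp algebra_simps)
    have nz: "norm z = r" "z \<noteq> 0" using r by (auto simp: z_def norm_mult)
    have zz: "of_real (r\<^sup>2) = z * cnj z" by (simp add: complex_norm_square[symmetric] nz)
    have n1: "1 - cnj w * z \<noteq> 0" "1 - w * cnj z \<noteq> 0"
      using one_minus_cnj_mult_nonzero[of w z] one_minus_cnj_mult_nonzero[of "cnj w" "cnj z"] nz r w by auto
    have nn: "of_real ((norm (1 - cnj w * z))\<^sup>2) = (1 - cnj w * z) * (1 - w * cnj z)"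
      by (simp add: complex_norm_square del: of_real_power)
    \<comment> \<open>On the circle \<open>r\<^sup>2 = z * cnj z\<close>; the factor
      \<open>z\<close> split off here cancels against the derivative of the path.\<close>
    have e1: "z - r\<^sup>2 * w = z * (1 - w * cnj z)"
      using zz by (simp add: algebra_simps)
    have "f z / (z - r\<^sup>2 * w) * z = G z * (1 - (norm w)\<^sup>2 * r\<^sup>2) / ((1 - cnj w * z) * (1 - w * cnj z))"
      unfolding e1 f_def using nz(2) by simp
    also have "\<dots> = G z * of_real (poisson w z)"
      by (simp add: poisson_def nn[symmetric] nz del: of_real_power)
    finally show "f (circlepath 0 r t) / (circlepath 0 r t - r\<^sup>2 * w) * (r * exp (2 * of_real pi * \<i> * t)) =
      G (r * cis (2 * pi * t)) * of_real (poisson w (r * cis (2 * pi * t)))"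
      unfolding z by (simp add: z_def)
  qed
qed

text \<open>The rotation by \<open>z / norm z\<close> reduces this to a circle started on the
  positive axis, since the kernel is unchanged when both arguments are rotated. For
  \<open>z = 0\<close> the circle degenerates and the kernel is 1.\<close>

lemma poisson_formula:
  fixes w z :: complex
  assumes G: "G holomorphic_on ball 0 1" and w: "norm w < 1" and z: "norm z < 1"
  shows "((\<lambda>t. Re (G (cis (2 * pi * t) * z)) * poisson w (cis (2 * pi * t) * z))
    has_integral Re (G ((norm z)\<^sup>2 * w))) {0..1}"
proof (cases "z = 0")
  case True
  then show ?thesis using has_integral_const_real[of "Re (G 0)" 0 1] by (simp add: poisson_def)
next
  case False
  define r c where "r = norm z" and "c = z / norm z"
  have c: "norm c = 1" "z = c * r" "c * cnj c = 1" using False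
    by (auto simp: r_def c_def norm_divide complex_norm_square[symmetric] power2_eq_square)
  have "((\<lambda>t. G (c * (r * cis (2 * pi * t))) * of_real (poisson (cnj c * w) (r * cis (2 * pi * t))))
    has_integral G (c * (r\<^sup>2 * (cnj c * w)))) {0..1}"
  proof (rule poisson_formula_circle)
    show "(\<lambda>u. G (c * u)) holomorphic_on ball 0 1"
      using c by (intro holomorphic_on_compose_gen[OF _ G, unfolded o_def] holomorphic_intros) (auto simp: norm_mult)
  qed (use c w z False in \<open>auto simp: norm_mult r_def\<close>)
  from has_integral_linear[OF this bounded_linear_Re]
  have *: "((\<lambda>t. Re (G (c * (r * cis (2 * pi * t))) * of_real (poisson (cnj c * w) (r * cis (2 * pi * t)))))
    has_integral Re (G (c * (r\<^sup>2 * (cnj c * w))))) {0..1}"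
    by (simp add: o_def)
  have e1: "poisson (cnj c * w) u = poisson w (c * u)" for u
    using c by (simp add: poisson_def norm_mult algebra_simps)
  have "c * (r\<^sup>2 * (cnj c * w)) = (c * cnj c) * (r\<^sup>2 * w)" by (simp only: mult_ac)
  then have e2: "c * (r\<^sup>2 * (cnj c * w)) = (norm z)\<^sup>2 * w"
    using c(3) by (simp add: r_def)
  have e3: "c * (r * u) = u * z" for u :: complex using c(2) by (simp add: mult_ac)
  show ?thesis using * unfolding e1 e2 e3 by simp
qed

text \<open>Extension by zero makes a holomorphic function Borel on the whole plane, where Fubini
  and the invariance lemmas are stated.\<close>

lemma borel_measurable_indicator_holomorphic:
  "open S \<Longrightarrow> f holomorphic_on S \<Longrightarrow> (\<lambda>x. indicator S x *\<^sub>R f x) \<in> borel_measurable borel"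
  by (intro borel_measurable_continuous_on_indicator borel_open holomorphic_on_imp_continuous_on)

lemma nn_integral_poisson_circle:
  fixes w z :: complex
  assumes G: "G holomorphic_on ball 0 1" and w: "norm w < 1" and z: "norm z < 1"
    and pos: "\<And>u. norm u < 1 \<Longrightarrow> Re (G u) \<ge> 0"
  shows "(\<integral>\<^sup>+t. ennreal (Re (G (cis (2 * pi * t) * z)) * poisson w (cis (2 * pi * t) * z)) * indicator {0..1} t \<partial>lborel)
    = ennreal (Re (G ((norm z)\<^sup>2 * w)))"
  by (rule nn_integral_has_integral_lebesgue'[OF _ poisson_formula[OF G w z]])
     (use w z in \<open>auto intro!: mult_nonneg_nonneg pos less_imp_le[OF poisson_pos] simp: norm_mult\<close>)

text \<open>The circle formula averaged over all circles of the annulus, whose indicator is constant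
  on each of them. It trades the Poisson mass of \<open>Re G\<close> near the boundary for values of
  \<open>Re G\<close> on the segment from 0 to \<open>w\<close>.\<close>

lemma nn_integral_poisson_annulus:
  fixes w :: complex
  assumes G: "G holomorphic_on ball 0 1" and w: "norm w < 1"
    and pos: "\<And>u. norm u < 1 \<Longrightarrow> Re (G u) \<ge> 0"
  shows "(\<integral>\<^sup>+z. ennreal (Re (G z) * poisson w z) * indicator {z::complex. a < norm z \<and> norm z < 1} z \<partial>lborel)
    = (\<integral>\<^sup>+z. ennreal (Re (G ((norm z)\<^sup>2 * w))) * indicator {z::complex. a < norm z \<and> norm z < 1} z \<partial>lborel)"
    (is "_ = (\<integral>\<^sup>+z. _ * indicator ?S z \<partial>lborel)")
proof -
  have [measurable]: "(\<lambda>x. indicator (ball 0 1) x *\<^sub>R G x) \<in> borel_measurable borel"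
    by (intro borel_measurable_indicator_holomorphic G open_ball)
  have [measurable]: "ball 0 1 \<in> sets (borel :: complex measure)" by simp
  define H where "H z = ennreal (Re (indicator (ball 0 1) z *\<^sub>R G z) * poisson w z) * indicator ?S z" for z
  have [measurable]: "H \<in> borel_measurable borel"
    unfolding H_def poisson_def by measurable
  have "(\<integral>\<^sup>+z. ennreal (Re (G z) * poisson w z) * indicator ?S z \<partial>lborel) = (\<integral>\<^sup>+z. H z \<partial>lborel)"
    by (intro nn_integral_cong) (auto simp: H_def split: split_indicator)
  also have "\<dots> = (\<integral>\<^sup>+z. (\<integral>\<^sup>+t. H (cis (2 * pi * t) * z) * indicator {0..1} t \<partial>lborel) \<partial>lborel)"
    by (rule nn_integral_lborel_rotation_average) measurable
  also have "\<dots> = (\<integral>\<^sup>+z. ennreal (Re (G ((norm z)\<^sup>2 * w))) * indicator ?S z \<partial>lborel)"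
  proof (intro nn_integral_cong)
    fix z :: complex
    show "(\<integral>\<^sup>+t. H (cis (2 * pi * t) * z) * indicator {0..1} t \<partial>lborel) = ennreal (Re (G ((norm z)\<^sup>2 * w))) * indicator ?S z"
    proof (cases "z \<in> ?S")
      case True
      then have "H (cis (2 * pi * t) * z) = ennreal (Re (G (cis (2 * pi * t) * z)) * poisson w (cis (2 * pi * t) * z))" for t
        by (simp add: H_def norm_mult)
      with True show ?thesis
        using nn_integral_poisson_circle[OF G w _ pos, of z] by simp
    qed (auto simp: H_def norm_mult)
  qed
  finally show ?thesis .
qed

text \<open>On every circle around \<open>a\<close> the mean of \<open>Re Q\<close> is
  \<open>Re (Q a)\<close>, the case \<open>w = 0\<close> of the Poisson formula. As \<open>Y\<close>
  only has to dominate \<open>Re Q\<close>, the latter may be a harmonic minorant touching a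
  subharmonic function at \<open>a\<close>.\<close>

lemma submean_value_ball:
  assumes Q: "Q holomorphic_on ball a r" and r: "r > 0"
    and [measurable]: "Y \<in> borel_measurable borel"
    and le: "\<And>u. u \<in> ball a r \<Longrightarrow> ennreal (Re (Q u)) \<le> Y u"
  shows "ennreal (Re (Q a)) * ennreal (pi * r\<^sup>2) \<le> (\<integral>\<^sup>+u. Y u * indicator (ball a r) u \<partial>lborel)"
proof -
  have [measurable]: "cis \<in> borel_measurable borel"
    by (intro borel_measurable_continuous_onI continuous_intros)
  have [measurable]: "ball 0 r \<in> sets (borel :: complex measure)" by simp
  define H where "H z = Y (a + z) * indicator (ball 0 r) z" for z
  have [measurable]: "H \<in> borel_measurable borel"
    unfolding H_def by measurable
  define f where "f z t = Re (Q (a + cis (2 * pi * t) * z))" for z t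
  have circle: "ennreal (Re (Q a)) * indicator (ball 0 r) z \<le> (\<integral>\<^sup>+t. H (cis (2 * pi * t) * z) * indicator {0..1} t \<partial>lborel)" for z
  proof (cases "norm z < r")
    case True
    have "(\<lambda>\<zeta>. Q (a + r * \<zeta>)) holomorphic_on ball 0 1"
      using r by (intro holomorphic_on_compose_gen[OF _ Q, unfolded o_def] holomorphic_intros)
        (auto simp: norm_mult dist_norm)
    from poisson_formula[OF this, of 0 "z / r"] True r
    have int: "(f z has_integral Re (Q a)) {0..1}"
      by (simp add: poisson_def f_def[abs_def] norm_divide)
    \<comment> \<open>\<open>Re Q\<close> may be negative while \<open>ennreal\<close> truncates at
      0; passing to the positive part can only increase the mean.\<close>
    have "continuous_on {0..1} (\<lambda>t. max 0 (f z t))"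
      unfolding f_def using True
      by (intro continuous_intros continuous_on_compose2[OF holomorphic_on_imp_continuous_on[OF Q]])
         (auto simp: dist_norm norm_mult)
    then have "(\<lambda>t. max 0 (f z t)) integrable_on {0..1}" by (rule integrable_continuous_interval)
    then obtain J where J: "((\<lambda>t. max 0 (f z t)) has_integral J) {0..1}" by (auto simp: integrable_on_def)
    have "Re (Q a) \<le> J"
      by (rule has_integral_le[OF int J]) auto
    then have "ennreal (Re (Q a)) \<le> ennreal J" by (rule ennreal_leI)
    also have "\<dots> = (\<integral>\<^sup>+t. ennreal (max 0 (f z t)) * indicator {0..1} t \<partial>lborel)"
      by (rule nn_integral_has_integral_lebesgue'[OF _ J, symmetric]) auto
    also have "\<dots> \<le> (\<integral>\<^sup>+t. H (cis (2 * pi * t) * z) * indicator {0..1} t \<partial>lborel)"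
    proof (intro nn_integral_mono mult_right_mono)
      fix t
      have "ennreal (f z t) \<le> H (cis (2 * pi * t) * z)"
        unfolding f_def H_def using True le[of "a + cis (2 * pi * t) * z"] by (simp add: norm_mult dist_norm)
      then show "ennreal (max 0 (f z t)) \<le> H (cis (2 * pi * t) * z)"
        by (simp add: max_def ennreal_neg)
    qed auto
    finally show ?thesis using True by simp
  qed auto
  have "ennreal (Re (Q a)) * ennreal (pi * r\<^sup>2) = (\<integral>\<^sup>+z. ennreal (Re (Q a)) * indicator (ball (0::complex) r) z \<partial>lborel)"
    using r emeasure_lborel_ball_complex[of r 0] by (simp add: nn_integral_cmult_indicator)
  also have "\<dots> \<le> (\<integral>\<^sup>+z. (\<integral>\<^sup>+t. H (cis (2 * pi * t) * z) * indicator {0..1} t \<partial>lborel) \<partial>lborel)"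
    by (intro nn_integral_mono circle)
  also have "\<dots> = (\<integral>\<^sup>+z. H z \<partial>lborel)"
    by (rule nn_integral_lborel_rotation_average[symmetric]) measurable
  also have "\<dots> = (\<integral>\<^sup>+z. H (- a + z) \<partial>lborel)"
    by (rule nn_integral_lborel_translate[symmetric]) measurable
  also have "\<dots> = (\<integral>\<^sup>+u. Y u * indicator (ball a r) u \<partial>lborel)"
    by (intro nn_integral_cong) (auto simp: H_def dist_norm norm_minus_commute split: split_indicator)
  finally show ?thesis .
qed

subsection \<open>Holomorphic maps into the right half plane\<close>

lemma norm_one_minus_cnj_mult_sq:
  "(norm (1 - cnj w * z))\<^sup>2 - (norm (w - z))\<^sup>2 = (1 - (norm w)\<^sup>2) * (1 - (norm z)\<^sup>2)"
  unfolding cmod_power2 by (simp add: power2_eq_square algebra_simps)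

lemma norm_disk_automorphism_lt_1:
  assumes "norm w < 1" "norm z < 1"
  shows "norm ((w - z) / (1 - cnj w * z)) < 1"
proof -
  have "(1 - (norm w)\<^sup>2) * (1 - (norm z)\<^sup>2) > 0"
    using assms by (intro mult_pos_pos) (simp_all add: abs_square_less_1)
  then have "(norm (w - z))\<^sup>2 < (norm (1 - cnj w * z))\<^sup>2"
    using norm_one_minus_cnj_mult_sq[of w z] by linarith
  then have "norm (w - z) < norm (1 - cnj w * z)"
    by (rule power2_less_imp_less) simp
  then show ?thesis
    using one_minus_cnj_mult_nonzero[OF assms] by (simp add: norm_divide)
qed

lemma norm_half_plane_automorphism_lt_1:
  assumes "Re p > 0" "Re a > 0"
  shows "norm ((p - a) / (p + cnj a)) < 1"
proof -
  have "(norm (p + cnj a))\<^sup>2 - (norm (p - a))\<^sup>2 = 4 * Re p * Re a"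
    unfolding cmod_power2 by (simp add: power2_eq_square algebra_simps)
  moreover have "4 * Re p * Re a > 0" using assms by simp
  ultimately have "(norm (p - a))\<^sup>2 < (norm (p + cnj a))\<^sup>2" by linarith
  then have "norm (p - a) < norm (p + cnj a)"
    by (rule power2_less_imp_less) simp
  moreover from this have "norm (p + cnj a) > 0" using norm_ge_zero[of "p - a"] by linarith
  ultimately show ?thesis by (simp add: norm_divide)
qed

text \<open>The Schwarz lemma for \<open>g\<close>, which is \<open>f\<close> preceded by the disk
  involution exchanging 0 and \<open>w\<close> and followed by a Cayley map sending
  \<open>f w\<close> to 0. At \<open>\<tau> z\<close> it bounds |f z - f w| by \<rho> |f z + cnj (f
  w)|, and the triangle inequality does the rest.\<close>

lemma schwarz_pick_half_plane:
  assumes f: "f holomorphic_on ball 0 1" and pos: "\<And>u. norm u < 1 \<Longrightarrow> Re (f u) > 0"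
    and wz: "norm w < 1" "norm z < 1"
  defines "\<rho> \<equiv> norm ((w - z) / (1 - cnj w * z))"
  shows "norm (f z) * (1 - \<rho>) \<le> norm (f w) * (1 + \<rho>)"
proof -
  define \<tau> where "\<tau> u = (w - u) / (1 - cnj w * u)" for u
  have \<tau>1: "norm (\<tau> u) < 1" if "norm u < 1" for u
    unfolding \<tau>_def using wz that by (intro norm_disk_automorphism_lt_1)
  have inv: "\<tau> (\<tau> z) = z"
  proof -
    have n0: "1 - cnj w * z \<noteq> 0" using one_minus_cnj_mult_nonzero[OF wz] .
    have nw: "1 - cnj w * w \<noteq> 0" using one_minus_cnj_mult_nonzero[OF wz(1) wz(1)] .
    have "w - \<tau> z = z * (1 - cnj w * w) / (1 - cnj w * z)"
      using n0 by (simp add: \<tau>_def divide_simps) (simp add: algebra_simps)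
    moreover have "1 - cnj w * \<tau> z = (1 - cnj w * w) / (1 - cnj w * z)"
      using n0 by (simp add: \<tau>_def divide_simps) (simp add: algebra_simps)
    ultimately show ?thesis using n0 nw by (subst \<tau>_def) simp
  qed
  define g where "g u = (f (\<tau> u) - f w) / (f (\<tau> u) + cnj (f w))" for u
  have hol: "(\<lambda>u. f (\<tau> u)) holomorphic_on ball 0 1"
    unfolding \<tau>_def
    by (intro holomorphic_on_compose_gen[OF _ f, unfolded o_def] holomorphic_intros)
       (use wz one_minus_cnj_mult_nonzero \<tau>1 in \<open>auto simp: \<tau>_def\<close>)
  have nz: "f (\<tau> u) + cnj (f w) \<noteq> 0" if "norm u < 1" for u
  proof
    assume "f (\<tau> u) + cnj (f w) = 0"
    from arg_cong[OF this, of Re] have "Re (f (\<tau> u)) + Re (f w) = 0" by simp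
    then show False using pos[OF \<tau>1[OF that]] pos[OF wz(1)] by simp
  qed
  have "g holomorphic_on ball 0 1"
    unfolding g_def by (intro holomorphic_intros hol) (use nz in auto)
  moreover have "g 0 = 0" by (simp add: g_def \<tau>_def)
  moreover have "norm (g u) < 1" if "norm u < 1" for u
    unfolding g_def by (intro norm_half_plane_automorphism_lt_1 pos \<tau>1 that wz)
  moreover have "norm (\<tau> z) < 1" using \<tau>1 wz by blast
  ultimately have "norm (g (\<tau> z)) \<le> norm (\<tau> z)" by (rule Schwarz_Lemma(1))
  then have "norm (f z - f w) / norm (f z + cnj (f w)) \<le> \<rho>"
    by (simp add: g_def inv norm_divide) (simp add: \<rho>_def \<tau>_def norm_divide)
  moreover have "f z + cnj (f w) \<noteq> 0" using nz[OF \<tau>1[OF wz(2)]] inv by simp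
  ultimately have 1: "norm (f z - f w) \<le> \<rho> * norm (f z + cnj (f w))"
    by (simp add: divide_le_eq)
  have "norm (f z) - norm (f w) \<le> norm (f z - f w)" by (rule norm_triangle_ineq2)
  also note 1
  also have "\<rho> * norm (f z + cnj (f w)) \<le> \<rho> * (norm (f z) + norm (f w))"
    by (intro mult_left_mono order_trans[OF norm_triangle_ineq]) (auto simp: \<rho>_def)
  finally show ?thesis by (simp add: algebra_simps)
qed

lemma norm_one_minus_cnj_mult_ge: "norm z < 1 \<Longrightarrow> 1 - norm w \<le> norm (1 - cnj w * z)"
proof -
  assume "norm z < 1"
  have "norm w * norm z \<le> norm w * 1" using \<open>norm z < 1\<close> by (intro mult_left_mono) auto
  then show ?thesis using norm_triangle_ineq2[of 1 "cnj w * z"] by (simp add: norm_mult)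
qed

text \<open>The pseudohyperbolic distance to \<open>w\<close> is at most 1/2 on this ball, so
  Schwarz-Pick gives the factor (1 + 1/2) / (1 - 1/2) = 3. The distance is symmetric, whence both
  directions.\<close>

lemma half_plane_le_on_whitney_ball:
  assumes f: "f holomorphic_on ball 0 1" and pos: "\<And>u. norm u < 1 \<Longrightarrow> Re (f u) > 0"
    and w: "norm w < 1" and z: "norm (z - w) \<le> (1 - norm w) / 2"
  shows "norm (f z) \<le> 3 * norm (f w)" "norm (f w) \<le> 3 * norm (f z)"
proof -
  define \<rho> where "\<rho> = norm (w - z) / norm (1 - cnj w * z)"
  have z1: "norm z < 1" using norm_triangle_ineq2[of z w] w z by simp
  have ge: "1 - norm w \<le> norm (1 - cnj w * z)" using z1 by (rule norm_one_minus_cnj_mult_ge)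
  have r: "\<rho> \<le> 1 / 2" "\<rho> \<ge> 0"
    using ge w z by (auto simp: \<rho>_def divide_le_eq norm_minus_commute)
  have "norm (f z) * (1 - \<rho>) \<le> norm (f w) * (1 + \<rho>)"
    using schwarz_pick_half_plane[OF f pos w z1] by (simp add: norm_divide \<rho>_def)
  moreover have "norm (f z) * (1 / 2) \<le> norm (f z) * (1 - \<rho>)" "norm (f w) * (1 + \<rho>) \<le> norm (f w) * (3 / 2)"
    by (rule mult_left_mono; use r in simp)+
  ultimately show "norm (f z) \<le> 3 * norm (f w)" by linarith
  have "norm (z - w) / norm (1 - cnj z * w) = \<rho>"
  proof -
    have "1 - cnj z * w = cnj (1 - cnj w * z)" by simp
    then have "norm (1 - cnj z * w) = norm (1 - cnj w * z)" by (simp only: complex_mod_cnj)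
    then show ?thesis by (simp add: \<rho>_def norm_minus_commute)
  qed
  then have "norm (f w) * (1 - \<rho>) \<le> norm (f z) * (1 + \<rho>)"
    using schwarz_pick_half_plane[OF f pos z1 w] by (simp add: norm_divide)
  moreover have "norm (f w) * (1 / 2) \<le> norm (f w) * (1 - \<rho>)" "norm (f z) * (1 + \<rho>) \<le> norm (f z) * (3 / 2)"
    by (rule mult_left_mono; use r in simp)+
  ultimately show "norm (f w) \<le> 3 * norm (f z)" by linarith
qed

text \<open>Split \<open>1 - cnj w * z\<close> as (1 - |w|^2) - cnj w (z - w); the two terms
  contribute 2 and 3 times 1 - |w|.\<close>

lemma norm_one_minus_cnj_mult_le:
  assumes w: "norm w < 1" and z: "norm (z - w) < 3 * (1 - norm w)"
  shows "norm (1 - cnj w * z) \<le> 5 * (1 - norm w)"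
proof -
  have "1 - cnj w * z = of_real (1 - (norm w)\<^sup>2) - cnj w * (z - w)"
    using complex_norm_square[of w] by (simp add: algebra_simps)
  then have "norm (1 - cnj w * z) \<le> norm (of_real (1 - (norm w)\<^sup>2) :: complex) + norm (cnj w * (z - w))"
    by (simp only: norm_triangle_ineq4)
  also have "norm (of_real (1 - (norm w)\<^sup>2) :: complex) = \<bar>1 - (norm w)\<^sup>2\<bar>" by (rule norm_of_real)
  also have "norm (cnj w * (z - w)) = norm w * norm (z - w)" by (simp add: norm_mult)
  also have "\<bar>1 - (norm w)\<^sup>2\<bar> = 1 - (norm w)\<^sup>2" using w by (simp add: abs_square_le_1)
  also have "1 - (norm w)\<^sup>2 = (1 - norm w) * (1 + norm w)" by (simp add: power2_eq_square algebra_simps)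
  also have "(1 - norm w) * (1 + norm w) \<le> (1 - norm w) * 2" using w by (intro mult_left_mono) auto
  also have "norm w * norm (z - w) \<le> 1 * norm (z - w)" using w by (intro mult_right_mono) auto
  finally show ?thesis using z by linarith
qed

text \<open>Schwarz-Pick gives |f z| (1 - \<rho>^2) \<le> 4 |f w|, and 1 - \<rho>^2 is at least (1 -
  |z|) / (25 (1 - |w|)) for \<open>z\<close> this close to \<open>w\<close>. Consequently
  \<open>f\<close> can be large near \<open>w\<close> only in a thin layer at the boundary.\<close>

lemma half_plane_growth:
  assumes f: "f holomorphic_on ball 0 1" and pos: "\<And>u. norm u < 1 \<Longrightarrow> Re (f u) > 0"
    and w: "norm w < 1" and z1: "norm z < 1" and z: "norm (z - w) < 3 * (1 - norm w)"
  shows "norm (f z) * (1 - norm z) \<le> 100 * (1 - norm w) * norm (f w)"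
proof -
  define N where "N = norm (1 - cnj w * z)"
  define \<rho> where "\<rho> = norm (w - z) / N"
  define d where "d = 1 - norm w"
  have d: "d > 0" using w by (simp add: d_def)
  have N: "N > 0" "N \<le> 5 * d"
    using one_minus_cnj_mult_nonzero[OF w z1] norm_one_minus_cnj_mult_le[OF w z] by (auto simp: N_def d_def)
  have r1: "\<rho> < 1" "\<rho> \<ge> 0"
    using norm_disk_automorphism_lt_1[OF w z1] by (auto simp: \<rho>_def N_def norm_divide)
  have "norm (f z) * (1 - \<rho>) \<le> norm (f w) * (1 + \<rho>)"
    using schwarz_pick_half_plane[OF f pos w z1] by (simp add: norm_divide \<rho>_def N_def)
  \<comment> \<open>Multiplying by 1 + \<rho> produces 1 - \<rho>^2, which
    \<open>norm_one_minus_cnj_mult_sq\<close> evaluates exactly.\<close>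
  then have "norm (f z) * (1 - \<rho>) * (1 + \<rho>) \<le> norm (f w) * (1 + \<rho>) * (1 + \<rho>)"
    using r1 by (intro mult_right_mono) auto
  also have "\<dots> \<le> norm (f w) * (2 * 2)"
    unfolding mult.assoc using r1 by (intro mult_left_mono mult_mono) auto
  finally have 1: "norm (f z) * (1 - \<rho>\<^sup>2) \<le> 4 * norm (f w)"
    by (simp add: power2_eq_square algebra_simps)
  have "\<rho>\<^sup>2 * N\<^sup>2 = (norm (w - z))\<^sup>2" using N by (simp add: \<rho>_def power_divide)
  then have 2: "(1 - \<rho>\<^sup>2) * N\<^sup>2 = (1 - (norm w)\<^sup>2) * (1 - (norm z)\<^sup>2)"
    using norm_one_minus_cnj_mult_sq[of w z] by (simp add: N_def algebra_simps)
  have "d * (1 - norm z) \<le> (1 - (norm w)\<^sup>2) * (1 - (norm z)\<^sup>2)"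
    using w z1 by (intro mult_mono) (auto simp: d_def abs_square_le_1 mult_le_one power2_eq_square mult_left_le)
  also note 2[symmetric]
  also have "(1 - \<rho>\<^sup>2) * N\<^sup>2 \<le> (1 - \<rho>\<^sup>2) * (5 * d)\<^sup>2"
    using r1 N by (intro mult_left_mono power_mono) (auto simp: abs_square_le_1)
  finally have "d * (1 - norm z) \<le> d * ((1 - \<rho>\<^sup>2) * (25 * d))"
    by (simp add: power2_eq_square algebra_simps)
  then have 3: "1 - norm z \<le> (1 - \<rho>\<^sup>2) * (25 * d)" using d by simp
  have "norm (f z) * (1 - norm z) \<le> norm (f z) * ((1 - \<rho>\<^sup>2) * (25 * d))"
    using 3 by (rule mult_left_mono) simp
  also have "\<dots> = norm (f z) * (1 - \<rho>\<^sup>2) * (25 * d)" by simp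
  also have "\<dots> \<le> 4 * norm (f w) * (25 * d)" using 1 d by (intro mult_right_mono) auto
  finally show ?thesis by (simp add: d_def algebra_simps)
qed

section \<open>Area of superlevel sets of maps into the half plane\<close>

lemma emeasure_annulus:
  assumes "0 \<le> \<eta>" "\<eta> \<le> 1"
  shows "emeasure lborel {z::complex. 1 - \<eta> < norm z \<and> norm z < 1} \<le> ennreal (2 * pi * \<eta>)"
proof -
  have "{z::complex. 1 - \<eta> < norm z \<and> norm z < 1} = ball 0 1 - cball 0 (1 - \<eta>)" by auto
  also have "emeasure lborel \<dots> = emeasure lborel (ball (0::complex) 1) - emeasure lborel (cball (0::complex) (1 - \<eta>))"
  \<comment> \<open>For \<open>\<eta> = 0\<close> the closed disk is not contained in the open one,
    so this case is computed directly.\<close>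
  proof (cases "\<eta> = 0")
    case False
    then show ?thesis using assms
      by (intro emeasure_Diff) (auto simp: emeasure_cball)
  next
    case True
    then have "ball 0 1 - cball (0::complex) (1 - \<eta>) = {}" by auto
    then have "emeasure lborel (ball 0 1 - cball (0::complex) (1 - \<eta>)) = 0" by (simp only: emeasure_empty)
    then show ?thesis using True by (simp add: emeasure_cball emeasure_ball)
  qed
  also have "\<dots> = ennreal (pi - pi * (1 - \<eta>)\<^sup>2)"
    using assms by (simp add: emeasure_cball emeasure_ball unit_ball_vol_2 ennreal_minus)
  also have "\<dots> \<le> ennreal (2 * pi * \<eta>)"
    by (intro ennreal_leI) (simp add: power2_eq_square algebra_simps)
  finally show ?thesis .
qed

text \<open>The set lies in an annulus of width \<open>\<eta>\<close> by the growth bound, and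
  \<open>Re G\<close> times the Poisson kernel is at least 1 on it. Over the annulus that product
  integrates to the integral of \<open>Re G\<close> at points close to \<open>w\<close>, where
  \<open>Re G\<close> is at most 50 d * 27 / \<Lambda>. With annulus area at most 2 pi \<eta> this
  gives 50 * 27 * 2 * 900 = 2430000.\<close>

lemma half_plane_superlevel_local:
  assumes f: "f holomorphic_on ball 0 1" and pos: "\<And>u. norm u < 1 \<Longrightarrow> Re (f u) > 0"
    and w: "norm w < 1" and fw: "norm (f w) \<le> 9" and \<Lambda>: "\<Lambda> \<ge> 3600"
  shows "emeasure lborel {z. norm z < 1 \<and> \<Lambda> < norm (f z) \<and> norm (z - w) < 3 * (1 - norm w)}
    \<le> ennreal (2430000 * pi / \<Lambda>\<^sup>2 * (1 - norm w)\<^sup>2)" (is "emeasure _ ?E \<le> _")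
proof -
  define d where "d = 1 - norm w"
  \<comment> \<open>The bound 100 d |f w| \<le> 900 d of \<open>half_plane_growth\<close>, divided
    by \<Lambda>. The threshold 3600 makes this at most d / 4.\<close>
  define \<eta> where "\<eta> = 900 * d / \<Lambda>"
  have d: "0 < d" "d \<le> 1" using w by (auto simp: d_def)
  have \<eta>: "0 < \<eta>" "\<eta> \<le> d / 4" "\<eta> \<le> 1" using d \<Lambda> by (auto simp: \<eta>_def divide_simps)
  define S where "S = {z::complex. 1 - \<eta> < norm z \<and> norm z < 1}"
  \<comment> \<open>The factor \<open>50 * d\<close> compensates the value 1/2 that the real part of
    the quotient reaches for |f| > \<Lambda> and the lower bound 1 / (25 d) of the kernel.\<close>
  define G where "G u = 50 * d * (f u / (\<Lambda> + f u))" for u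
  have nz: "\<Lambda> + f u \<noteq> 0" if "norm u < 1" for u
  proof
    assume "\<Lambda> + f u = 0"
    from arg_cong[OF this, of Re] have "\<Lambda> + Re (f u) = 0" by simp
    then show False using pos[OF that] \<Lambda> by simp
  qed
  have G: "G holomorphic_on ball 0 1"
    unfolding G_def by (intro holomorphic_intros f) (use nz in auto)
  have ReG: "Re (G u) = 50 * d * (((norm (f u))\<^sup>2 + \<Lambda> * Re (f u)) / (norm (\<Lambda> + f u))\<^sup>2)" for u
  proof -
    have "Re (f u / (\<Lambda> + f u)) = ((norm (f u))\<^sup>2 + \<Lambda> * Re (f u)) / (norm (\<Lambda> + f u))\<^sup>2"
      by (simp add: Re_divide cmod_power2) (simp add: power2_eq_square algebra_simps)
    moreover have "Re (complex_of_real (50 * d) * x) = 50 * d * Re x" for x by simp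
    ultimately show ?thesis unfolding G_def by metis
  qed
  have Gpos: "Re (G u) \<ge> 0" if "norm u < 1" for u
    unfolding ReG using pos[OF that] \<Lambda> d by (intro mult_nonneg_nonneg divide_nonneg_nonneg) auto
  have Gbig: "Re (G u) \<ge> 25 * d" if "norm u < 1" "\<Lambda> < norm (f u)" for u
  proof -
    have "(norm (\<Lambda> + f u))\<^sup>2 = \<Lambda>\<^sup>2 + 2 * \<Lambda> * Re (f u) + (norm (f u))\<^sup>2"
      by (simp add: cmod_power2) (simp add: power2_eq_square algebra_simps)
    moreover have "\<Lambda>\<^sup>2 \<le> (norm (f u))\<^sup>2" using that \<Lambda> by (intro power_mono) auto
    ultimately have "(norm (\<Lambda> + f u))\<^sup>2 \<le> 2 * ((norm (f u))\<^sup>2 + \<Lambda> * Re (f u))" by simp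
    then have "1 / 2 \<le> ((norm (f u))\<^sup>2 + \<Lambda> * Re (f u)) / (norm (\<Lambda> + f u))\<^sup>2"
      using nz[OF that(1)] by (simp add: field_simps)
    from mult_left_mono[OF this, of "50 * d"] show ?thesis unfolding ReG using d by simp
  qed
  have Gsmall: "Re (G u) \<le> 50 * d * (norm (f u) / \<Lambda>)" if "norm u < 1" for u
  proof -
    have "Re (G u) \<le> norm (G u)" by (rule complex_Re_le_cmod)
    also have "\<dots> = 50 * d * (norm (f u) / norm (\<Lambda> + f u))"
      using d by (simp add: G_def norm_mult norm_divide)
    also have "\<Lambda> \<le> norm (\<Lambda> + f u)"
      using complex_Re_le_cmod[of "\<Lambda> + f u"] pos[OF that] by simp
    then have "50 * d * (norm (f u) / norm (\<Lambda> + f u)) \<le> 50 * d * (norm (f u) / \<Lambda>)"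
      using d \<Lambda> by (intro mult_left_mono divide_left_mono) (auto intro!: mult_pos_pos)
    finally show ?thesis .
  qed
  have P: "1 / (25 * d) \<le> poisson w z" if "norm z < 1" "norm (z - w) < 3 * d" for z
  proof -
    have N: "norm (1 - cnj w * z) \<le> 5 * d" "norm (1 - cnj w * z) > 0"
      using norm_one_minus_cnj_mult_le[OF w] one_minus_cnj_mult_nonzero[OF w] that by (auto simp: d_def)
    have "(norm w)\<^sup>2 * (norm z)\<^sup>2 \<le> norm w * 1"
      using w that by (intro mult_mono) (auto simp: power2_eq_square mult_left_le abs_square_le_1 mult_le_one)
    then have "d \<le> 1 - (norm w)\<^sup>2 * (norm z)\<^sup>2" by (simp add: d_def)
    then have "d / (5 * d)\<^sup>2 \<le> poisson w z"
      unfolding poisson_def using N d by (intro frac_le power_mono zero_less_power) auto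
    moreover have "d / (5 * d)\<^sup>2 = 1 / (25 * d)" using d by (simp add: power2_eq_square)
    ultimately show ?thesis by simp
  qed
  have ES: "z \<in> S" if "z \<in> ?E" for z
  proof -
    have "\<Lambda> * (1 - norm z) \<le> norm (f z) * (1 - norm z)" using that by (intro mult_right_mono) auto
    also have "\<dots> \<le> 100 * d * norm (f w)"
      using half_plane_growth[OF f pos w, of z] that by (auto simp: d_def)
    also have "\<dots> \<le> 100 * d * 9" using fw d by (intro mult_left_mono) auto
    finally have "1 - norm z \<le> \<eta>" using \<Lambda> by (simp add: \<eta>_def field_simps)
    \<comment> \<open>The annulus omits its inner circle, so equality is excluded through the strict
      inequality \<Lambda> < |f z|.\<close>
    moreover have "1 - norm z \<noteq> \<eta>"
    proof
      assume "1 - norm z = \<eta>"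
      have "\<Lambda> * (1 - norm z) < norm (f z) * (1 - norm z)" using that by (intro mult_strict_right_mono) auto
      also have "\<dots> \<le> 100 * d * norm (f w)"
        using half_plane_growth[OF f pos w, of z] that by (auto simp: d_def)
      also have "\<dots> \<le> 100 * d * 9" using fw d by (intro mult_left_mono) auto
      finally show False using \<open>1 - norm z = \<eta>\<close> \<Lambda> by (simp add: \<eta>_def field_simps)
    qed
    ultimately show ?thesis using that by (auto simp: S_def)
  qed
  have [measurable]: "(\<lambda>x. indicator (ball 0 1) x *\<^sub>R f x) \<in> borel_measurable borel"
    by (intro borel_measurable_indicator_holomorphic f open_ball)
  have "?E = {z. norm z < 1 \<and> \<Lambda> < norm (indicator (ball 0 1) z *\<^sub>R f z) \<and> norm (z - w) < 3 * (1 - norm w)}"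
    by (auto simp: indicator_def)
  also have "\<dots> \<in> sets borel" by measurable
  finally have [measurable]: "?E \<in> sets borel" .
  have "emeasure lborel ?E = (\<integral>\<^sup>+z. indicator ?E z \<partial>lborel)"
    by (rule nn_integral_indicator[symmetric]) (use \<open>?E \<in> sets borel\<close> in simp)
  also have "\<dots> \<le> (\<integral>\<^sup>+z. ennreal (Re (G z) * poisson w z) * indicator S z \<partial>lborel)"
  proof (rule nn_integral_mono)
    fix z
    show "indicator ?E z \<le> ennreal (Re (G z) * poisson w z) * indicator S z"
    proof (cases "z \<in> ?E")
      case True
      then have "1 \<le> Re (G z) * poisson w z"
        using mult_mono[of "25 * d" "Re (G z)" "1 / (25 * d)" "poisson w z"] Gbig[of z] P[of z] d by (auto simp: d_def)
      then show ?thesis using True ES[OF True] by simp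
    qed simp
  qed
  also have "\<dots> = (\<integral>\<^sup>+z. ennreal (Re (G ((norm z)\<^sup>2 * w))) * indicator S z \<partial>lborel)"
    unfolding S_def by (rule nn_integral_poisson_annulus[OF G w Gpos])
  also have "\<dots> \<le> (\<integral>\<^sup>+z. ennreal (50 * d * (27 / \<Lambda>)) * indicator S z \<partial>lborel)"
  proof (rule nn_integral_mono)
    fix z
    show "ennreal (Re (G ((norm z)\<^sup>2 * w))) * indicator S z \<le> ennreal (50 * d * (27 / \<Lambda>)) * indicator S z"
    proof (cases "z \<in> S")
      case True
      \<comment> \<open>Here 1 - |z|^2 \<le> 2 \<eta> \<le> d / 2, so \<open>u\<close> is in the
        Whitney ball at \<open>w\<close> and |f u| \<le> 3 * 9.\<close>
      define u where "u = (norm z)\<^sup>2 * w"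
      have z: "1 - \<eta> < norm z" "norm z < 1" using True by (auto simp: S_def)
      have "(1 - \<eta>)\<^sup>2 \<le> (norm z)\<^sup>2" using z \<eta> by (intro power_mono) auto
      moreover have "1 - 2 * \<eta> \<le> (1 - \<eta>)\<^sup>2" by (simp add: power2_eq_square algebra_simps)
      ultimately have a: "1 - (norm z)\<^sup>2 \<le> d / 2" using \<eta> by linarith
      have b: "0 \<le> 1 - (norm z)\<^sup>2" using z by (simp add: abs_square_le_1)
      have "u - w = - (of_real (1 - (norm z)\<^sup>2) * w)" by (simp add: u_def algebra_simps)
      then have "norm (u - w) = (1 - (norm z)\<^sup>2) * norm w"
        by (simp only: norm_minus_cancel norm_mult norm_of_real abs_of_nonneg[OF b])
      also have "\<dots> \<le> (1 - (norm z)\<^sup>2) * 1" using w b by (intro mult_left_mono) auto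
      finally have uw: "norm (u - w) \<le> (1 - norm w) / 2" using a by (simp add: d_def)
      have u1: "norm u < 1" using norm_triangle_ineq2[of u w] w uw by simp
      have "norm (f u) \<le> 3 * norm (f w)" by (rule half_plane_le_on_whitney_ball[OF f pos w uw])
      then have "norm (f u) \<le> 27" using fw by simp
      then have "50 * d * (norm (f u) / \<Lambda>) \<le> 50 * d * (27 / \<Lambda>)"
        using d \<Lambda> by (intro mult_left_mono divide_right_mono) auto
      then have "Re (G u) \<le> 50 * d * (27 / \<Lambda>)" using Gsmall[OF u1] by linarith
      then show ?thesis using True by (simp add: u_def ennreal_leI)
    qed simp
  qed
  also have "\<dots> = ennreal (50 * d * (27 / \<Lambda>)) * emeasure lborel S"
    by (rule nn_integral_cmult_indicator) (simp add: S_def)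
  also have "\<dots> \<le> ennreal (50 * d * (27 / \<Lambda>)) * ennreal (2 * pi * \<eta>)"
    unfolding S_def using \<eta> by (intro mult_left_mono emeasure_annulus) auto
  also have "\<dots> = ennreal (50 * d * (27 / \<Lambda>) * (2 * pi * \<eta>))"
    using d \<eta> \<Lambda> by (intro ennreal_mult[symmetric]) auto
  also have "50 * d * (27 / \<Lambda>) * (2 * pi * \<eta>) = 2430000 * pi / \<Lambda>\<^sup>2 * d\<^sup>2"
    by (simp add: \<eta>_def power2_eq_square)
  finally show ?thesis by (simp add: d_def)
qed


text \<open>Integrate the kernel \<open>k\<close> in both orders. For fixed \<open>w\<close> in
  \<open>Om\<close> the local bound cancels the weight and leaves 2430000 pi / \<Lambda>^2. For
  fixed \<open>z\<close> in \<open>E\<close> the integral is at least pi / 9, because a whole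
  Whitney ball around some point of the radius to \<open>z\<close> contributes. The quotient of the
  two constants is 21870000 / \<Lambda>^2.\<close>

lemma half_plane_superlevel:
  assumes f: "f holomorphic_on ball 0 1" and pos: "\<And>u. norm u < 1 \<Longrightarrow> Re (f u) > 0"
    and f0: "norm (f 0) < 3" and \<Lambda>: "\<Lambda> \<ge> 3600"
  shows "emeasure lborel {z. norm z < 1 \<and> \<Lambda> < norm (f z)}
    \<le> ennreal (21870000 / \<Lambda>\<^sup>2) * emeasure lborel {z. norm z < 1 \<and> 1 \<le> norm (f z)}"
proof -
  define F where "F x = indicator (ball 0 1) x *\<^sub>R f x" for x
  have [measurable]: "F \<in> borel_measurable borel"
    unfolding F_def by (intro borel_measurable_indicator_holomorphic f open_ball)
  define E where "E = {z. norm z < 1 \<and> \<Lambda> < norm (F z)}"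
  \<comment> \<open>The bounds 1 and 9 are 3 / 3 and 3 * 3, the range allowed for |f| on a Whitney
    ball around a point where |f| = 3.\<close>
  define Om where "Om = {z. norm z < 1 \<and> 1 \<le> norm (F z) \<and> norm (F z) \<le> 9}"
  have Ff: "F z = f z" if "norm z < 1" for z using that by (simp add: F_def)
  have [measurable]: "E \<in> sets borel" "Om \<in> sets borel"
    unfolding E_def Om_def by measurable
  define k where "k z w = ennreal (1 / (1 - norm w)\<^sup>2) * indicator E z * indicator Om w
    * indicator {p. norm (fst p - snd p) < 3 * (1 - norm (snd p))} (z, w)" for z w :: complex
  have [measurable]: "(\<lambda>(z, w). k z w) \<in> borel_measurable (lborel \<Otimes>\<^sub>M lborel)"
    unfolding k_def by measurable
  have inner_z: "(\<integral>\<^sup>+z. k z w \<partial>lborel) \<le> ennreal (2430000 * pi / \<Lambda>\<^sup>2) * indicator Om w" for w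
  proof (cases "w \<in> Om")
    case True
    then have w: "norm w < 1" "norm (f w) \<le> 9" by (auto simp: Om_def Ff)
    define E' where "E' = {z. norm z < 1 \<and> \<Lambda> < norm (f z) \<and> norm (z - w) < 3 * (1 - norm w)}"
    have E': "E' = E \<inter> {z. norm (z - w) < 3 * (1 - norm w)}" by (auto simp: E'_def E_def Ff)
    have [measurable]: "E' \<in> sets borel" unfolding E' by measurable
    have "(\<integral>\<^sup>+z. k z w \<partial>lborel) = (\<integral>\<^sup>+z. ennreal (1 / (1 - norm w)\<^sup>2) * indicator E' z \<partial>lborel)"
      using True by (intro nn_integral_cong) (auto simp: k_def E' split: split_indicator)
    also have "\<dots> = ennreal (1 / (1 - norm w)\<^sup>2) * emeasure lborel E'"
      by (rule nn_integral_cmult_indicator) simp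
    also have "\<dots> \<le> ennreal (1 / (1 - norm w)\<^sup>2) * ennreal (2430000 * pi / \<Lambda>\<^sup>2 * (1 - norm w)\<^sup>2)"
      unfolding E'_def by (intro mult_left_mono half_plane_superlevel_local f pos w \<Lambda>) auto
    also have "\<dots> = ennreal (2430000 * pi / \<Lambda>\<^sup>2)"
      using w by (subst ennreal_mult[symmetric]) auto
    finally show ?thesis using True by simp
  qed (simp add: k_def)
  have inner_w: "ennreal (pi / 9) * indicator E z \<le> (\<integral>\<^sup>+w. k z w \<partial>lborel)" for z
  proof (cases "z \<in> E")
    case True
    then have z: "norm z < 1" "\<Lambda> < norm (f z)" by (auto simp: E_def Ff)
    have rz: "r * norm z < 1" if "0 \<le> r" "r \<le> 1" for r
      using mult_left_le_one_le[of "norm z" r] z that by simp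
    \<comment> \<open>Along the radius |f| passes from below 3 at the origin to above \<Lambda> at
      \<open>z\<close>.\<close>
    have "\<exists>r\<ge>0. r \<le> 1 \<and> norm (f (of_real r * z)) = 3"
    proof (rule IVT')
      show "continuous_on {0..1} (\<lambda>r. norm (f (of_real r * z)))"
        using z by (intro continuous_intros continuous_on_compose2[OF holomorphic_on_imp_continuous_on[OF f]])
          (auto simp: norm_mult rz)
    qed (use z f0 \<Lambda> in auto)
    then obtain r where r: "0 \<le> r" "r \<le> 1" "norm (f (of_real r * z)) = 3" by blast
    define w where "w = of_real r * z"
    define d where "d = 1 - norm w"
    have "norm w \<le> norm z" using r by (simp add: w_def norm_mult mult_left_le_one_le)
    then have d: "d > 0" "norm w < 1" using z by (auto simp: d_def)
    have "z - w = of_real (1 - r) * z" by (simp add: w_def algebra_simps)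
    then have "norm (z - w) = (1 - r) * norm z" using r by (simp only: norm_mult norm_of_real abs_of_nonneg diff_ge_0_iff_ge)
    then have zw: "norm (z - w) = norm z - norm w" using r by (simp add: w_def norm_mult algebra_simps)
    have sub: "ennreal (4 / (9 * d\<^sup>2)) * indicator (ball w (d / 2)) w' \<le> k z w'" for w'
    proof (cases "w' \<in> ball w (d / 2)")
      case True
      then have ww: "norm (w' - w) < d / 2" by (simp add: dist_norm norm_minus_commute)
      have n1: "norm w' \<le> norm w + d / 2" "norm w \<le> norm w' + d / 2"
        using ww norm_triangle_ineq2[of w' w] norm_triangle_ineq3[of w' w] by linarith+
      have d': "d / 2 \<le> 1 - norm w'" "1 - norm w' \<le> 3 / 2 * d" using n1 by (simp_all add: d_def field_simps)
      have w'1: "norm w' < 1" using d' d by simp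
      have "norm (f w') \<le> 3 * norm (f w)" "norm (f w) \<le> 3 * norm (f w')"
        using half_plane_le_on_whitney_ball[OF f pos d(2), of w'] ww by (simp_all add: d_def)
      then have "w' \<in> Om" using r(3) w'1 by (simp add: Om_def Ff w_def)
      \<comment> \<open>This is where the factor 3 in the kernel comes from: the distance is less
        than d + d / 2, while 1 - |w'| is at least d / 2.\<close>
      moreover have "norm (z - w') < 3 * (1 - norm w')"
      proof -
        have "norm (z - w') \<le> norm (z - w) + norm (w - w')"
          using norm_triangle_ineq[of "z - w" "w - w'"] by simp
        also have "\<dots> < d + d / 2" using ww zw z by (simp add: d_def norm_minus_commute diff_divide_distrib)
        also have "\<dots> \<le> 3 * (1 - norm w')" using d' by simp
        finally show ?thesis .
      qed
      ultimately have "k z w' = ennreal (1 / (1 - norm w')\<^sup>2)" using \<open>z \<in> E\<close> by (simp add: k_def)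
      moreover have "4 / (9 * d\<^sup>2) \<le> 1 / (1 - norm w')\<^sup>2"
      proof -
        have "(1 - norm w')\<^sup>2 \<le> (3 / 2 * d)\<^sup>2" using d' d by (intro power_mono) auto
        also have "\<dots> = 9 * d\<^sup>2 / 4" by (simp add: power2_eq_square)
        finally have "1 / (9 * d\<^sup>2 / 4) \<le> 1 / (1 - norm w')\<^sup>2" using d' d by (intro divide_left_mono) auto
        then show ?thesis by simp
      qed
      ultimately show ?thesis using True by (simp add: ennreal_leI)
    qed simp
    have "ennreal (pi / 9) = ennreal (4 / (9 * d\<^sup>2)) * ennreal (pi * (d / 2)\<^sup>2)"
      using d by (subst ennreal_mult[symmetric]) (auto simp: power2_eq_square)
    also have "\<dots> = ennreal (4 / (9 * d\<^sup>2)) * emeasure lborel (ball w (d / 2))"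
      using d by (simp add: emeasure_lborel_ball_complex)
    also have "\<dots> = (\<integral>\<^sup>+w'. ennreal (4 / (9 * d\<^sup>2)) * indicator (ball w (d / 2)) w' \<partial>lborel)"
      by (rule nn_integral_cmult_indicator[symmetric]) simp
    also have "\<dots> \<le> (\<integral>\<^sup>+w'. k z w' \<partial>lborel)" by (intro nn_integral_mono sub)
    finally show ?thesis using True by simp
  qed simp
  have "ennreal (pi / 9) * emeasure lborel E = (\<integral>\<^sup>+z. ennreal (pi / 9) * indicator E z \<partial>lborel)"
    by (rule nn_integral_cmult_indicator[symmetric]) simp
  also have "\<dots> \<le> (\<integral>\<^sup>+z. (\<integral>\<^sup>+w. k z w \<partial>lborel) \<partial>lborel)" by (intro nn_integral_mono inner_w)
  also have "\<dots> = (\<integral>\<^sup>+w. (\<integral>\<^sup>+z. k z w \<partial>lborel) \<partial>lborel)" by (rule lborel_pair.Fubini') measurable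
  also have "\<dots> \<le> (\<integral>\<^sup>+w. ennreal (2430000 * pi / \<Lambda>\<^sup>2) * indicator Om w \<partial>lborel)"
    by (intro nn_integral_mono inner_z)
  also have "\<dots> = ennreal (2430000 * pi / \<Lambda>\<^sup>2) * emeasure lborel Om"
    by (rule nn_integral_cmult_indicator) simp
  finally have *: "ennreal (pi / 9) * emeasure lborel E \<le> ennreal (2430000 * pi / \<Lambda>\<^sup>2) * emeasure lborel Om" .
  have "emeasure lborel E = ennreal (9 / pi) * (ennreal (pi / 9) * emeasure lborel E)"
    by (simp add: mult.assoc[symmetric] ennreal_mult[symmetric])
  also have "\<dots> \<le> ennreal (9 / pi) * (ennreal (2430000 * pi / \<Lambda>\<^sup>2) * emeasure lborel Om)"
    using * by (rule mult_left_mono) simp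
  also have "\<dots> = ennreal (21870000 / \<Lambda>\<^sup>2) * emeasure lborel Om"
    by (simp add: mult.assoc[symmetric] ennreal_mult[symmetric])
  also have "\<dots> \<le> ennreal (21870000 / \<Lambda>\<^sup>2) * emeasure lborel {z. norm z < 1 \<and> 1 \<le> norm (F z)}"
    by (intro mult_left_mono emeasure_mono) (auto simp: Om_def)
  also have "{z. norm z < 1 \<and> 1 \<le> norm (F z)} = {z. norm z < 1 \<and> 1 \<le> norm (f z)}"
    by (auto simp: Ff)
  also have "E = {z. norm z < 1 \<and> \<Lambda> < norm (f z)}" by (auto simp: E_def Ff)
  finally show ?thesis .
qed

subsection \<open>Homogeneity of the Carleson function\<close>

lemma space_areaD [simp]: "space areaD = unit_disk"
  by (simp add: areaD_def space_restrict_space space_scale_measure)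

lemma sets_areaD: "sets areaD = sets (restrict_space borel unit_disk)"
  by (simp add: areaD_def cong: sets_restrict_space_cong)

lemma unit_disk_borel [measurable]: "unit_disk \<in> sets borel"
  by (simp add: unit_disk_def)

lemma sets_areaD_iff: "E \<in> sets areaD \<longleftrightarrow> E \<in> sets borel \<and> E \<subseteq> unit_disk"
  unfolding sets_areaD by (subst sets_restrict_space_iff) auto

lemma nn_integral_areaD:
  assumes "H \<in> borel_measurable areaD"
  shows "(\<integral>\<^sup>+z. H z \<partial>areaD) = ennreal (1 / pi) * (\<integral>\<^sup>+z. H z * indicator unit_disk z \<partial>lborel)"
proof -
  have "H \<in> borel_measurable (restrict_space lborel unit_disk)"
    using assms by (simp add: areaD_def cong: measurable_cong_sets)
  then show ?thesis
    unfolding areaD_def by (simp add: nn_integral_scale_measure nn_integral_restrict_space)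
qed

lemma emeasure_areaD: "E \<in> sets borel \<Longrightarrow> E \<subseteq> unit_disk \<Longrightarrow> emeasure areaD E = ennreal (1 / pi) * emeasure lborel E"
  unfolding areaD_def by (simp add: emeasure_restrict_space)

lemma emeasure_areaD_unit_disk: "emeasure areaD unit_disk = 1"
  using emeasure_lborel_ball_complex[of 1 0]
  by (simp add: emeasure_areaD unit_disk_def ennreal_mult[symmetric])

interpretation areaD: finite_measure areaD
  by (rule finite_measureI) (simp add: emeasure_areaD_unit_disk)

lemma measure_areaD_le_1: "measure areaD E \<le> 1"
  using areaD.bounded_measure[of E] emeasure_areaD_unit_disk by (simp add: measure_def)

lemma borel_measurable_areaD_holomorphic:
  "f holomorphic_on unit_disk \<Longrightarrow> f \<in> borel_measurable areaD"
  using borel_measurable_continuous_on_restrict[OF holomorphic_on_imp_continuous_on]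
    measurable_cong_sets[OF sets_areaD refl] by blast

lemma borel_measurable_areaD: "H \<in> measurable borel N \<Longrightarrow> H \<in> measurable areaD N"
  unfolding measurable_cong_sets[OF sets_areaD refl] by (rule measurable_restrict_space1)

lemma borel_measurable_comp_areaD:
  assumes "\<phi> holomorphic_on unit_disk" "\<phi> ` unit_disk \<subseteq> unit_disk" "f holomorphic_on unit_disk"
  shows "(\<lambda>z. f (\<phi> z)) \<in> borel_measurable areaD"
  using holomorphic_on_compose_gen[OF assms(1,3,2)] by (simp add: o_def borel_measurable_areaD_holomorphic)

text \<open>The Carleson function with Euclidean discs in place of windows. The sets {|\<phi> -
  \<xi>| < t} are superlevel sets of 1 / |1 - cnj \<xi> \<phi>|, to which the half plane estimate
  applies.\<close>

definition disc_rho :: "(complex \<Rightarrow> complex) \<Rightarrow> real \<Rightarrow> real" where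
  "disc_rho \<phi> t = (SUP \<xi>\<in>sphere 0 1. measure areaD {z \<in> unit_disk. norm (\<phi> z - \<xi>) < t})"

lemma preimage_disc_sets_areaD:
  assumes "\<phi> holomorphic_on unit_disk"
  shows "{z \<in> unit_disk. norm (\<phi> z - \<xi>) < t} \<in> sets areaD"
proof -
  have [measurable]: "\<phi> \<in> borel_measurable areaD" using assms by (rule borel_measurable_areaD_holomorphic)
  have "{z \<in> space areaD. norm (\<phi> z - \<xi>) < t} \<in> sets areaD" by measurable
  then show ?thesis by simp
qed

lemma disc_rho_bdd: "bdd_above ((\<lambda>\<xi>. measure areaD {z \<in> unit_disk. norm (\<phi> z - \<xi>) < t}) ` S)"
  by (intro bdd_aboveI[of _ 1]) (auto intro: measure_areaD_le_1)

lemma disc_rho_upper: "norm \<xi> = 1 \<Longrightarrow> measure areaD {z \<in> unit_disk. norm (\<phi> z - \<xi>) < t} \<le> disc_rho \<phi> t"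
  unfolding disc_rho_def by (intro cSUP_upper disc_rho_bdd) auto

lemma disc_rho_leI:
  "(\<And>\<xi>. norm \<xi> = 1 \<Longrightarrow> measure areaD {z \<in> unit_disk. norm (\<phi> z - \<xi>) < t} \<le> a) \<Longrightarrow> disc_rho \<phi> t \<le> a"
  unfolding disc_rho_def by (intro cSUP_least) auto

lemma disc_rho_nonneg: "disc_rho \<phi> t \<ge> 0"
  using disc_rho_upper[of 1 \<phi> t] by (meson measure_nonneg norm_one order_trans)

lemma disc_rho_mono:
  assumes "\<phi> holomorphic_on unit_disk" "t \<le> t'"
  shows "disc_rho \<phi> t \<le> disc_rho \<phi> t'"
proof (rule disc_rho_leI)
  fix \<xi> :: complex assume "norm \<xi> = 1"
  have "measure areaD {z \<in> unit_disk. norm (\<phi> z - \<xi>) < t} \<le> measure areaD {z \<in> unit_disk. norm (\<phi> z - \<xi>) < t'}"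
    using assms by (intro areaD.finite_measure_mono preimage_disc_sets_areaD) auto
  also have "\<dots> \<le> disc_rho \<phi> t'" by (rule disc_rho_upper) fact
  finally show "measure areaD {z \<in> unit_disk. norm (\<phi> z - \<xi>) < t} \<le> disc_rho \<phi> t'" .
qed

text \<open>Apply \<open>half_plane_superlevel\<close> with \<Lambda> = 1 / (2 \<epsilon>), so that
  87480000 = 4 * 21870000. The assumption \<open>t \<le> 1 - norm (\<phi> 0)\<close> keeps |f 0| at
  most 1/2.\<close>

lemma disc_rho_homogeneity:
  assumes \<phi>: "\<phi> holomorphic_on unit_disk" "\<phi> ` unit_disk \<subseteq> unit_disk"
    and t: "0 < t" "t \<le> 1 - norm (\<phi> 0)" and \<epsilon>: "0 < \<epsilon>" "\<epsilon> \<le> 1"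
  shows "disc_rho \<phi> (\<epsilon> * t) \<le> 87480000 * \<epsilon>\<^sup>2 * disc_rho \<phi> t"
\<comment> \<open>Exactly for \<epsilon> \<le> 1 / 7200 is \<Lambda> \<ge> 3600. For larger
  \<epsilon> the constant times \<epsilon>^2 exceeds 1 and monotonicity suffices.\<close>
proof (cases "\<epsilon> \<le> 1 / 7200")
  case False
  then have "(1 / 7200)\<^sup>2 \<le> \<epsilon>\<^sup>2" by (intro power_mono) auto
  then have "1 \<le> 87480000 * \<epsilon>\<^sup>2" by (simp add: power2_eq_square)
  have "disc_rho \<phi> (\<epsilon> * t) \<le> disc_rho \<phi> t"
    using t \<epsilon> by (intro disc_rho_mono \<phi>) (simp add: mult_left_le_one_le)
  also have "\<dots> \<le> 87480000 * \<epsilon>\<^sup>2 * disc_rho \<phi> t"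
    using mult_right_mono[OF \<open>1 \<le> _\<close> disc_rho_nonneg[of \<phi> t]] by simp
  finally show ?thesis .
next
  case True
  show ?thesis
  proof (rule disc_rho_leI)
    fix \<xi> :: complex assume \<xi>: "norm \<xi> = 1"
    define S where "S t = {z \<in> unit_disk. norm (\<phi> z - \<xi>) < t}" for t
    have Sm: "S t \<in> sets areaD" for t unfolding S_def by (rule preimage_disc_sets_areaD[OF \<phi>(1)])
    have \<phi>1: "norm (\<phi> u) < 1" if "norm u < 1" for u
    proof -
      have "u \<in> unit_disk" using that by (simp add: unit_disk_def)
      then have "\<phi> u \<in> unit_disk" using \<phi>(2) by blast
      then show ?thesis by (simp add: unit_disk_def)
    qed
    \<comment> \<open>Since |f| = (t / 2) / |\<phi> - \<xi>|, the set {|f| > 1 / (2 \<epsilon>)} is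
      the disc preimage for \<epsilon> t. The half leaves room to place the closed condition |f|
      \<ge> 1 inside the open disc of radius t.\<close>
    define f where "f u = of_real (t / 2) / (1 - cnj \<xi> * \<phi> u)" for u
    have Re_lt: "Re (cnj \<xi> * \<phi> u) < 1" if "norm u < 1" for u
      using complex_Re_le_cmod[of "cnj \<xi> * \<phi> u"] \<phi>1[OF that] \<xi> by (simp add: norm_mult)
    have nz: "1 - cnj \<xi> * \<phi> u \<noteq> 0" if "norm u < 1" for u
    proof
      assume "1 - cnj \<xi> * \<phi> u = 0"
      from arg_cong[OF this, of Re] show False using Re_lt[OF that] by simp
    qed
    have f: "f holomorphic_on ball 0 1"
      unfolding f_def using \<phi>(1) nz by (intro holomorphic_intros) (auto simp: unit_disk_def)
    have pos: "Re (f u) > 0" if "norm u < 1" for u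
    proof -
      have "Re (complex_of_real c / a) = c * Re a / (norm a)\<^sup>2" for c a
        by (simp add: Re_divide cmod_power2)
      from this[of "t / 2"] have "Re (f u) = (t / 2) * Re (1 - cnj \<xi> * \<phi> u) / (norm (1 - cnj \<xi> * \<phi> u))\<^sup>2"
        unfolding f_def .
      also have "\<dots> > 0" using t Re_lt[OF that] nz[OF that] by (intro divide_pos_pos mult_pos_pos) auto
      finally show ?thesis .
    qed
    have "cnj \<xi> * \<xi> = 1" using complex_norm_square[of \<xi>] \<xi> by (simp add: mult.commute)
    then have "1 - cnj \<xi> * \<phi> u = - (cnj \<xi> * (\<phi> u - \<xi>))" for u by (simp add: algebra_simps)
    then have dist: "norm (1 - cnj \<xi> * \<phi> u) = norm (\<phi> u - \<xi>)" for u
      using \<xi> by (simp only: norm_minus_cancel norm_mult complex_mod_cnj mult_1)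
    have nf: "norm (f u) = (t / 2) / norm (\<phi> u - \<xi>)" for u
      unfolding f_def norm_divide dist norm_of_real using t by simp
    have dpos: "norm (\<phi> u - \<xi>) > 0" if "norm u < 1" for u
      unfolding dist[symmetric] zero_less_norm_iff using nz[OF that] .
    have "1 - norm (\<phi> 0) \<le> norm (\<phi> 0 - \<xi>)"
      using norm_triangle_ineq2[of \<xi> "\<phi> 0"] \<xi> by (simp add: norm_minus_commute)
    then have "norm (f 0) < 3"
      using t dpos[of 0] by (simp add: nf divide_less_eq)
    moreover have "1 / (2 * \<epsilon>) \<ge> 3600" using True \<epsilon> by (simp add: le_divide_eq)
    ultimately have "emeasure lborel {z. norm z < 1 \<and> 1 / (2 * \<epsilon>) < norm (f z)}
      \<le> ennreal (21870000 / (1 / (2 * \<epsilon>))\<^sup>2) * emeasure lborel {z. norm z < 1 \<and> 1 \<le> norm (f z)}"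
      using f pos by (intro half_plane_superlevel) auto
    also have "{z. norm z < 1 \<and> 1 / (2 * \<epsilon>) < norm (f z)} = S (\<epsilon> * t)"
      using dpos \<epsilon> by (auto simp: S_def nf unit_disk_def field_simps)
    also have "21870000 / (1 / (2 * \<epsilon>))\<^sup>2 = 87480000 * \<epsilon>\<^sup>2"
      by (simp add: power_divide power_mult_distrib)
    also have "emeasure lborel {z. norm z < 1 \<and> 1 \<le> norm (f z)} \<le> emeasure lborel (S t)"
    proof (rule emeasure_mono)
      show "{z. norm z < 1 \<and> 1 \<le> norm (f z)} \<subseteq> S t"
      proof
        fix z assume z: "z \<in> {z. norm z < 1 \<and> 1 \<le> norm (f z)}"
        then have "norm (\<phi> z - \<xi>) \<le> t / 2" using dpos[of z] by (simp add: nf le_divide_eq)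
        then show "z \<in> S t" using z t by (simp add: S_def unit_disk_def)
      qed
      show "S t \<in> sets lborel" using Sm[of t] by (simp add: sets_areaD_iff)
    qed
    finally have "emeasure lborel (S (\<epsilon> * t)) \<le> ennreal (87480000 * \<epsilon>\<^sup>2) * emeasure lborel (S t)"
      by (simp add: mult_left_mono)
    then have "ennreal (1 / pi) * emeasure lborel (S (\<epsilon> * t)) \<le> ennreal (1 / pi) * (ennreal (87480000 * \<epsilon>\<^sup>2) * emeasure lborel (S t))"
      by (rule mult_left_mono) simp
    then have "emeasure areaD (S (\<epsilon> * t)) \<le> ennreal (87480000 * \<epsilon>\<^sup>2) * emeasure areaD (S t)"
      using Sm[of t] Sm[of "\<epsilon> * t"] by (simp add: sets_areaD_iff emeasure_areaD mult_ac)
    then have "measure areaD (S (\<epsilon> * t)) \<le> 87480000 * \<epsilon>\<^sup>2 * measure areaD (S t)"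
      by (simp add: areaD.emeasure_eq_measure ennreal_mult[symmetric])
    also have "\<dots> \<le> 87480000 * \<epsilon>\<^sup>2 * disc_rho \<phi> t"
      unfolding S_def using \<xi> by (intro mult_left_mono disc_rho_upper) auto
    finally show "measure areaD {z \<in> unit_disk. norm (\<phi> z - \<xi>) < \<epsilon> * t} \<le> 87480000 * \<epsilon>\<^sup>2 * disc_rho \<phi> t"
      by (simp add: S_def)
  qed
qed

section \<open>Comparison of Carleson windows with Euclidean discs\<close>

lemma Arg_le_iff_cos:
  assumes "u \<noteq> 0" "0 \<le> a" "a \<le> pi"
  shows "\<bar>Arg u\<bar> \<le> a \<longleftrightarrow> norm u * cos a \<le> Re u"
proof -
  have "cos \<bar>Arg u\<bar> = cos (Arg u)" by simp
  then have "Re u = norm u * cos \<bar>Arg u\<bar>"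
    using arg_cong[OF rcis_cmod_Arg[of u], of Re] by (simp only: Re_rcis)
  then have "norm u * cos a \<le> Re u \<longleftrightarrow> cos a \<le> cos \<bar>Arg u\<bar>"
    using mult_le_cancel_left_pos[of "norm u" "cos a" "cos \<bar>Arg u\<bar>"] assms(1) by (simp only: zero_less_norm_iff not_False_eq_True)
  also have "\<dots> \<longleftrightarrow> \<bar>Arg u\<bar> \<le> a"
    using assms mpi_less_Arg[of u] Arg_le_pi[of u] by (intro cos_mono_le_eq) linarith+
  finally show ?thesis ..
qed

text \<open>Cosine decreases on [0, pi], so the condition on the argument becomes an inequality
  between continuous functions. This avoids the jump of \<open>Arg\<close>.\<close>

lemma carleson_window_borel:
  assumes "0 < h" "h < 1" "norm \<xi> = 1"
  shows "carleson_window \<xi> h \<in> sets borel"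
proof -
  have "carleson_window \<xi> h = {z. norm z < 1 \<and> norm z \<ge> 1 - h \<and> norm (z * cnj \<xi>) * cos (pi * h) \<le> Re (z * cnj \<xi>)}"
  proof -
    have "\<bar>Arg (z * cnj \<xi>)\<bar> \<le> pi * h \<longleftrightarrow> norm (z * cnj \<xi>) * cos (pi * h) \<le> Re (z * cnj \<xi>)" if "norm z \<ge> 1 - h" for z
    proof (rule Arg_le_iff_cos)
      show "z * cnj \<xi> \<noteq> 0" using assms that by auto
    qed (use assms in simp_all)
    then show ?thesis unfolding carleson_window_def by (intro Collect_cong conj_cong refl)
  qed
  also have "\<dots> \<in> sets borel" by measurable
  finally show ?thesis .
qed

text \<open>After rotating \<xi> to 1 the point has real part above 1/2, so its argument is an
  arctangent bounded by h / (1/2) \<le> pi h.\<close>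

lemma disc_subset_carleson_window:
  assumes h: "0 < h" "h \<le> 1 / 2" and \<xi>: "norm \<xi> = 1" and z: "norm z < 1" "norm (z - \<xi>) < h"
  shows "z \<in> carleson_window \<xi> h"
proof -
  define u where "u = z * cnj \<xi>"
  have "\<xi> * cnj \<xi> = 1" using complex_norm_square[of \<xi>] \<xi> by simp
  then have "u - 1 = (z - \<xi>) * cnj \<xi>" by (simp add: u_def algebra_simps)
  then have u1: "norm (u - 1) < h" using z \<xi> by (simp add: norm_mult)
  have "\<bar>Im u\<bar> < h" using abs_Im_le_cmod[of "u - 1"] u1 by simp
  have Re: "Re u > 1 / 2" using abs_Re_le_cmod[of "u - 1"] u1 h by simp
  have "\<bar>Arg u\<bar> = \<bar>arctan (Im u / Re u)\<bar>" using Re by (simp add: arg_conv_arctan)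
  also have "\<dots> \<le> \<bar>Im u / Re u\<bar>" by (rule abs_arctan_le)
  also have "\<dots> = \<bar>Im u\<bar> / Re u" using Re by simp
  also have "\<dots> \<le> h / (1 / 2)" using \<open>\<bar>Im u\<bar> < h\<close> Re h by (intro frac_le) auto
  also have "\<dots> \<le> pi * h" using pi_gt3 h by simp
  finally have "\<bar>Arg u\<bar> \<le> pi * h" .
  moreover have "norm z \<ge> 1 - h" using norm_triangle_ineq2[of \<xi> "z"] z \<xi> by (simp add: norm_minus_commute)
  ultimately show ?thesis using z by (simp add: carleson_window_def u_def)
qed

text \<open>The path from \<open>u\<close> along its circle to |u| and then radially to 1 costs at
  most pi h + h. The bound makes the test functions large on windows.\<close>

lemma carleson_window_dist:
  assumes \<xi>: "norm \<xi> = 1" and z: "z \<in> carleson_window \<xi> h"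
  shows "norm (z - \<xi>) \<le> 5 * h"
proof -
  define u where "u = z * cnj \<xi>"
  have "\<xi> * cnj \<xi> = 1" using complex_norm_square[of \<xi>] \<xi> by simp
  then have "u - 1 = (z - \<xi>) * cnj \<xi>" by (simp add: u_def algebra_simps)
  then have u1: "norm (u - 1) = norm (z - \<xi>)" using \<xi> by (simp add: norm_mult)
  have nu: "norm u = norm z" using \<xi> by (simp add: u_def norm_mult)
  have "norm (u - norm u) \<le> pi * h"
  proof -
    have "norm u * exp (\<i> * Arg u) = u"
      using rcis_cmod_Arg[of u] unfolding rcis_def cis_conv_exp .
    then have "u - norm u = of_real (norm u) * (exp (\<i> * Arg u) - 1)"
      by (simp only: right_diff_distrib mult_1_right)
    from arg_cong[OF this, of norm] have "norm (u - norm u) = norm u * norm (exp (\<i> * Arg u) - 1)"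
      by (simp only: norm_mult norm_of_real abs_norm_cancel)
    also have "\<dots> \<le> 1 * norm (exp (\<i> * Arg u) - 1)"
      using z nu by (intro mult_right_mono) (auto simp: carleson_window_def)
    also have "norm (exp (\<i> * Arg u) - 1) = 2 * \<bar>sin (Arg u / 2)\<bar>" by (rule dist_exp_i_1)
    also have "1 * \<dots> \<le> \<bar>Arg u\<bar>" using abs_sin_x_le_abs_x[of "Arg u / 2"] by simp
    also have "\<dots> \<le> pi * h" using z by (simp add: carleson_window_def u_def)
    finally show ?thesis .
  qed
  moreover have "norm (complex_of_real (norm u) - 1) \<le> h"
  proof -
    have "complex_of_real (norm u) - 1 = complex_of_real (norm u - 1)" by simp
    then have "norm (complex_of_real (norm u) - 1) = \<bar>norm u - 1\<bar>"
      by (simp only: norm_of_real)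
    then show ?thesis using nu z by (simp add: carleson_window_def)
  qed
  moreover have "norm (u - 1) \<le> norm (u - norm u) + norm (complex_of_real (norm u) - 1)"
    using norm_triangle_ineq[of "u - norm u" "complex_of_real (norm u) - 1"] by simp
  moreover have "pi * h + h \<le> 5 * h"
  proof -
    have "h \<ge> 0" using z by (auto simp: carleson_window_def)
    then have "pi * h \<le> 4 * h" using pi_less_4 by (intro mult_right_mono) auto
    then show ?thesis by simp
  qed
  ultimately show ?thesis using u1 by linarith
qed

lemma pullback_window_sets:
  assumes "\<phi> holomorphic_on unit_disk" "0 < h" "h < 1" "norm \<xi> = 1"
  shows "\<phi> -` carleson_window \<xi> h \<inter> unit_disk \<in> sets areaD"
proof -
  have "\<phi> \<in> borel_measurable areaD" using assms(1) by (rule borel_measurable_areaD_holomorphic)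
  from measurable_sets[OF this carleson_window_borel[OF assms(2-4)]] show ?thesis by simp
qed

lemma pullback_area_le_rho:
  "norm \<xi> = 1 \<Longrightarrow> pullback_area \<phi> (carleson_window \<xi> h) \<le> rho_phi2 \<phi> h"
  unfolding rho_phi2_def
  by (intro cSUP_upper bdd_aboveI[of _ 1]) (auto simp: pullback_area_def intro: measure_areaD_le_1)

lemma rho_phi2_nonneg: "rho_phi2 \<phi> h \<ge> 0"
  using pullback_area_le_rho[of 1 \<phi> h] by (simp add: pullback_area_def) (meson measure_nonneg order_trans)

lemma disc_rho_le_rho:
  assumes "\<phi> holomorphic_on unit_disk" "\<phi> ` unit_disk \<subseteq> unit_disk" "0 < h" "h \<le> 1 / 2"
  shows "disc_rho \<phi> h \<le> rho_phi2 \<phi> h"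
proof (rule disc_rho_leI)
  fix \<xi> :: complex assume \<xi>: "norm \<xi> = 1"
  have "{z \<in> unit_disk. norm (\<phi> z - \<xi>) < h} \<subseteq> \<phi> -` carleson_window \<xi> h \<inter> unit_disk"
    using assms \<xi> by (auto intro!: disc_subset_carleson_window simp: image_subset_iff unit_disk_def)
  then have "measure areaD {z \<in> unit_disk. norm (\<phi> z - \<xi>) < h} \<le> pullback_area \<phi> (carleson_window \<xi> h)"
    unfolding pullback_area_def using assms \<xi> by (intro areaD.finite_measure_mono pullback_window_sets) auto
  also have "\<dots> \<le> rho_phi2 \<phi> h" using \<xi> by (rule pullback_area_le_rho)
  finally show "measure areaD {z \<in> unit_disk. norm (\<phi> z - \<xi>) < h} \<le> rho_phi2 \<phi> h" .
qed

subsection \<open>Orlicz functions and the modular\<close>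

locale orlicz =
  fixes \<Psi> :: "real \<Rightarrow> real"
  assumes orlicz_function: "orlicz_function \<Psi>"
begin

lemma nonneg: "x \<ge> 0 \<Longrightarrow> \<Psi> x \<ge> 0"
  and mono: "0 \<le> x \<Longrightarrow> x \<le> y \<Longrightarrow> \<Psi> x \<le> \<Psi> y"
  and convex: "convex_on {0..} \<Psi>"
  and zero: "\<Psi> 0 = 0"
  and pos: "x > 0 \<Longrightarrow> \<Psi> x > 0"
  and at_top: "filterlim \<Psi> at_top at_top"
  using orlicz_function unfolding orlicz_function_def mono_on_def by auto

lemma scale: "0 \<le> k \<Longrightarrow> k \<le> 1 \<Longrightarrow> x \<ge> 0 \<Longrightarrow> \<Psi> (k * x) \<le> k * \<Psi> x"
  using convex_onD[OF convex, of k 0 x] by (simp add: zero)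

lemma divide: "1 \<le> k \<Longrightarrow> x \<ge> 0 \<Longrightarrow> \<Psi> (x / k) \<le> \<Psi> x / k"
  using scale[of "1 / k" x] by simp

lemma strict_mono: "0 \<le> x \<Longrightarrow> x < y \<Longrightarrow> \<Psi> x < \<Psi> y"
proof -
  assume "0 \<le> x" "x < y"
  then have "\<Psi> x \<le> x / y * \<Psi> y" using scale[of "x / y" y] by simp
  also have "\<dots> < 1 * \<Psi> y"
    using \<open>0 \<le> x\<close> \<open>x < y\<close> pos[of y] by (intro mult_strict_right_mono) auto
  finally show ?thesis by simp
qed

lemma le_iff: "0 \<le> x \<Longrightarrow> 0 \<le> y \<Longrightarrow> \<Psi> x \<le> \<Psi> y \<longleftrightarrow> x \<le> y"
  using mono[of x y] strict_mono[of y x] by (meson not_le)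

text \<open>The even extension is convex on an open set, which makes the general results on
  continuity and supporting lines applicable up to the endpoint 0.\<close>

lemma convex_abs: "convex_on UNIV (\<lambda>x. \<Psi> \<bar>x\<bar>)"
proof (rule convex_onI)
  fix t x y :: real assume t: "0 < t" "t < 1"
  have "\<Psi> \<bar>(1 - t) *\<^sub>R x + t *\<^sub>R y\<bar> \<le> \<Psi> ((1 - t) *\<^sub>R \<bar>x\<bar> + t *\<^sub>R \<bar>y\<bar>)"
    using t abs_triangle_ineq[of "(1 - t) * x" "t * y"] by (intro mono) (auto simp: abs_mult)
  also have "\<dots> \<le> (1 - t) * \<Psi> \<bar>x\<bar> + t * \<Psi> \<bar>y\<bar>"
    using t by (intro convex_onD[OF convex]) auto
  finally show "\<Psi> \<bar>(1 - t) *\<^sub>R x + t *\<^sub>R y\<bar> \<le> (1 - t) * \<Psi> \<bar>x\<bar> + t * \<Psi> \<bar>y\<bar>" .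
qed simp

lemma continuous_on_abs: "continuous_on UNIV (\<lambda>x. \<Psi> \<bar>x\<bar>)"
  by (rule convex_on_continuous[OF open_UNIV convex_abs])

lemma continuous_on: "continuous_on {0..} \<Psi>"
  by (rule continuous_on_eq[OF continuous_on_subset[OF continuous_on_abs subset_UNIV]]) auto

lemma measurable_norm [measurable]:
  fixes f :: "'a \<Rightarrow> 'b::{real_normed_vector, second_countable_topology}"
  assumes [measurable]: "f \<in> borel_measurable M"
  shows "(\<lambda>x. \<Psi> (norm (f x))) \<in> borel_measurable M"
proof -
  have "(\<lambda>x. \<Psi> \<bar>x\<bar>) \<in> borel_measurable borel"
    by (rule borel_measurable_continuous_onI[OF continuous_on_abs])
  from measurable_compose[OF _ this, of "\<lambda>x. norm (f x)" M] show ?thesis by simp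
qed

lemma measurable_norm_divide [measurable]:
  fixes f :: "'a \<Rightarrow> complex"
  assumes [measurable]: "f \<in> borel_measurable M" and "C > 0"
  shows "(\<lambda>x. \<Psi> (norm (f x) / C)) \<in> borel_measurable M"
proof -
  have "(\<lambda>x. \<Psi> (norm (f x / of_real C))) \<in> borel_measurable M" by measurable
  then show ?thesis using assms(2) by (simp add: norm_divide)
qed

text \<open>The one-sided derivative serves as slope. For s > 0 the line evaluated at 0 gives \<Psi>
  s \<le> k s, so the slope is positive; at 0 the horizontal line works.\<close>

lemma supporting_line:
  assumes "s \<ge> 0"
  obtains k where "k \<ge> 0" "\<And>t. t \<ge> 0 \<Longrightarrow> \<Psi> s + k * (t - s) \<le> \<Psi> t"
proof (cases "s = 0")
  case True
  then show thesis using that[of 0] by (simp add: zero nonneg)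
next
  case False
  with assms have s: "s > 0" by simp
  define k where "k = Inf ((\<lambda>t. (\<Psi> \<bar>s\<bar> - \<Psi> \<bar>t\<bar>) / (s - t)) ` ({s<..} \<inter> UNIV))"
  have k: "\<Psi> \<bar>s\<bar> + k * (t - s) \<le> \<Psi> \<bar>t\<bar>" for t
    unfolding k_def by (rule convex_le_Inf_differential[OF convex_abs]) auto
  have "\<Psi> s \<le> k * s" using k[of 0] s by (simp add: zero)
  then have "k * s > 0" using pos[OF s] by linarith
  then have "k \<ge> 0" using s by (simp add: zero_less_mult_iff)
  then show thesis using that k s by (metis abs_of_nonneg assms)
qed

lemma surj: "y \<ge> 0 \<Longrightarrow> \<exists>x\<ge>0. \<Psi> x = y"
proof -
  assume y: "y \<ge> 0"
  obtain b where b: "b \<ge> 0" "\<Psi> b \<ge> y"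
    using at_top unfolding filterlim_at_top eventually_at_top_linorder
    by (meson max.cobounded1 max.cobounded2)
  have "\<exists>x\<ge>0. x \<le> b \<and> \<Psi> x = y"
    using b y by (intro IVT' continuous_on_subset[OF continuous_on]) (auto simp: zero)
  then show ?thesis by blast
qed

lemma inv_eq: "y \<ge> 0 \<Longrightarrow> \<Psi> (orlicz_inv \<Psi> y) = y"
  and inv_nonneg: "y \<ge> 0 \<Longrightarrow> orlicz_inv \<Psi> y \<ge> 0"
proof -
  assume "y \<ge> 0"
  then have "y \<in> \<Psi> ` {0..}" using surj[of y] by auto
  from f_inv_into_f[OF this] inv_into_into[OF this]
  show "\<Psi> (orlicz_inv \<Psi> y) = y" "orlicz_inv \<Psi> y \<ge> 0" by (simp_all add: orlicz_inv_def)
qed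

lemma le_inv_iff: "x \<ge> 0 \<Longrightarrow> y \<ge> 0 \<Longrightarrow> x \<le> orlicz_inv \<Psi> y \<longleftrightarrow> \<Psi> x \<le> y"
  using le_iff[of x "orlicz_inv \<Psi> y"] by (simp add: inv_eq inv_nonneg)

lemma inv_pos: "y > 0 \<Longrightarrow> orlicz_inv \<Psi> y > 0"
  using inv_nonneg[of y] inv_eq[of y] zero by (metis less_eq_real_def less_irrefl)

text \<open>Applying \<Psi> to A \<Psi>^-1(1 / h^2) \<le> \<Psi>^-1(1 / \<rho>) removes the second
  inverse. It also absorbs the convention for \<rho> = 0, where the product vanishes.\<close>

lemma compactness_ratio_iff:
  "(compactness_ratio \<Psi> \<phi> \<longlongrightarrow> 0) (at_right 0) \<longleftrightarrow>
    (\<forall>A>0. \<forall>\<^sub>F h in at_right 0. rho_phi2 \<phi> h * \<Psi> (A * orlicz_inv \<Psi> (1 / h\<^sup>2)) \<le> 1)"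
proof -
  have key: "rho_phi2 \<phi> h * \<Psi> (A * orlicz_inv \<Psi> (1 / h\<^sup>2)) \<le> 1 \<longleftrightarrow> compactness_ratio \<Psi> \<phi> h \<le> 1 / A"
    if "A > 0" "h > 0" for A h
  proof (cases "rho_phi2 \<phi> h = 0")
    case True
    then show ?thesis using that by (simp add: compactness_ratio_def)
  next
    case False
    then have r: "rho_phi2 \<phi> h > 0" using rho_phi2_nonneg[of \<phi> h] by simp
    define s where "s = orlicz_inv \<Psi> (1 / h\<^sup>2)"
    have s: "s > 0" unfolding s_def using that by (intro inv_pos) auto
    have "rho_phi2 \<phi> h * \<Psi> (A * s) \<le> 1 \<longleftrightarrow> \<Psi> (A * s) \<le> 1 / rho_phi2 \<phi> h"
      using r by (simp add: le_divide_eq mult.commute)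
    also have "\<dots> \<longleftrightarrow> A * s \<le> orlicz_inv \<Psi> (1 / rho_phi2 \<phi> h)"
      using r s that by (subst le_inv_iff) auto
    also have "\<dots> \<longleftrightarrow> s / orlicz_inv \<Psi> (1 / rho_phi2 \<phi> h) \<le> 1 / A"
      using inv_pos[of "1 / rho_phi2 \<phi> h"] r that by (simp add: divide_le_eq le_divide_eq mult.commute)
    also have "s / orlicz_inv \<Psi> (1 / rho_phi2 \<phi> h) = compactness_ratio \<Psi> \<phi> h"
      using False by (simp add: compactness_ratio_def s_def)
    finally show ?thesis by (simp add: s_def)
  qed
  have nn: "compactness_ratio \<Psi> \<phi> h \<ge> 0" if "h > 0" for h
    using that rho_phi2_nonneg[of \<phi> h] by (auto simp: compactness_ratio_def intro!: divide_nonneg_nonneg inv_nonneg)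
  have ev: "eventually (\<lambda>h::real. h > 0) (at_right 0)" by (simp add: eventually_at_right_less)
  show ?thesis
  proof safe
    fix A :: real assume lim: "(compactness_ratio \<Psi> \<phi> \<longlongrightarrow> 0) (at_right 0)" and A: "A > 0"
    have "eventually (\<lambda>h. compactness_ratio \<Psi> \<phi> h < 1 / A) (at_right 0)"
      using A by (intro order_tendstoD[OF lim]) auto
    with ev show "\<forall>\<^sub>F h in at_right 0. rho_phi2 \<phi> h * \<Psi> (A * orlicz_inv \<Psi> (1 / h\<^sup>2)) \<le> 1"
      by eventually_elim (use key[OF A] in auto)
  next
    assume *: "\<forall>A>0. \<forall>\<^sub>F h in at_right 0. rho_phi2 \<phi> h * \<Psi> (A * orlicz_inv \<Psi> (1 / h\<^sup>2)) \<le> 1"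
    show "(compactness_ratio \<Psi> \<phi> \<longlongrightarrow> 0) (at_right 0)"
    proof (rule tendstoI)
      fix e :: real assume e: "e > 0"
      \<comment> \<open>The choice A = 2 / e bounds the ratio by e / 2, which is strictly below
        e.\<close>
      then have "\<forall>\<^sub>F h in at_right 0. rho_phi2 \<phi> h * \<Psi> (2 / e * orlicz_inv \<Psi> (1 / h\<^sup>2)) \<le> 1"
        using *[rule_format, of "2 / e"] by simp
      with ev show "\<forall>\<^sub>F h in at_right 0. dist (compactness_ratio \<Psi> \<phi> h) 0 < e"
      proof eventually_elim
        case (elim h)
        then have "compactness_ratio \<Psi> \<phi> h \<le> e / 2" using key[of "2 / e" h] e by simp
        then show ?case using nn[of h] elim e by simp
      qed
    qed
  qed
qed

section \<open>The modular and its Luxemburg norm\<close>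

lemma modular_scale:
  assumes [measurable]: "f \<in> borel_measurable areaD" and "k \<ge> 1" "C > 0"
  shows "orlicz_modular \<Psi> f (k * C) \<le> ennreal (1 / k) * orlicz_modular \<Psi> f C"
proof -
  have "ennreal (\<Psi> (norm (f z) / (k * C))) \<le> ennreal (1 / k) * ennreal (\<Psi> (norm (f z) / C))" for z
    using scale[of "1 / k" "norm (f z) / C"] assms nonneg[of "norm (f z) / C"]
    by (simp add: ennreal_mult[symmetric] ennreal_leI mult.commute)
  then have "orlicz_modular \<Psi> f (k * C) \<le> (\<integral>\<^sup>+z. ennreal (1 / k) * ennreal (\<Psi> (norm (f z) / C)) \<partial>areaD)"
    unfolding orlicz_modular_def by (intro nn_integral_mono)
  also have "\<dots> = ennreal (1 / k) * orlicz_modular \<Psi> f C"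
    unfolding orlicz_modular_def using assms(3) by (intro nn_integral_cmult) measurable
  finally show ?thesis .
qed

lemma modular_mono:
  assumes "0 < C" "C \<le> C'"
  shows "orlicz_modular \<Psi> f C' \<le> orlicz_modular \<Psi> f C"
  unfolding orlicz_modular_def using assms
  by (intro nn_integral_mono ennreal_leI mono divide_left_mono) auto

lemma modular_diff:
  assumes [measurable]: "f \<in> borel_measurable areaD" "g \<in> borel_measurable areaD" and C: "C > 0"
  shows "orlicz_modular \<Psi> (\<lambda>z. f z - g z) (2 * C)
    \<le> ennreal (1 / 2) * orlicz_modular \<Psi> f C + ennreal (1 / 2) * orlicz_modular \<Psi> g C"
proof -
  have "ennreal (\<Psi> (norm (f z - g z) / (2 * C)))
    \<le> ennreal (1 / 2) * ennreal (\<Psi> (norm (f z) / C)) + ennreal (1 / 2) * ennreal (\<Psi> (norm (g z) / C))" for z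
  proof -
    have "norm (f z - g z) / (2 * C) \<le> (norm (f z) + norm (g z)) / (2 * C)"
      using C by (intro divide_right_mono norm_triangle_ineq4) auto
    also have "\<dots> = (1 - 1 / 2) *\<^sub>R (norm (f z) / C) + (1 / 2) *\<^sub>R (norm (g z) / C)"
      by (simp add: add_divide_distrib)
    finally have "\<Psi> (norm (f z - g z) / (2 * C)) \<le> \<Psi> ((1 - 1 / 2) *\<^sub>R (norm (f z) / C) + (1 / 2) *\<^sub>R (norm (g z) / C))"
      using C by (intro mono) auto
    also have "\<dots> \<le> (1 - 1 / 2) * \<Psi> (norm (f z) / C) + 1 / 2 * \<Psi> (norm (g z) / C)"
      using C by (intro convex_onD[OF convex]) auto
    finally have "ennreal (\<Psi> (norm (f z - g z) / (2 * C)))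
      \<le> ennreal (1 / 2 * \<Psi> (norm (f z) / C) + 1 / 2 * \<Psi> (norm (g z) / C))"
      by (intro ennreal_leI) simp
    also have "\<dots> = ennreal (1 / 2) * ennreal (\<Psi> (norm (f z) / C)) + ennreal (1 / 2) * ennreal (\<Psi> (norm (g z) / C))"
      using C nonneg[of "norm (f z) / C"] nonneg[of "norm (g z) / C"]
      by (subst ennreal_plus) (auto simp: ennreal_mult[symmetric] simp del: ennreal_half)
    finally show ?thesis .
  qed
  then have "orlicz_modular \<Psi> (\<lambda>z. f z - g z) (2 * C)
    \<le> (\<integral>\<^sup>+z. ennreal (1 / 2) * ennreal (\<Psi> (norm (f z) / C)) + ennreal (1 / 2) * ennreal (\<Psi> (norm (g z) / C)) \<partial>areaD)"
    unfolding orlicz_modular_def by (intro nn_integral_mono)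
  also have "\<dots> = ennreal (1 / 2) * orlicz_modular \<Psi> f C + ennreal (1 / 2) * orlicz_modular \<Psi> g C"
    unfolding orlicz_modular_def using C by (simp add: nn_integral_add nn_integral_cmult)
  finally show ?thesis .
qed

text \<open>Fatou's lemma, with continuity of \<Psi> carrying the pointwise limit through.\<close>

lemma modular_liminf:
  assumes meas [measurable]: "\<And>n. f n \<in> borel_measurable areaD" and C: "C > 0"
    and le: "\<forall>\<^sub>F n in sequentially. orlicz_modular \<Psi> (f n) C \<le> b"
    and lim: "\<And>z. z \<in> unit_disk \<Longrightarrow> (\<lambda>n. f n z) \<longlonglongrightarrow> g z"
  shows "orlicz_modular \<Psi> g C \<le> b"
proof -
  have "orlicz_modular \<Psi> g C = (\<integral>\<^sup>+z. liminf (\<lambda>n. ennreal (\<Psi> (norm (f n z) / C))) \<partial>areaD)"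
    unfolding orlicz_modular_def
  proof (rule nn_integral_cong)
    fix z assume "z \<in> space areaD"
    then have "(\<lambda>n. norm (f n z) / C) \<longlonglongrightarrow> norm (g z) / C"
      using C lim[of z] by (intro tendsto_intros) auto
    then have "(\<lambda>n. \<Psi> \<bar>norm (f n z) / C\<bar>) \<longlonglongrightarrow> \<Psi> \<bar>norm (g z) / C\<bar>"
      by (rule continuous_on_tendsto_compose[OF continuous_on_abs]) auto
    then have "(\<lambda>n. ennreal (\<Psi> (norm (f n z) / C))) \<longlonglongrightarrow> ennreal (\<Psi> (norm (g z) / C))"
      using C by simp
    then show "ennreal (\<Psi> (norm (g z) / C)) = liminf (\<lambda>n. ennreal (\<Psi> (norm (f n z) / C)))"
      by (simp add: lim_imp_Liminf)
  qed
  also have "\<dots> \<le> liminf (\<lambda>n. orlicz_modular \<Psi> (f n) C)"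
    unfolding orlicz_modular_def using C by (intro nn_integral_liminf) measurable
  also have "\<dots> \<le> b" using le by (intro Liminf_le) auto
  finally show ?thesis .
qed

text \<open>Convexity lets a larger constant divide a finite modular down to 1. This ensures that
  the infimum defining \<open>bo_norm\<close> is over a nonempty set.\<close>

lemma modular_le_1_exists:
  assumes [measurable]: "f \<in> borel_measurable areaD" and C: "C > 0" "orlicz_modular \<Psi> f C < \<infinity>"
  shows "\<exists>C'>0. orlicz_modular \<Psi> f C' \<le> 1"
proof -
  obtain m where m: "orlicz_modular \<Psi> f C = ennreal m" "m \<ge> 0" using C(2) by (cases "orlicz_modular \<Psi> f C") auto
  define k where "k = max 1 m"
  have "orlicz_modular \<Psi> f (k * C) \<le> ennreal (1 / k) * ennreal m"
    unfolding m(1)[symmetric] by (intro modular_scale C) (auto simp: k_def)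
  also have "\<dots> = ennreal (m / k)" using m by (simp add: ennreal_mult[symmetric] k_def)
  also have "\<dots> \<le> 1" using m by (simp add: k_def)
  finally show ?thesis using C(1) by (intro exI[of _ "k * C"]) (auto simp: k_def)
qed

lemma bo_norm_le: "C > 0 \<Longrightarrow> orlicz_modular \<Psi> f C \<le> 1 \<Longrightarrow> bo_norm \<Psi> f \<le> C"
  unfolding bo_norm_def by (intro cInf_lower bdd_belowI[of _ 0]) auto

lemma bo_norm_nonneg: "C > 0 \<Longrightarrow> orlicz_modular \<Psi> f C \<le> 1 \<Longrightarrow> bo_norm \<Psi> f \<ge> 0"
  unfolding bo_norm_def by (intro cInf_greatest) auto

lemma modular_le_1_of_bo_norm_less:
  assumes "C > 0" "orlicz_modular \<Psi> f C \<le> 1" "bo_norm \<Psi> f < B"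
  shows "orlicz_modular \<Psi> f B \<le> 1"
proof -
  obtain C' where "C' > 0" "orlicz_modular \<Psi> f C' \<le> 1" "C' < B"
    using assms unfolding bo_norm_def by (subst (asm) cInf_less_iff) (auto intro: bdd_belowI[of _ 0])
  then show ?thesis using modular_mono[of C' B f] by auto
qed

lemma modular_eq_norm_divide: "orlicz_modular \<Psi> f C = (\<integral>\<^sup>+z. ennreal (\<Psi> (norm (f z / of_real C))) \<partial>areaD)" if "C > 0"
  using that by (simp add: orlicz_modular_def norm_divide)

text \<open>Sub-mean value property of \<Psi>(|F|). A supporting line of \<Psi> at s = |F z|,
  evaluated at Re (c F) with a unimodular c that makes c F z = |F z|, is a harmonic minorant
  touching at \<open>z\<close>. The ball has normalized area (1 - |z|)^2 / 4.\<close>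

lemma subharmonic_ball:
  assumes F: "F holomorphic_on unit_disk" and z: "norm z < 1"
  shows "ennreal (\<Psi> (norm (F z)) * ((1 - norm z)\<^sup>2 / 4))
    \<le> (\<integral>\<^sup>+w. ennreal (\<Psi> (norm (F w))) * indicator (ball z ((1 - norm z) / 2)) w \<partial>areaD)"
proof -
  define d where "d = 1 - norm z"
  have d: "d > 0" using z by (simp add: d_def)
  have sub: "norm w < 1" if "w \<in> ball z (d / 2)" for w
  proof -
    have "norm w < norm z + d / 2" using that norm_triangle_ineq2[of w z] by (simp add: dist_norm norm_minus_commute)
    then show ?thesis using d by (simp add: d_def diff_divide_distrib)
  qed
  define s where "s = norm (F z)"
  obtain k where k: "k \<ge> 0" "\<And>t. t \<ge> 0 \<Longrightarrow> \<Psi> s + k * (t - s) \<le> \<Psi> t"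
    by (rule supporting_line[of s]) (auto simp: s_def)
  define c where "c = (if F z = 0 then 1 else cnj (F z) / norm (F z))"
  have c: "norm c = 1" by (simp add: c_def norm_divide)
  have cF: "Re (c * F z) = s"
  proof (cases "F z = 0")
    case False
    then have "c * F z = of_real ((norm (F z))\<^sup>2 / norm (F z))"
      using complex_norm_square[of "F z"] by (simp add: c_def mult.commute)
    also have "\<dots> = of_real s" using False by (simp add: s_def power2_eq_square)
    finally show ?thesis by simp
  qed (simp add: c_def s_def)
  define G where "G w = indicator unit_disk w *\<^sub>R F w" for w
  have [measurable]: "G \<in> borel_measurable borel"
    unfolding G_def using F by (intro borel_measurable_indicator_holomorphic) (simp_all add: unit_disk_def)
  have GF: "G w = F w" if "norm w < 1" for w using that by (simp add: G_def unit_disk_def)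
  define Q where "Q w = of_real (\<Psi> s) + of_real k * (c * F w - of_real s)" for w
  have ReQ: "Re (Q w) = \<Psi> s + k * (Re (c * F w) - s)" for w
  proof -
    have "Re (of_real a + of_real k * (u - of_real s)) = a + k * (Re u - s)" for a u by simp
    then show ?thesis unfolding Q_def .
  qed
  have "Q holomorphic_on ball z (d / 2)"
    unfolding Q_def using F sub
    by (intro holomorphic_intros) (auto intro!: holomorphic_on_subset[OF F] simp: unit_disk_def)
  moreover have "ennreal (Re (Q w)) \<le> ennreal (\<Psi> (norm (G w)))" if "w \<in> ball z (d / 2)" for w
  proof -
    have "Re (c * F w) \<le> norm (F w)"
      using complex_Re_le_cmod[of "c * F w"] c by (simp add: norm_mult)
    \<comment> \<open>The slope must be nonnegative here, because Re (c F) is replaced by the larger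
      |F|.\<close>
    then have "k * (Re (c * F w) - s) \<le> k * (norm (F w) - s)" using k(1) by (intro mult_left_mono) auto
    then have "Re (Q w) \<le> \<Psi> (norm (F w))" using k(2)[of "norm (F w)"] unfolding ReQ by simp
    then show ?thesis using GF[OF sub[OF that]] by (simp add: ennreal_leI)
  qed
  ultimately have "ennreal (Re (Q z)) * ennreal (pi * (d / 2)\<^sup>2)
    \<le> (\<integral>\<^sup>+w. ennreal (\<Psi> (norm (G w))) * indicator (ball z (d / 2)) w \<partial>lborel)"
    using d by (intro submean_value_ball) auto
  moreover have "Re (Q z) = \<Psi> s" unfolding ReQ cF by simp
  ultimately have "ennreal (1 / pi) * (ennreal (\<Psi> s) * ennreal (pi * (d / 2)\<^sup>2))
    \<le> ennreal (1 / pi) * (\<integral>\<^sup>+w. ennreal (\<Psi> (norm (G w))) * indicator (ball z (d / 2)) w \<partial>lborel)"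
    by (intro mult_left_mono) auto
  also have "ennreal (1 / pi) * (ennreal (\<Psi> s) * ennreal (pi * (d / 2)\<^sup>2)) = ennreal (\<Psi> s * (d\<^sup>2 / 4))"
    using nonneg[of s] by (simp add: ennreal_mult[symmetric] s_def power_divide)
  also have "(\<integral>\<^sup>+w. ennreal (\<Psi> (norm (G w))) * indicator (ball z (d / 2)) w \<partial>lborel)
    = (\<integral>\<^sup>+w. ennreal (\<Psi> (norm (G w))) * indicator (ball z (d / 2)) w * indicator unit_disk w \<partial>lborel)"
    using sub by (intro nn_integral_cong) (auto split: split_indicator simp: unit_disk_def)
  also have "ennreal (1 / pi) * \<dots> = (\<integral>\<^sup>+w. ennreal (\<Psi> (norm (G w))) * indicator (ball z (d / 2)) w \<partial>areaD)"
  proof (rule nn_integral_areaD[symmetric], rule borel_measurable_areaD)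
    have [measurable]: "ball z (d / 2) \<in> sets borel" by simp
    show "(\<lambda>w. ennreal (\<Psi> (norm (G w))) * indicator (ball z (d / 2)) w) \<in> borel_measurable borel"
      by measurable
  qed
  also have "\<dots> = (\<integral>\<^sup>+w. ennreal (\<Psi> (norm (F w))) * indicator (ball z (d / 2)) w \<partial>areaD)"
    by (intro nn_integral_cong) (simp add: GF unit_disk_def)
  finally show ?thesis by (simp add: d_def s_def)
qed

text \<open>The sub-mean value property with the whole modular on the right. It provides the local
  boundedness needed for Montel's theorem.\<close>

lemma pointwise_bound:
  assumes F: "F holomorphic_on unit_disk" and C: "C > 0" and m: "orlicz_modular \<Psi> F C \<le> 1"
    and z: "norm z \<le> r" "r < 1"
  shows "norm (F z) \<le> C * orlicz_inv \<Psi> (4 / (1 - r)\<^sup>2)"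
proof -
  have F': "(\<lambda>w. F w / of_real C) holomorphic_on unit_disk" using F C by (intro holomorphic_intros) auto
  have z1: "norm z < 1" using z by simp
  have "ennreal (\<Psi> (norm (F z / of_real C)) * ((1 - norm z)\<^sup>2 / 4)) \<le> (\<integral>\<^sup>+w. ennreal (\<Psi> (norm (F w / of_real C))) \<partial>areaD)"
    by (rule order_trans[OF subharmonic_ball[OF F' z1]])
       (auto intro!: nn_integral_mono split: split_indicator)
  also have "\<dots> \<le> 1" using m C by (simp add: modular_eq_norm_divide)
  finally have "\<Psi> (norm (F z / of_real C)) * ((1 - norm z)\<^sup>2 / 4) \<le> 1" by simp
  then have "\<Psi> (norm (F z / of_real C)) \<le> 4 / (1 - norm z)\<^sup>2" using z1 by (simp add: field_simps)
  also have "\<dots> \<le> 4 / (1 - r)\<^sup>2" using z by (intro divide_left_mono power_mono) auto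
  finally have "norm (F z / of_real C) \<le> orlicz_inv \<Psi> (4 / (1 - r)\<^sup>2)" by (subst le_inv_iff) auto
  then show ?thesis using C by (simp add: norm_divide divide_le_eq mult.commute)
qed

lemma modular_comp_split:
  fixes u :: "complex \<Rightarrow> complex"
  assumes [measurable]: "u \<in> borel_measurable areaD" and A: "A > 0" and M: "M \<ge> 0"
  shows "(\<integral>\<^sup>+x. ennreal (\<Psi> (A * norm (u x))) \<partial>areaD)
    = (\<integral>\<^sup>+x. ennreal (\<Psi> (A * norm (u x))) * indicator {x. norm (u x) > M} x \<partial>areaD)
    + (\<integral>\<^sup>+x. ennreal (\<Psi> (A * norm (u x))) * indicator {x. norm (u x) \<le> M} x \<partial>areaD)"
proof -
  have "(\<lambda>x. \<Psi> (norm (of_real A * u x))) \<in> borel_measurable areaD" by measurable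
  then have [measurable]: "(\<lambda>x. \<Psi> (A * norm (u x))) \<in> borel_measurable areaD" using A by (simp add: norm_mult)
  show ?thesis
    by (subst nn_integral_add[symmetric]) (auto intro!: nn_integral_cong split: split_indicator)
qed

end

subsection \<open>Sufficiency\<close>

context orlicz
begin

text \<open>Two features matter: \<open>M\<close> depends on \<open>A\<close> but not on
  \<open>F\<close>, and the bound depends on neither. So \<open>A\<close> may be taken large
  afterwards while the remaining part |F o \<phi>| \<le> M is handled by dominated
  convergence.\<close>

lemma composition_estimate:
  assumes \<phi>: "\<phi> holomorphic_on unit_disk" "\<phi> ` unit_disk \<subseteq> unit_disk"
    and cond: "\<forall>A>0. \<forall>\<^sub>F h in at_right 0. rho_phi2 \<phi> h * \<Psi> (A * orlicz_inv \<Psi> (1 / h\<^sup>2)) \<le> 1"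
    and A: "A > 0"
  obtains M where "M \<ge> 0"
    "\<And>F. F holomorphic_on unit_disk \<Longrightarrow> (\<integral>\<^sup>+w. ennreal (\<Psi> (norm (F w))) \<partial>areaD) \<le> 1 \<Longrightarrow>
      (\<integral>\<^sup>+x. ennreal (\<Psi> (A * norm (F (\<phi> x)))) * indicator {x. norm (F (\<phi> x)) > M} x \<partial>areaD) \<le> 87480000"
proof -
  have \<phi>1: "norm (\<phi> u) < 1" if "norm u < 1" for u
    using \<phi>(2) that by (auto simp: unit_disk_def image_subset_iff)
  define t0 where "t0 = 1 - norm (\<phi> 0)"
  have t0: "t0 > 0" using \<phi>1[of 0] by (simp add: t0_def)
  \<comment> \<open>The extra factor 36 is spent on the scale: \<Psi>-free form A s = 36 A (s / 36),
    with h chosen so that the inverse at 1 / h^2 equals s / 36.\<close>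
  have "\<forall>\<^sub>F h in at_right 0. rho_phi2 \<phi> h * \<Psi> (36 * A * orlicz_inv \<Psi> (1 / h\<^sup>2)) \<le> 1"
    using cond A by simp
  then obtain b where b: "b > 0" "\<And>h. 0 < h \<Longrightarrow> h < b \<Longrightarrow> rho_phi2 \<phi> h * \<Psi> (36 * A * orlicz_inv \<Psi> (1 / h\<^sup>2)) \<le> 1"
    unfolding eventually_at_right_field by blast
  define h0 where "h0 = min b (1 / 2)"
  have h0: "h0 > 0" "h0 \<le> b" "h0 \<le> 1 / 2" using b by (auto simp: h0_def)
  \<comment> \<open>The first term forces h < h0 for the scale h attached to s > M; the second
    forces 6 / sqrt (\<Psi> s) \<le> t0, the range of the homogeneity lemma.\<close>
  define M where "M = max (36 * orlicz_inv \<Psi> (1 / h0\<^sup>2)) (orlicz_inv \<Psi> (36 / t0\<^sup>2))"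
  have M0: "M \<ge> 0" using inv_nonneg[of "36 / t0\<^sup>2"] by (simp add: M_def le_max_iff_disj)
  have large: "disc_rho \<phi> (6 / sqrt (\<Psi> s)) * \<Psi> (A * s) \<le> 1" "6 / sqrt (\<Psi> s) \<le> t0" if s: "s > M" for s
  proof -
    have s0: "s > 0" using s M0 by linarith
    have P: "\<Psi> (s / 36) > 0" "\<Psi> s > 0" using s0 pos by auto
    define h where "h = 1 / sqrt (\<Psi> (s / 36))"
    have h: "h > 0" using P by (simp add: h_def)
    have hsq: "1 / h\<^sup>2 = \<Psi> (s / 36)" using P by (simp add: h_def power_divide)
    have "\<not> s / 36 \<le> orlicz_inv \<Psi> (1 / h0\<^sup>2)" using s by (simp add: M_def)
    then have "1 / h0\<^sup>2 < \<Psi> (s / 36)" using s0 by (subst (asm) le_inv_iff) auto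
    then have "h\<^sup>2 < h0\<^sup>2" unfolding hsq[symmetric] using h h0 by (simp add: divide_less_eq less_divide_eq field_simps)
    then have hh: "h < h0" using h0 by (intro power_less_imp_less_base[of h 2 h0]) auto
    have inv: "orlicz_inv \<Psi> (1 / h\<^sup>2) = s / 36"
    proof (rule antisym)
      show "s / 36 \<le> orlicz_inv \<Psi> (1 / h\<^sup>2)" using s0 P by (subst le_inv_iff) (auto simp: hsq)
      have "\<Psi> (orlicz_inv \<Psi> (1 / h\<^sup>2)) \<le> \<Psi> (s / 36)" using P by (subst inv_eq) (auto simp: hsq)
      then show "orlicz_inv \<Psi> (1 / h\<^sup>2) \<le> s / 36" using s0 P by (subst (asm) le_iff) (auto simp: hsq inv_nonneg)
    qed
    \<comment> \<open>Convexity turns the factor 36 inside \<Psi> into a factor 6 = sqrt 36 in the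
      scale.\<close>
    have "\<Psi> (s / 36) \<le> \<Psi> s / 36" using divide[of 36 s] s0 by simp
    then have "sqrt (\<Psi> (s / 36)) \<le> sqrt (\<Psi> s / 36)" by simp
    also have "\<dots> = sqrt (\<Psi> s) / 6" using real_sqrt_unique[of 6 36] by (simp add: real_sqrt_divide)
    finally have "6 / sqrt (\<Psi> s) \<le> h"
      unfolding h_def using P by (simp add: field_simps)
    then have "disc_rho \<phi> (6 / sqrt (\<Psi> s)) \<le> disc_rho \<phi> h" by (rule disc_rho_mono[OF \<phi>(1)])
    also have "\<dots> \<le> rho_phi2 \<phi> h" using h hh h0 by (intro disc_rho_le_rho \<phi>) auto
    finally have "disc_rho \<phi> (6 / sqrt (\<Psi> s)) * \<Psi> (A * s) \<le> rho_phi2 \<phi> h * \<Psi> (A * s)"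
      using A s0 by (intro mult_right_mono nonneg) auto
    also have "\<dots> \<le> 1" using b(2)[of h] h hh h0 by (simp add: inv)
    finally show "disc_rho \<phi> (6 / sqrt (\<Psi> s)) * \<Psi> (A * s) \<le> 1" .
    have "\<not> s \<le> orlicz_inv \<Psi> (36 / t0\<^sup>2)" using s by (simp add: M_def)
    then have "(6 / t0)\<^sup>2 \<le> \<Psi> s" using s0 by (subst (asm) le_inv_iff) (auto simp: power_divide)
    then have "6 / t0 \<le> sqrt (\<Psi> s)" by (rule real_le_rsqrt)
    then show "6 / sqrt (\<Psi> s) \<le> t0" using t0 P by (simp add: field_simps)
  qed
  show thesis
  proof (rule that[OF M0])
    fix F assume F: "F holomorphic_on unit_disk" and F1: "(\<integral>\<^sup>+w. ennreal (\<Psi> (norm (F w))) \<partial>areaD) \<le> 1"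
    have [measurable]: "F \<in> borel_measurable areaD" "\<phi> \<in> borel_measurable areaD"
      using F \<phi>(1) by (auto intro: borel_measurable_areaD_holomorphic)
    have [measurable]: "(\<lambda>w. w) \<in> measurable areaD borel"
      by (rule borel_measurable_areaD) simp
    have [measurable]: "disc_rho \<phi> \<in> borel_measurable borel"
      by (intro borel_measurable_mono monoI disc_rho_mono[OF \<phi>(1)])
    interpret pair: pair_sigma_finite areaD areaD ..
    define d where "d x = 1 - norm (\<phi> x)" for x
    have [measurable]: "d \<in> borel_measurable areaD" unfolding d_def by measurable
    \<comment> \<open>Where the Carleson function vanishes this is infinite, which keeps the
      pointwise bound true there.\<close>
    define R where "R x = inverse (ennreal (disc_rho \<phi> (3 * d x)))" for x
    have [measurable]: "R \<in> borel_measurable areaD" unfolding R_def by measurable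
    define V where "V = {p. norm (snd p - \<phi> (fst p)) < d (fst p) / 2}"
    have [measurable]: "(\<lambda>p. indicator V p :: ennreal) \<in> borel_measurable (areaD \<Otimes>\<^sub>M areaD)"
      unfolding V_def by measurable
    have Vw: "(\<lambda>w. indicator V (x, w)) = (indicator {w. norm (w - \<phi> x) < d x / 2} :: complex \<Rightarrow> ennreal)" for x
      by (simp add: V_def indicator_def fun_eq_iff)
    have [measurable]: "(\<lambda>w. indicator V (x, w) :: ennreal) \<in> borel_measurable areaD" for x
      unfolding Vw by measurable
    have Vx: "(\<lambda>x. indicator V (x, w)) = (indicator {x. norm (w - \<phi> x) < d x / 2} :: complex \<Rightarrow> ennreal)" for w
      by (simp add: V_def indicator_def fun_eq_iff)
    have [measurable]: "(\<lambda>x. indicator V (x, w) :: ennreal) \<in> borel_measurable areaD" for w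
      unfolding Vx by measurable
    define I where "I x = (\<integral>\<^sup>+w. ennreal (\<Psi> (norm (F w))) * indicator V (x, w) \<partial>areaD)" for x
    have pointwise: "ennreal (\<Psi> (A * norm (F (\<phi> x)))) * indicator {x. norm (F (\<phi> x)) > M} x
        \<le> 87480000 * (I x * R x)" if x: "x \<in> unit_disk" for x
    proof (cases "norm (F (\<phi> x)) > M")
      case True
      define s where "s = norm (F (\<phi> x))"
      have s: "s > M" "s > 0" using True M0 by (auto simp: s_def)
      have z: "norm (\<phi> x) < 1" using x \<phi>1 by (simp add: unit_disk_def)
      have d0: "d x > 0" using z by (simp add: d_def)
      have Ps: "\<Psi> s > 0" using s pos by auto
      \<comment> \<open>With \<epsilon> = sqrt a one has 3 d x = \<epsilon> * 6 / sqrt (\<Psi> s).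
        Homogeneity thus yields the factor \<epsilon>^2 = a, and the sub-mean value property bounds
        a by I x, hence by 1.\<close>
      define a where "a = \<Psi> s * ((d x)\<^sup>2 / 4)"
      have a0: "a > 0" using Ps d0 by (simp add: a_def)
      have aI: "ennreal a \<le> I x"
        using subharmonic_ball[OF F z] unfolding a_def s_def d_def[symmetric] I_def V_def
        by (simp add: indicator_def dist_norm norm_minus_commute)
      also have "\<dots> \<le> (\<integral>\<^sup>+w. ennreal (\<Psi> (norm (F w))) \<partial>areaD)"
        unfolding I_def by (intro nn_integral_mono) (auto split: split_indicator)
      also note F1
      finally have a1: "a \<le> 1" by simp
      define \<epsilon> where "\<epsilon> = sqrt a"
      have eps: "0 < \<epsilon>" "\<epsilon> \<le> 1" "\<epsilon>\<^sup>2 = a" using a0 a1 by (auto simp: \<epsilon>_def)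
      have "sqrt (\<Psi> s) * d x / 2 = \<epsilon>"
        unfolding \<epsilon>_def a_def using d0 real_sqrt_unique[of 2 4] by (simp add: real_sqrt_mult real_sqrt_divide)
      moreover have "3 * d x = sqrt (\<Psi> s) * d x / 2 * (6 / sqrt (\<Psi> s))" using Ps by simp
      ultimately have "3 * d x = \<epsilon> * (6 / sqrt (\<Psi> s))" by (simp only:)
      then have "disc_rho \<phi> (3 * d x) \<le> 87480000 * a * disc_rho \<phi> (6 / sqrt (\<Psi> s))"
        using disc_rho_homogeneity[OF \<phi>, of "6 / sqrt (\<Psi> s)" \<epsilon>] eps Ps large(2)[OF s(1)] by (simp add: t0_def)
      then have "disc_rho \<phi> (3 * d x) * \<Psi> (A * s) \<le> 87480000 * a * disc_rho \<phi> (6 / sqrt (\<Psi> s)) * \<Psi> (A * s)"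
        using s A by (intro mult_right_mono nonneg) auto
      also have "\<dots> = 87480000 * a * (disc_rho \<phi> (6 / sqrt (\<Psi> s)) * \<Psi> (A * s))" by simp
      also have "\<dots> \<le> 87480000 * a * 1" using large(1)[OF s(1)] a0 by (intro mult_left_mono) auto
      finally have le: "disc_rho \<phi> (3 * d x) * \<Psi> (A * s) \<le> 87480000 * a" by simp
      have "ennreal (\<Psi> (A * s)) \<le> 87480000 * (ennreal a * R x)"
      proof (cases "disc_rho \<phi> (3 * d x) = 0")
        case True
        then show ?thesis using a0 by (simp add: R_def ennreal_mult_top)
      next
        case False
        then have r: "disc_rho \<phi> (3 * d x) > 0" using disc_rho_nonneg[of \<phi> "3 * d x"] by simp
        then have "\<Psi> (A * s) \<le> 87480000 * (a * inverse (disc_rho \<phi> (3 * d x)))"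
          using le by (simp add: field_simps)
        then have "ennreal (\<Psi> (A * s)) \<le> ennreal (87480000 * (a * inverse (disc_rho \<phi> (3 * d x))))"
          by (rule ennreal_leI)
        also have "\<dots> = 87480000 * (ennreal a * R x)"
          using r a0 by (simp add: R_def ennreal_mult inverse_ennreal)
        finally show ?thesis .
      qed
      also have "\<dots> \<le> 87480000 * (I x * R x)" using aI by (intro mult_left_mono mult_right_mono) auto
      finally show ?thesis using True by (simp add: s_def)
    qed simp
    have inner: "(\<integral>\<^sup>+x. indicator V (x, w) * R x \<partial>areaD) \<le> 1" if w: "w \<in> unit_disk" for w
    proof -
      define Z where "Z = {x \<in> unit_disk. (x, w) \<in> V}"
      have "Z = {x \<in> space areaD. norm (w - \<phi> x) < d x / 2}" by (auto simp: Z_def V_def)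
      also have "\<dots> \<in> sets areaD" by measurable
      finally have [measurable]: "Z \<in> sets areaD" .
      define m where "m = measure areaD Z"
      \<comment> \<open>The boundary point nearest to \<open>w\<close>. If \<open>\<phi> x\<close>
        has \<open>w\<close> in its Whitney ball, then 2 (1 - |w|) \<le> 3 d x, and all such points
        lie in the disc of radius 2 (1 - |w|) at \<xi>. So R \<le> 1 / m on \<open>Z\<close>, a set
        of measure m.\<close>
      define \<xi> where "\<xi> = (if w = 0 then 1 else w / norm w)"
      have \<xi>: "norm \<xi> = 1" by (simp add: \<xi>_def norm_divide)
      have w1: "norm w < 1" using w by (simp add: unit_disk_def)
      have w\<xi>: "norm (w - \<xi>) = 1 - norm w"
      proof (cases "w = 0")
        case False
        have "w - \<xi> = of_real (norm w - 1) * \<xi>" using False by (simp add: \<xi>_def field_simps)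
        then have "norm (w - \<xi>) = \<bar>norm w - 1\<bar> * norm \<xi>" by (simp only: norm_mult norm_of_real)
        then show ?thesis using \<xi> w1 by simp
      qed (simp add: \<xi>_def)
      have m_le: "m \<le> disc_rho \<phi> (3 * d x)" if "x \<in> Z" for x
      proof -
        have near: "norm (\<phi> y - \<xi>) < 2 * (1 - norm w)" if "y \<in> Z" for y
        proof -
          have y: "norm (w - \<phi> y) < d y / 2" using that by (simp add: Z_def V_def)
          have "norm w - norm (\<phi> y) \<le> norm (w - \<phi> y)" by (rule norm_triangle_ineq2)
          then have "d y \<le> 2 * (1 - norm w)"
            using y norm_triangle_ineq2[of w "\<phi> y"] norm_triangle_ineq3[of w "\<phi> y"] by (simp add: d_def abs_le_iff diff_divide_distrib)
          moreover have "norm (\<phi> y - \<xi>) \<le> norm (w - \<phi> y) + norm (w - \<xi>)"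
            using norm_triangle_ineq[of "\<phi> y - w" "w - \<xi>"] by (simp add: norm_minus_commute)
          ultimately show ?thesis using y w\<xi> by (simp add: algebra_simps)
        qed
        have "Z \<subseteq> {y \<in> unit_disk. norm (\<phi> y - \<xi>) < 2 * (1 - norm w)}" using near by (auto simp: Z_def)
        then have "m \<le> measure areaD {y \<in> unit_disk. norm (\<phi> y - \<xi>) < 2 * (1 - norm w)}"
          unfolding m_def by (intro areaD.finite_measure_mono preimage_disc_sets_areaD \<phi>)
        also have "\<dots> \<le> disc_rho \<phi> (2 * (1 - norm w))" using \<xi> by (rule disc_rho_upper)
        also have "\<dots> \<le> disc_rho \<phi> (3 * d x)"
        proof (rule disc_rho_mono[OF \<phi>(1)])
          have "norm (w - \<phi> x) < d x / 2" using \<open>x \<in> Z\<close> by (simp add: Z_def V_def)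
          moreover have "norm (\<phi> x) - norm w \<le> norm (w - \<phi> x)"
            using norm_triangle_ineq2[of "\<phi> x" w] by (simp add: norm_minus_commute)
          ultimately show "2 * (1 - norm w) \<le> 3 * d x" by (simp add: d_def diff_divide_distrib)
        qed
        finally show ?thesis .
      qed
      have "(\<integral>\<^sup>+x. indicator V (x, w) * R x \<partial>areaD) \<le> (\<integral>\<^sup>+x. inverse (ennreal m) * indicator Z x \<partial>areaD)"
      proof (rule nn_integral_mono)
        fix x assume "x \<in> space areaD"
        show "indicator V (x, w) * R x \<le> inverse (ennreal m) * indicator Z x"
        proof (cases "x \<in> Z")
          case True
          have "R x \<le> inverse (ennreal m)"
          proof (cases "m = 0")
            case False
            then have "m > 0" by (simp add: m_def zero_less_measure_iff)
            then show ?thesis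
              unfolding R_def using m_le[OF True]
              by (simp add: inverse_ennreal ennreal_leI le_imp_inverse_le)
          qed simp
          then show ?thesis using True by (simp add: Z_def)
        next
          case False
          then show ?thesis using \<open>x \<in> space areaD\<close> by (simp add: Z_def)
        qed
      qed
      also have "\<dots> = inverse (ennreal m) * ennreal m"
        by (simp add: nn_integral_cmult_indicator m_def areaD.emeasure_eq_measure)
      also have "\<dots> \<le> 1"
      proof (cases "m = 0")
        case False
        then have "m > 0" by (simp add: m_def zero_less_measure_iff)
        then show ?thesis by (simp add: inverse_ennreal ennreal_mult[symmetric])
      qed simp
      finally show ?thesis .
    qed
    have "(\<integral>\<^sup>+x. ennreal (\<Psi> (A * norm (F (\<phi> x)))) * indicator {x. norm (F (\<phi> x)) > M} x \<partial>areaD)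
      \<le> (\<integral>\<^sup>+x. 87480000 * (I x * R x) \<partial>areaD)"
      by (intro nn_integral_mono pointwise) simp
    also have "\<dots> = (\<integral>\<^sup>+x. (\<integral>\<^sup>+w. 87480000 * (ennreal (\<Psi> (norm (F w))) * indicator V (x, w)) * R x \<partial>areaD) \<partial>areaD)"
      unfolding I_def
      by (intro nn_integral_cong) (simp add: nn_integral_multc[symmetric] nn_integral_cmult[symmetric] mult.assoc)
    \<comment> \<open>Exchanging the order leaves the mass of \<open>Z\<close> weighted by
      \<open>R\<close>, at most 1 for each \<open>w\<close>, and what remains is the modular of
      \<open>F\<close>.\<close>
    also have "\<dots> = (\<integral>\<^sup>+w. (\<integral>\<^sup>+x. 87480000 * (ennreal (\<Psi> (norm (F w))) * indicator V (x, w)) * R x \<partial>areaD) \<partial>areaD)"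
      by (rule pair.Fubini'[symmetric]) measurable
    also have "\<dots> \<le> (\<integral>\<^sup>+w. 87480000 * ennreal (\<Psi> (norm (F w))) \<partial>areaD)"
    proof (rule nn_integral_mono)
      fix w assume "w \<in> space areaD"
      then have w: "w \<in> unit_disk" by simp
      have "(\<integral>\<^sup>+x. 87480000 * (ennreal (\<Psi> (norm (F w))) * indicator V (x, w)) * R x \<partial>areaD)
        = (\<integral>\<^sup>+x. (87480000 * ennreal (\<Psi> (norm (F w)))) * (indicator V (x, w) * R x) \<partial>areaD)"
        by (simp add: mult.assoc)
      also have "\<dots> = (87480000 * ennreal (\<Psi> (norm (F w)))) * (\<integral>\<^sup>+x. indicator V (x, w) * R x \<partial>areaD)"
        by (rule nn_integral_cmult) measurable
      also have "\<dots> \<le> (87480000 * ennreal (\<Psi> (norm (F w)))) * 1"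
        by (intro mult_left_mono inner w) auto
      finally show "(\<integral>\<^sup>+x. 87480000 * (ennreal (\<Psi> (norm (F w))) * indicator V (x, w)) * R x \<partial>areaD)
        \<le> 87480000 * ennreal (\<Psi> (norm (F w)))" by simp
    qed
    also have "\<dots> = 87480000 * (\<integral>\<^sup>+w. ennreal (\<Psi> (norm (F w))) \<partial>areaD)"
      by (rule nn_integral_cmult) measurable
    also have "\<dots> \<le> 87480000 * 1" using F1 by (intro mult_left_mono) auto
    finally show "(\<integral>\<^sup>+x. ennreal (\<Psi> (A * norm (F (\<phi> x)))) * indicator {x. norm (F (\<phi> x)) > M} x \<partial>areaD) \<le> 87480000"
      by simp
  qed
qed

text \<open>Montel's theorem extracts a pointwise limit \<open>g\<close>, and Fatou's lemma keeps
  its modular at most 1. The normalized differences \<open>G n\<close> are split at height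
  \<open>M\<close>: the high part is bounded by \<open>composition_estimate\<close> and the low part
  tends to 0.\<close>

lemma compact_sufficient:
  assumes \<phi>: "\<phi> holomorphic_on unit_disk" "\<phi> ` unit_disk \<subseteq> unit_disk"
    and cond: "\<forall>A>0. \<forall>\<^sub>F h in at_right 0. rho_phi2 \<phi> h * \<Psi> (A * orlicz_inv \<Psi> (1 / h\<^sup>2)) \<le> 1"
  shows "compact_comp_op \<Psi> \<phi>"
  unfolding compact_comp_op_def
proof (intro allI impI, elim conjE)
  fix fs :: "nat \<Rightarrow> complex \<Rightarrow> complex"
  assume fs: "\<forall>n. fs n \<in> bergman_orlicz \<Psi>" and bdd: "bounded (range (\<lambda>n. bo_norm \<Psi> (fs n)))"
  have hol: "fs n holomorphic_on unit_disk" for n using fs by (auto simp: bergman_orlicz_def)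
  then have [measurable]: "fs n \<in> borel_measurable areaD" for n by (rule borel_measurable_areaD_holomorphic)
  obtain B where B: "B > 0" "\<And>n. orlicz_modular \<Psi> (fs n) B \<le> 1"
  proof -
    obtain B0 where B0: "\<And>n. \<bar>bo_norm \<Psi> (fs n)\<bar> \<le> B0"
      using bdd unfolding bounded_iff by auto
    \<comment> \<open>The passage from norm to modular takes a constant strictly above the norm,
      hence the added 1.\<close>
    have "orlicz_modular \<Psi> (fs n) (B0 + 1) \<le> 1" for n
    proof -
      obtain C where "C > 0" "orlicz_modular \<Psi> (fs n) C < \<infinity>" using fs by (auto simp: bergman_orlicz_def)
      then obtain C' where "C' > 0" "orlicz_modular \<Psi> (fs n) C' \<le> 1" using modular_le_1_exists[of "fs n" C] by auto
      moreover have "bo_norm \<Psi> (fs n) < B0 + 1" using B0[of n] by linarith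
      ultimately show ?thesis by (rule modular_le_1_of_bo_norm_less)
    qed
    moreover have "B0 + 1 > 0" using B0[of 0] by linarith
    ultimately show thesis using that by blast
  qed
  obtain g r where g: "g holomorphic_on unit_disk" "strict_mono (r :: nat \<Rightarrow> nat)"
    "\<And>x. x \<in> unit_disk \<Longrightarrow> (\<lambda>n. fs (r n) x) \<longlonglongrightarrow> g x"
  proof (rule Montel[of unit_disk "range fs" fs])
    show "open unit_disk" by (simp add: unit_disk_def)
    show "h holomorphic_on unit_disk" if "h \<in> range fs" for h using that hol by auto
    show "\<exists>Bd. \<forall>h\<in>range fs. \<forall>z\<in>K. norm (h z) \<le> Bd" if K: "compact K" "K \<subseteq> unit_disk" for K
    proof -
      obtain r where r: "r < 1" "\<forall>z\<in>K. norm z \<le> r"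
      proof (cases "K = {}")
        case False
        obtain z where z: "z \<in> K" "\<forall>y\<in>K. norm y \<le> norm z"
          using continuous_attains_sup[OF K(1) False, of norm] by (auto intro: continuous_intros)
        then show thesis using that[of "norm z"] K(2) by (auto simp: unit_disk_def)
      qed (use that[of 0] in auto)
      have "norm (fs n z) \<le> B * orlicz_inv \<Psi> (4 / (1 - r)\<^sup>2)" if "z \<in> K" for n z
        using r that by (intro pointwise_bound[where F = "fs n"] hol B) auto
      then show ?thesis by auto
    qed
  qed auto
  have [measurable]: "g \<in> borel_measurable areaD" using g(1) by (rule borel_measurable_areaD_holomorphic)
  have gB: "orlicz_modular \<Psi> g B \<le> 1"
    by (rule modular_liminf[of "\<lambda>n. fs (r n)"]) (use B g(3) in auto)
  define G where "G n z = (fs (r n) z - g z) / of_real (2 * B)" for n z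
  have G: "G n holomorphic_on unit_disk" for n
    unfolding G_def using B by (intro holomorphic_intros hol g) auto
  have G1: "(\<integral>\<^sup>+w. ennreal (\<Psi> (norm (G n w))) \<partial>areaD) \<le> 1" for n
  proof -
    have "orlicz_modular \<Psi> (\<lambda>z. fs (r n) z - g z) (2 * B)
      \<le> ennreal (1 / 2) * orlicz_modular \<Psi> (fs (r n)) B + ennreal (1 / 2) * orlicz_modular \<Psi> g B"
      using B by (intro modular_diff) auto
    also have "\<dots> \<le> ennreal (1 / 2) * 1 + ennreal (1 / 2) * 1"
      using B gB by (intro add_mono mult_left_mono) auto
    also have "\<dots> = 1" by (simp add: ennreal_plus[symmetric] del: ennreal_plus ennreal_half)
    finally show ?thesis using B by (simp add: modular_eq_norm_divide G_def)
  qed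
  have G0: "(\<lambda>n. G n x) \<longlonglongrightarrow> 0" if "x \<in> unit_disk" for x
  proof -
    have "(\<lambda>n. (fs (r n) x - g x) / of_real (2 * B)) \<longlonglongrightarrow> (g x - g x) / of_real (2 * B)"
      using B g(3)[OF that] by (intro tendsto_intros) auto
    then show ?thesis by (simp add: G_def)
  qed
  have G\<phi> [measurable]: "(\<lambda>x. G n (\<phi> x)) \<in> borel_measurable areaD" for n
    by (rule borel_measurable_comp_areaD[OF \<phi> G])
  have small: "\<forall>\<^sub>F n in sequentially. orlicz_modular \<Psi> (\<lambda>x. fs (r n) (\<phi> x) - g (\<phi> x)) (e * (2 * B)) \<le> 1" if e: "e > 0" for e
  proof -
    \<comment> \<open>The modular at 1 / A will be at most 87480000 + 1; convexity divides it by
      87480001 on enlarging the constant to 87480001 / A = e.\<close>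
    define A where "A = 87480001 / e"
    have A: "A > 0" using e by (simp add: A_def)
    obtain M where M: "M \<ge> 0" "\<And>F. F holomorphic_on unit_disk \<Longrightarrow> (\<integral>\<^sup>+w. ennreal (\<Psi> (norm (F w))) \<partial>areaD) \<le> 1 \<Longrightarrow>
      (\<integral>\<^sup>+x. ennreal (\<Psi> (A * norm (F (\<phi> x)))) * indicator {x. norm (F (\<phi> x)) > M} x \<partial>areaD) \<le> 87480000"
      by (rule composition_estimate[OF \<phi> cond A]) blast
    define low where "low n x = ennreal (\<Psi> (A * norm (G n (\<phi> x)))) * indicator {x. norm (G n (\<phi> x)) \<le> M} x" for n x
    have [measurable]: "low n \<in> borel_measurable areaD" for n
    proof -
      have "(\<lambda>x. \<Psi> (norm (of_real A * G n (\<phi> x)))) \<in> borel_measurable areaD" by measurable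
      then have [measurable]: "(\<lambda>x. \<Psi> (A * norm (G n (\<phi> x)))) \<in> borel_measurable areaD" using A by (simp add: norm_mult)
      show ?thesis unfolding low_def by measurable
    qed
    have "(\<lambda>n. \<integral>\<^sup>+x. low n x \<partial>areaD) \<longlonglongrightarrow> (\<integral>\<^sup>+x. 0 \<partial>areaD)"
    proof (rule nn_integral_dominated_convergence[where w = "\<lambda>_. ennreal (\<Psi> (A * M))"])
      show "AE x in areaD. low n x \<le> ennreal (\<Psi> (A * M))" for n
        using A by (intro AE_I2) (auto simp: low_def indicator_def intro!: ennreal_leI mono mult_left_mono)
      show "(\<integral>\<^sup>+x. ennreal (\<Psi> (A * M)) \<partial>areaD) < \<infinity>"
        by (simp add: emeasure_areaD_unit_disk)
      show "AE x in areaD. (\<lambda>n. low n x) \<longlonglongrightarrow> 0"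
      proof (rule AE_I2)
        fix x assume "x \<in> space areaD"
        then have "\<phi> x \<in> unit_disk" using \<phi>(2) by auto
        then have "(\<lambda>n. A * norm (G n (\<phi> x))) \<longlonglongrightarrow> A * norm (0::complex)"
          by (intro tendsto_intros G0)
        then have "(\<lambda>n. \<Psi> \<bar>A * norm (G n (\<phi> x))\<bar>) \<longlonglongrightarrow> \<Psi> \<bar>A * norm (0::complex)\<bar>"
          by (rule continuous_on_tendsto_compose[OF continuous_on_abs]) auto
        then have "(\<lambda>n. ennreal (\<Psi> (A * norm (G n (\<phi> x))))) \<longlonglongrightarrow> 0"
          using A by (simp add: abs_mult zero ennreal_0[symmetric] del: ennreal_0)
        then show "(\<lambda>n. low n x) \<longlonglongrightarrow> 0"
          by (rule tendsto_sandwich[OF _ _ tendsto_const, rotated 2])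
             (auto simp: low_def indicator_def)
      qed
    qed auto
    then have "\<forall>\<^sub>F n in sequentially. (\<integral>\<^sup>+x. low n x \<partial>areaD) < 1"
      by (intro order_tendstoD(2)[of _ "0::ennreal"]) auto
    then show ?thesis
    proof eventually_elim
      case (elim n)
      have "(\<integral>\<^sup>+x. ennreal (\<Psi> (A * norm (G n (\<phi> x)))) \<partial>areaD) \<le> 87480000 + 1"
        using M(2)[OF G G1] elim unfolding modular_comp_split[OF G\<phi> A M(1)] low_def
        by (intro add_mono) auto
      moreover have "(\<integral>\<^sup>+x. ennreal (\<Psi> (A * norm (G n (\<phi> x)))) \<partial>areaD) = orlicz_modular \<Psi> (\<lambda>x. G n (\<phi> x)) (1 / A)"
        by (simp add: orlicz_modular_def mult.commute)
      ultimately have "orlicz_modular \<Psi> (\<lambda>x. G n (\<phi> x)) (87480001 * (1 / A)) \<le> ennreal (1 / 87480001) * (87480000 + 1)"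
        using A by (intro order_trans[OF modular_scale] mult_left_mono) auto
      also have "\<dots> = ennreal (1 / 87480001) * ennreal 87480001" by simp
      also have "\<dots> = 1" by (simp add: ennreal_mult[symmetric] del: ennreal_numeral)
      also have "87480001 * (1 / A) = e" by (simp add: A_def)
      finally have "orlicz_modular \<Psi> (\<lambda>x. G n (\<phi> x)) e \<le> 1" .
      then show ?case using B by (simp add: orlicz_modular_def G_def norm_divide mult_ac)
    qed
  qed
  \<comment> \<open>The limit of the images must itself lie in the space; this is the estimate with
    A = 1 plus the bound \<Psi> M on the low part.\<close>
  have "(\<lambda>z. g (\<phi> z)) \<in> bergman_orlicz \<Psi>"
  proof -
    have gF: "(\<lambda>z. g z / of_real B) holomorphic_on unit_disk" using B by (intro holomorphic_intros g) auto
    obtain M where M: "M \<ge> 0" "\<And>F. F holomorphic_on unit_disk \<Longrightarrow> (\<integral>\<^sup>+w. ennreal (\<Psi> (norm (F w))) \<partial>areaD) \<le> 1 \<Longrightarrow>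
      (\<integral>\<^sup>+x. ennreal (\<Psi> (1 * norm (F (\<phi> x)))) * indicator {x. norm (F (\<phi> x)) > M} x \<partial>areaD) \<le> 87480000"
      by (rule composition_estimate[OF \<phi> cond zero_less_one]) blast
    have "orlicz_modular \<Psi> (\<lambda>z. g (\<phi> z)) B = (\<integral>\<^sup>+x. ennreal (\<Psi> (1 * norm (g (\<phi> x) / of_real B))) \<partial>areaD)"
      using B by (simp add: modular_eq_norm_divide)
    also have "\<dots> \<le> 87480000 + ennreal (\<Psi> M)"
      unfolding modular_comp_split[OF borel_measurable_comp_areaD[OF \<phi> gF] zero_less_one M(1)]
    proof (rule add_mono)
      show "(\<integral>\<^sup>+x. ennreal (\<Psi> (1 * norm (g (\<phi> x) / of_real B))) * indicator {x. norm (g (\<phi> x) / of_real B) > M} x \<partial>areaD) \<le> 87480000"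
        using gB B by (intro M(2)[OF gF]) (simp add: modular_eq_norm_divide)
      have "(\<integral>\<^sup>+x. ennreal (\<Psi> (1 * norm (g (\<phi> x) / of_real B))) * indicator {x. norm (g (\<phi> x) / of_real B) \<le> M} x \<partial>areaD)
        \<le> (\<integral>\<^sup>+x. ennreal (\<Psi> M) \<partial>areaD)"
        by (intro nn_integral_mono) (auto simp: indicator_def intro!: ennreal_leI mono)
      also have "\<dots> = ennreal (\<Psi> M)" by (simp add: emeasure_areaD_unit_disk)
      finally show "(\<integral>\<^sup>+x. ennreal (\<Psi> (1 * norm (g (\<phi> x) / of_real B))) * indicator {x. norm (g (\<phi> x) / of_real B) \<le> M} x \<partial>areaD)
        \<le> ennreal (\<Psi> M)" .
    qed
    also have "\<dots> < \<infinity>" by (simp add: ennreal_numeral[symmetric] ennreal_plus[symmetric] del: ennreal_numeral ennreal_plus)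
    finally have "orlicz_modular \<Psi> (\<lambda>z. g (\<phi> z)) B < \<infinity>" .
    moreover have "(\<lambda>z. g (\<phi> z)) holomorphic_on unit_disk"
      using holomorphic_on_compose_gen[OF \<phi>(1) g(1) \<phi>(2)] by (simp add: o_def)
    ultimately show ?thesis using B by (auto simp: bergman_orlicz_def)
  qed
  moreover have "(\<lambda>n. bo_norm \<Psi> (\<lambda>z. fs (r n) (\<phi> z) - g (\<phi> z))) \<longlonglongrightarrow> 0"
  proof (rule tendstoI)
    fix e :: real assume e: "e > 0"
    have "\<forall>\<^sub>F n in sequentially. orlicz_modular \<Psi> (\<lambda>x. fs (r n) (\<phi> x) - g (\<phi> x)) (e / (4 * B) * (2 * B)) \<le> 1"
      using e B by (intro small) auto
    then show "\<forall>\<^sub>F n in sequentially. dist (bo_norm \<Psi> (\<lambda>z. fs (r n) (\<phi> z) - g (\<phi> z))) 0 < e"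
    proof eventually_elim
      case (elim n)
      have eq: "e / (4 * B) * (2 * B) = e / 2" using B by simp
      have *: "orlicz_modular \<Psi> (\<lambda>x. fs (r n) (\<phi> x) - g (\<phi> x)) (e / 2) \<le> 1"
        using elim unfolding eq .
      show ?case using bo_norm_le[OF _ *] bo_norm_nonneg[OF _ *] e by simp
    qed
  qed
  ultimately show "\<exists>r g. strict_mono r \<and> g \<in> bergman_orlicz \<Psi> \<and>
      (\<lambda>n. bo_norm \<Psi> (\<lambda>z. fs (r n) (\<phi> z) - g z)) \<longlonglongrightarrow> 0"
    using g(2) by blast
qed

end

subsection \<open>Necessity\<close>

lemma nn_integral_areaD_ball_le:
  assumes "r \<ge> 0"
  shows "(\<integral>\<^sup>+z. indicator (ball \<xi> r) z \<partial>areaD) \<le> ennreal (r\<^sup>2)"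
proof -
  have [measurable]: "ball \<xi> r \<in> sets borel" by simp
  have "(\<integral>\<^sup>+z. indicator (ball \<xi> r) z \<partial>areaD) = ennreal (1 / pi) * (\<integral>\<^sup>+z. indicator (ball \<xi> r) z * indicator unit_disk z \<partial>lborel)"
    by (intro nn_integral_areaD borel_measurable_areaD) measurable
  also have "\<dots> \<le> ennreal (1 / pi) * (\<integral>\<^sup>+z. indicator (ball \<xi> r) z \<partial>lborel)"
    by (intro mult_left_mono nn_integral_mono) (auto split: split_indicator)
  also have "\<dots> = ennreal (r\<^sup>2)"
    using assms by (simp add: emeasure_lborel_ball_complex ennreal_mult[symmetric])
  finally show ?thesis .
qed

text \<open>The fourth power gives a factor \<open>h ^ 4\<close> at fixed \<open>z\<close>, enough
  to beat the growth of \<Psi>^-1(1 / h^2), which is of order at most 1 / h^2. It also makes the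
  dyadic sum for the integral converge.\<close>

definition bump :: "real \<Rightarrow> complex \<Rightarrow> complex \<Rightarrow> complex" where
  "bump h \<xi> z = (of_real h / (1 - of_real (1 - h) * cnj \<xi> * z)) ^ 4"

text \<open>The denominator differs from 1 - cnj \<xi> z, of modulus |z - \<xi>|, by at most h, and
  h is itself at most q.\<close>

lemma bump_denominator:
  assumes h: "0 < h" "h < 1" and \<xi>: "norm \<xi> = 1" and z: "norm z < 1"
  defines "q \<equiv> norm (1 - of_real (1 - h) * cnj \<xi> * z)"
  shows "h \<le> q" "1 - norm z \<le> q" "norm (z - \<xi>) \<le> 2 * q" "q \<le> norm (z - \<xi>) + h"
proof -
  have n: "norm (of_real (1 - h) * cnj \<xi> * z) = (1 - h) * norm z"
    using h \<xi> by (simp add: norm_mult del: of_real_diff)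
  have q1: "1 - (1 - h) * norm z \<le> q"
    unfolding q_def using norm_triangle_ineq2[of 1 "of_real (1 - h) * cnj \<xi> * z"] unfolding n by simp
  have "(1 - h) * norm z \<le> (1 - h) * 1" using h z by (intro mult_left_mono) auto
  then show hq: "h \<le> q" using q1 by simp
  have "(1 - h) * norm z \<le> norm z" using h by (intro mult_left_le_one_le) auto
  then show "1 - norm z \<le> q" using q1 by linarith
  have "cnj \<xi> * \<xi> = 1" using complex_norm_square[of \<xi>] \<xi> by (simp add: mult.commute)
  then have "1 - cnj \<xi> * z = - (cnj \<xi> * (z - \<xi>))" by (simp add: algebra_simps)
  then have d: "norm (1 - cnj \<xi> * z) = norm (z - \<xi>)"
    using \<xi> by (simp only: norm_minus_cancel norm_mult complex_mod_cnj mult_1)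
  define e where "e = of_real h * (cnj \<xi> * z)"
  have e: "norm e \<le> h" using h \<xi> z by (simp add: e_def norm_mult mult_left_le)
  have eq: "1 - of_real (1 - h) * cnj \<xi> * z = (1 - cnj \<xi> * z) + e" by (simp add: e_def algebra_simps)
  then have "q = norm ((1 - cnj \<xi> * z) + e)" unfolding q_def by (rule arg_cong)
  moreover have "norm ((1 - cnj \<xi> * z) + e) \<le> norm (z - \<xi>) + norm e"
    unfolding d[symmetric] by (rule norm_triangle_ineq)
  moreover have "norm (z - \<xi>) - norm e \<le> norm ((1 - cnj \<xi> * z) + e)"
    unfolding d[symmetric] by (rule norm_diff_ineq)
  ultimately show "norm (z - \<xi>) \<le> 2 * q" "q \<le> norm (z - \<xi>) + h" using e hq by linarith+
qed

lemma bump_bounds: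
  assumes h: "0 < h" "h < 1" and \<xi>: "norm \<xi> = 1"
  shows "bump h \<xi> holomorphic_on unit_disk"
    and "norm z < 1 \<Longrightarrow> norm (bump h \<xi> z) \<le> 1"
    and "norm z < 1 \<Longrightarrow> norm (bump h \<xi> z) \<le> h ^ 4 / (1 - norm z) ^ 4"
    and "z \<in> carleson_window \<xi> h \<Longrightarrow> 1 / 1296 \<le> norm (bump h \<xi> z)"
proof -
  note q = bump_denominator[OF h \<xi>]
  show "bump h \<xi> holomorphic_on unit_disk"
    unfolding bump_def using q(1) h by (intro holomorphic_intros) (force simp: unit_disk_def)
  have nb: "norm (bump h \<xi> z) = (h / norm (1 - of_real (1 - h) * cnj \<xi> * z)) ^ 4" for z
    using h by (simp add: bump_def norm_power norm_divide)
  show "norm (bump h \<xi> z) \<le> 1" if "norm z < 1"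
  proof -
    have "0 < norm (1 - of_real (1 - h) * cnj \<xi> * z)" using q(1)[OF that] h by linarith
    then show ?thesis unfolding nb using q(1)[OF that] h by (intro power_le_one) (auto simp: divide_le_eq)
  qed
  show "norm (bump h \<xi> z) \<le> h ^ 4 / (1 - norm z) ^ 4" if "norm z < 1"
    unfolding nb power_divide[symmetric] using q(2)[OF that] h that
    by (intro power_mono divide_left_mono mult_pos_pos) auto
  show "1 / 1296 \<le> norm (bump h \<xi> z)" if w: "z \<in> carleson_window \<xi> h"
  proof -
    have z: "norm z < 1" using w by (simp add: carleson_window_def)
    \<comment> \<open>Distance 5 h to \<xi> inside the window plus the perturbation h; hence 1296 =
      6^4.\<close>
    have "norm (1 - of_real (1 - h) * cnj \<xi> * z) \<le> 6 * h"
      using q(4)[OF z] carleson_window_dist[OF \<xi> w] by simp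
    moreover have "0 < norm (1 - of_real (1 - h) * cnj \<xi> * z)" using q(1)[OF z] h by linarith
    ultimately have "1 / 6 \<le> h / norm (1 - of_real (1 - h) * cnj \<xi> * z)"
      by (simp add: le_divide_eq)
    then have "(1 / 6) ^ 4 \<le> norm (bump h \<xi> z)" unfolding nb by (intro power_mono) auto
    then show ?thesis by (simp add: power_divide)
  qed
qed

text \<open>Split the disk into the dyadic shells where the denominator is comparable to \<open>2 ^ k * h\<close>.\<close>
lemma bump_integral:
  assumes h: "0 < h" "h < 1" and \<xi>: "norm \<xi> = 1"
  shows "(\<integral>\<^sup>+z. ennreal (norm (bump h \<xi> z)) \<partial>areaD) \<le> ennreal (22 * h\<^sup>2)"
proof -
  define S where "S k = ball \<xi> (4 * 2 ^ k * h)" for k :: nat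
  have [measurable]: "S k \<in> sets borel" for k by (simp add: S_def)
  have [measurable]: "(\<lambda>z. indicator (S k) z :: ennreal) \<in> borel_measurable areaD" for k
    by (intro borel_measurable_areaD) measurable
  have pt: "ennreal (norm (bump h \<xi> z)) \<le> (\<Sum>k. ennreal ((1 / 16) ^ k) * indicator (S k) z)"
    if z: "z \<in> unit_disk" for z
  proof -
    define q where "q = norm (1 - of_real (1 - h) * cnj \<xi> * z)"
    have z1: "norm z < 1" using z by (simp add: unit_disk_def)
    have q: "h \<le> q" "norm (z - \<xi>) \<le> 2 * q" using bump_denominator[OF h \<xi> z1] by (simp_all add: q_def)
    have nb: "norm (bump h \<xi> z) = (h / q) ^ 4"
      using h by (simp add: bump_def norm_power norm_divide q_def)
    obtain n0 where "q / h < 2 ^ n0" using real_arch_pow[of 2 "q / h"] by auto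
    then have ex: "\<exists>n. q / h < 2 ^ n" by blast
    \<comment> \<open>The least such n is positive because q \<ge> h, so its predecessor k satisfies
      2^k \<le> q / h < 2^(k+1). Together with |z - \<xi>| \<le> 2 q this gives the radius 4 * 2^k
      h.\<close>
    define n where "n = (LEAST n. q / h < 2 ^ n)"
    have n: "q / h < 2 ^ n" unfolding n_def by (rule LeastI_ex[OF ex])
    have "n \<noteq> 0" using n q h by (intro notI) simp
    then obtain k where k: "n = Suc k" by (cases n) auto
    then have "\<not> q / h < 2 ^ k" unfolding n_def by (intro not_less_Least) simp
    then have lo: "2 ^ k \<le> q / h" by simp
    have "norm (z - \<xi>) < 4 * 2 ^ k * h" using n k q h by (simp add: divide_less_eq)
    then have zS: "z \<in> S k" by (simp add: S_def dist_norm norm_minus_commute)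
    have "h / q \<le> 1 / 2 ^ k" using lo h q by (simp add: field_simps)
    then have "(h / q) ^ 4 \<le> (1 / 2 ^ k) ^ 4" using h q by (intro power_mono) auto
    also have "(1 / 2 ^ k) ^ 4 = (1 / 16 :: real) ^ k"
    proof -
      have "((2 :: real) ^ k) ^ 4 = (2 ^ 4) ^ k" by (simp only: power_mult[symmetric] mult.commute)
      then show ?thesis by (simp add: power_divide)
    qed
    finally have "ennreal (norm (bump h \<xi> z)) \<le> ennreal ((1 / 16) ^ k) * indicator (S k) z"
      using zS by (simp add: nb ennreal_leI)
    also have "\<dots> = (\<Sum>j\<in>{k}. ennreal ((1 / 16) ^ j) * indicator (S j) z)"
      by (simp only: sum.insert[OF finite.emptyI] sum.empty empty_iff not_False_eq_True add_0_right)
    also have "\<dots> \<le> (\<Sum>k. ennreal ((1 / 16) ^ k) * indicator (S k) z)"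
      by (intro sum_le_suminf) auto
    finally show ?thesis .
  qed
  have "(\<integral>\<^sup>+z. ennreal (norm (bump h \<xi> z)) \<partial>areaD) \<le> (\<integral>\<^sup>+z. (\<Sum>k. ennreal ((1 / 16) ^ k) * indicator (S k) z) \<partial>areaD)"
    using pt by (intro nn_integral_mono) simp
  also have "\<dots> = (\<Sum>k. \<integral>\<^sup>+z. ennreal ((1 / 16) ^ k) * indicator (S k) z \<partial>areaD)"
    by (rule nn_integral_suminf) measurable
  \<comment> \<open>Height 16^-k times area 16 * 4^k h^2; the geometric series sums to 64 h^2 / 3,
    below 22 h^2.\<close>
  also have "\<dots> \<le> (\<Sum>k. ennreal (16 * h\<^sup>2 * (1 / 4) ^ k))"
  proof (rule suminf_le)
    fix k
    have "(\<integral>\<^sup>+z. ennreal ((1 / 16) ^ k) * indicator (S k) z \<partial>areaD) = ennreal ((1 / 16) ^ k) * (\<integral>\<^sup>+z. indicator (S k) z \<partial>areaD)"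
      by (rule nn_integral_cmult) measurable
    also have "\<dots> \<le> ennreal ((1 / 16) ^ k) * ennreal ((4 * 2 ^ k * h)\<^sup>2)"
      unfolding S_def using h by (intro mult_left_mono nn_integral_areaD_ball_le) auto
    also have "\<dots> = ennreal (16 * h\<^sup>2 * (1 / 4) ^ k)"
    proof -
      have "(2 ^ k)\<^sup>2 = (4 ^ k :: real)" by (simp add: power2_eq_square flip: power_mult_distrib)
      moreover have "(16 :: real) ^ k = 4 ^ k * 4 ^ k" by (simp flip: power_mult_distrib)
      ultimately have "(1 / 16) ^ k * (4 * 2 ^ k * h)\<^sup>2 = 16 * h\<^sup>2 * (1 / 4) ^ k"
        by (simp add: power_mult_distrib power_divide)
      then show ?thesis by (simp add: ennreal_mult[symmetric])
    qed
    finally show "(\<integral>\<^sup>+z. ennreal ((1 / 16) ^ k) * indicator (S k) z \<partial>areaD) \<le> ennreal (16 * h\<^sup>2 * (1 / 4) ^ k)" .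
  qed auto
  also have "\<dots> = ennreal (16 * h\<^sup>2 * (4 / 3))"
  proof (rule suminf_ennreal_eq)
    have "(\<lambda>k. (1 / 4 :: real) ^ k) sums (1 / (1 - 1 / 4))" by (rule geometric_sums) simp
    from sums_mult[OF this, of "16 * h\<^sup>2"]
    show "(\<lambda>k. 16 * h\<^sup>2 * (1 / 4) ^ k) sums (16 * h\<^sup>2 * (4 / 3))" by simp
  qed simp
  also have "\<dots> \<le> ennreal (22 * h\<^sup>2)" by (intro ennreal_leI) simp
  finally show ?thesis .
qed

section \<open>Test functions in the Bergman-Orlicz space\<close>

context orlicz
begin

definition test_function :: "real \<Rightarrow> complex \<Rightarrow> complex \<Rightarrow> complex" where
  "test_function h \<xi> z = of_real (orlicz_inv \<Psi> (1 / h\<^sup>2)) * bump h \<xi> z"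

lemma test_function_holomorphic:
  "0 < h \<Longrightarrow> h < 1 \<Longrightarrow> norm \<xi> = 1 \<Longrightarrow> test_function h \<xi> holomorphic_on unit_disk"
  unfolding test_function_def by (intro holomorphic_intros bump_bounds)

lemma norm_test_function:
  "0 < h \<Longrightarrow> norm (test_function h \<xi> z) = orlicz_inv \<Psi> (1 / h\<^sup>2) * norm (bump h \<xi> z)"
  by (simp add: test_function_def norm_mult inv_nonneg)

text \<open>The bump is at most 1, so convexity gives \<Psi>(s |bump| / 22) \<le> |bump| \<Psi>(s) /
  22 with \<Psi>(s) = 1 / h^2, and \<open>bump_integral\<close> finishes.\<close>

lemma test_function_modular:
  assumes h: "0 < h" "h < 1" and \<xi>: "norm \<xi> = 1"
  shows "orlicz_modular \<Psi> (test_function h \<xi>) 22 \<le> 1"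
proof -
  have [measurable]: "bump h \<xi> \<in> borel_measurable areaD"
    by (intro borel_measurable_areaD_holomorphic bump_bounds assms)
  define s where "s = orlicz_inv \<Psi> (1 / h\<^sup>2)"
  have s: "s \<ge> 0" "\<Psi> s = 1 / h\<^sup>2" by (simp_all add: s_def inv_nonneg inv_eq)
  have "orlicz_modular \<Psi> (test_function h \<xi>) 22 \<le> (\<integral>\<^sup>+z. ennreal (1 / (22 * h\<^sup>2)) * ennreal (norm (bump h \<xi> z)) \<partial>areaD)"
    unfolding orlicz_modular_def
  proof (rule nn_integral_mono)
    fix z assume "z \<in> space areaD"
    then have z: "norm z < 1" by (simp add: unit_disk_def)
    have "\<Psi> (norm (test_function h \<xi> z) / 22) = \<Psi> (norm (bump h \<xi> z) / 22 * s)"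
      using h by (simp add: norm_test_function s_def mult.commute)
    also have "\<dots> \<le> norm (bump h \<xi> z) / 22 * \<Psi> s"
      using bump_bounds(2)[OF h \<xi> z] s by (intro scale) auto
    also have "\<dots> = 1 / (22 * h\<^sup>2) * norm (bump h \<xi> z)" by (simp add: s)
    finally show "ennreal (\<Psi> (norm (test_function h \<xi> z) / 22)) \<le> ennreal (1 / (22 * h\<^sup>2)) * ennreal (norm (bump h \<xi> z))"
      by (simp add: ennreal_mult[symmetric] ennreal_leI)
  qed
  also have "\<dots> = ennreal (1 / (22 * h\<^sup>2)) * (\<integral>\<^sup>+z. ennreal (norm (bump h \<xi> z)) \<partial>areaD)"
    by (rule nn_integral_cmult) measurable
  also have "\<dots> \<le> ennreal (1 / (22 * h\<^sup>2)) * ennreal (22 * h\<^sup>2)"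
    by (intro mult_left_mono bump_integral assms) auto
  also have "\<dots> = 1" using h by (simp add: ennreal_mult[symmetric])
  finally show ?thesis .
qed

text \<open>Beyond 1 the function \<Psi> grows at least like x \<Psi>(1), by convexity and \<Psi>(0)
  = 0.\<close>

lemma inv_le_linear:
  assumes "y > 0" shows "orlicz_inv \<Psi> y \<le> 1 + y / \<Psi> 1"
proof (cases "orlicz_inv \<Psi> y \<le> 1")
  case True
  then show ?thesis using assms pos[of 1] by (smt (verit) divide_pos_pos)
next
  case False
  define s where "s = orlicz_inv \<Psi> y"
  have "\<Psi> (1 / s * s) \<le> 1 / s * \<Psi> s" using False by (intro scale) (auto simp: s_def)
  then have "s * \<Psi> 1 \<le> y" using False assms by (simp add: s_def inv_eq field_simps)
  then have "s \<le> y / \<Psi> 1" using pos[of 1] by (simp add: le_divide_eq)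
  then show ?thesis by (simp add: s_def)
qed

text \<open>The amplitude is at most 1 + 1 / (h^2 \<Psi>(1)) while the bump is of order h^4 at fixed
  \<open>z\<close>.\<close>

lemma test_function_tendsto_0:
  assumes h: "\<And>n. 0 < h n" "\<And>n. h n < 1" "h \<longlonglongrightarrow> 0" and \<xi>: "\<And>n. norm (\<xi> n) = 1" and z: "norm z < 1"
  shows "(\<lambda>n. test_function (h n) (\<xi> n) z) \<longlonglongrightarrow> 0"
proof (rule Lim_null_comparison)
  define c where "c = 1 / (1 - norm z) ^ 4"
  show "\<forall>\<^sub>F n in sequentially. norm (test_function (h n) (\<xi> n) z) \<le> (h n ^ 4 + h n ^ 2 / \<Psi> 1) * c"
  proof (intro always_eventually allI)
    fix n
    have hn: "h n > 0" "h n < 1" using h by auto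
    have "norm (test_function (h n) (\<xi> n) z) \<le> (1 + (1 / (h n)\<^sup>2) / \<Psi> 1) * (h n ^ 4 / (1 - norm z) ^ 4)"
      unfolding norm_test_function[OF hn(1)]
      using hn z \<xi> pos[of 1] by (intro mult_mono inv_le_linear bump_bounds(3)) auto
    also have "(1 + (1 / (h n)\<^sup>2) / \<Psi> 1) * (h n ^ 4 / (1 - norm z) ^ 4) = (h n ^ 4 + h n ^ 2 / \<Psi> 1) * c"
    proof -
      have "(1 / (h n)\<^sup>2) * h n ^ 4 = h n ^ 2" using hn by (simp add: power2_eq_square power4_eq_xxxx)
      then have "(1 / (h n)\<^sup>2) / \<Psi> 1 * h n ^ 4 = h n ^ 2 / \<Psi> 1" by (metis times_divide_eq_left)
      then have "(1 + (1 / (h n)\<^sup>2) / \<Psi> 1) * h n ^ 4 = h n ^ 4 + h n ^ 2 / \<Psi> 1" by (simp only: distrib_right mult_1)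
      then show ?thesis by (simp add: c_def)
    qed
    finally show "norm (test_function (h n) (\<xi> n) z) \<le> (h n ^ 4 + h n ^ 2 / \<Psi> 1) * c" .
  qed
  have "(\<lambda>n. (h n ^ 4 + h n ^ 2 / \<Psi> 1) * c) \<longlonglongrightarrow> (0 ^ 4 + 0 ^ 2 / \<Psi> 1) * c"
    using pos[of 1] by (intro tendsto_intros h) auto
  then show "(\<lambda>n. (h n ^ 4 + h n ^ 2 / \<Psi> 1) * c) \<longlonglongrightarrow> 0" by simp
qed

text \<open>By convexity the modular at 1 is at most \<delta> times the modular at \<delta>, hence
  at most \<delta> for every small \<delta>.\<close>

lemma AE_zero_of_modular_le_1:
  assumes [measurable]: "g \<in> borel_measurable areaD" and le: "\<And>\<delta>. \<delta> > 0 \<Longrightarrow> orlicz_modular \<Psi> g \<delta> \<le> 1"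
  shows "AE x in areaD. g x = 0"
proof -
  have small: "orlicz_modular \<Psi> g 1 \<le> ennreal \<delta>" if "0 < \<delta>" "\<delta> \<le> 1" for \<delta>
  proof -
    have "orlicz_modular \<Psi> g (1 / \<delta> * \<delta>) \<le> ennreal (1 / (1 / \<delta>)) * orlicz_modular \<Psi> g \<delta>"
      using that by (intro modular_scale) auto
    also have "\<dots> \<le> ennreal (1 / (1 / \<delta>)) * 1" using that by (intro mult_left_mono le) auto
    finally show ?thesis using that by simp
  qed
  obtain m where m: "orlicz_modular \<Psi> g 1 = ennreal m" "m \<ge> 0"
    using small[of 1] by (cases "orlicz_modular \<Psi> g 1") (auto simp: top_unique)
  have "m \<le> 0"
  proof (rule ccontr)
    assume "\<not> m \<le> 0"
    then have "m \<le> min 1 (m / 2)" using small[of "min 1 (m / 2)"] unfolding m(1) by simp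
    then show False using \<open>\<not> m \<le> 0\<close> by simp
  qed
  then have "(\<integral>\<^sup>+x. ennreal (\<Psi> (norm (g x))) \<partial>areaD) = 0" using m by (simp add: orlicz_modular_def)
  then have "AE x in areaD. ennreal (\<Psi> (norm (g x))) = 0"
    by (subst (asm) nn_integral_0_iff_AE) auto
  then show ?thesis
  proof eventually_elim
    case (elim x)
    then have "\<Psi> (norm (g x)) \<le> 0" by (simp add: ennreal_eq_0_iff)
    then show ?case using pos[of "norm (g x)"] by (cases "g x = 0") auto
  qed
qed

text \<open>If the bound fails along h n tending to 0, the test functions for these scales are
  bounded and tend to 0 pointwise. Compactness then makes a subsequence of their images small in
  norm, although each image has modular above 1 at \<open>\<delta>\<close>.\<close>

lemma compact_necessary:
  assumes \<phi>: "\<phi> holomorphic_on unit_disk" "\<phi> ` unit_disk \<subseteq> unit_disk"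
    and compact: "compact_comp_op \<Psi> \<phi>" and A: "A > 0"
  shows "\<forall>\<^sub>F h in at_right 0. rho_phi2 \<phi> h * \<Psi> (A * orlicz_inv \<Psi> (1 / h\<^sup>2)) \<le> 1"
proof (rule ccontr)
  define s where "s h = orlicz_inv \<Psi> (1 / h\<^sup>2)" for h :: real
  assume neg: "\<not> ?thesis"
  \<comment> \<open>The offset 2 keeps every \<open>h n\<close> below 1, as the test functions
    require.\<close>
  have "\<exists>h. 0 < h \<and> h < 1 / real (n + 2) \<and> rho_phi2 \<phi> h * \<Psi> (A * s h) > 1" for n
  proof (rule ccontr)
    assume none: "\<nexists>h. 0 < h \<and> h < 1 / real (n + 2) \<and> rho_phi2 \<phi> h * \<Psi> (A * s h) > 1"
    have "\<forall>h>0. h < 1 / real (n + 2) \<longrightarrow> rho_phi2 \<phi> h * \<Psi> (A * s h) \<le> 1"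
    proof (intro allI impI, rule ccontr)
      fix h assume "0 < h" "h < 1 / real (n + 2)" "\<not> rho_phi2 \<phi> h * \<Psi> (A * s h) \<le> 1"
      then have "0 < h \<and> h < 1 / real (n + 2) \<and> rho_phi2 \<phi> h * \<Psi> (A * s h) > 1" by (simp only: not_le simp_thms)
      with none show False by blast
    qed
    moreover have "1 / real (n + 2) > 0" by simp
    ultimately have "\<forall>\<^sub>F h in at_right 0. rho_phi2 \<phi> h * \<Psi> (A * s h) \<le> 1"
      unfolding eventually_at_right_field by (intro exI[of _ "1 / real (n + 2)"] conjI)
    then show False using neg[folded s_def] by (rule notE[rotated])
  qed
  then have "\<exists>h. \<forall>n. 0 < h n \<and> h n < 1 / real (n + 2) \<and> rho_phi2 \<phi> (h n) * \<Psi> (A * s (h n)) > 1"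
    by (intro choice allI)
  then obtain h where h: "\<And>n. 0 < h n" "\<And>n. h n < 1 / real (n + 2)"
    "\<And>n. rho_phi2 \<phi> (h n) * \<Psi> (A * s (h n)) > 1" by blast
  have h1: "h n < 1" for n using h(2)[of n] by (rule order_less_trans) simp
  have "(\<lambda>n. 1 / real (n + 2)) \<longlonglongrightarrow> 0"
    using LIMSEQ_ignore_initial_segment[OF lim_const_over_n[of 1], of 2] by simp
  then have h0: "h \<longlonglongrightarrow> 0"
    by (rule tendsto_sandwich[OF _ _ tendsto_const, rotated 2])
       (intro always_eventually allI less_imp_le h)+
  have sp: "s (h n) > 0" for n using h(1)[of n] by (auto simp: s_def intro!: inv_pos)
  \<comment> \<open>A supremum with product above 1 has a window whose product is already above
    1.\<close>
  have "\<exists>\<xi>. norm \<xi> = 1 \<and> pullback_area \<phi> (carleson_window \<xi> (h n)) * \<Psi> (A * s (h n)) > 1" for n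
  proof (rule ccontr)
    assume "\<nexists>\<xi>. norm \<xi> = 1 \<and> pullback_area \<phi> (carleson_window \<xi> (h n)) * \<Psi> (A * s (h n)) > 1"
    then have *: "pullback_area \<phi> (carleson_window \<xi> (h n)) \<le> 1 / \<Psi> (A * s (h n))" if "norm \<xi> = 1" for \<xi>
      using that A sp[of n] pos[of "A * s (h n)"] by (auto simp: le_divide_eq not_less)
    have "rho_phi2 \<phi> (h n) \<le> 1 / \<Psi> (A * s (h n))"
      unfolding rho_phi2_def using * by (intro cSUP_least) auto
    then show False using h(3)[of n] A sp[of n] pos[of "A * s (h n)"] by (simp add: le_divide_eq)
  qed
  then have "\<exists>\<xi>. \<forall>n. norm (\<xi> n) = 1 \<and> pullback_area \<phi> (carleson_window (\<xi> n) (h n)) * \<Psi> (A * s (h n)) > 1"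
    by (intro choice allI)
  then obtain \<xi> where \<xi>: "\<And>n. norm (\<xi> n) = 1"
    "\<And>n. pullback_area \<phi> (carleson_window (\<xi> n) (h n)) * \<Psi> (A * s (h n)) > 1" by blast
  define fs where "fs n = test_function (h n) (\<xi> n)" for n
  have fs_hol: "fs n holomorphic_on unit_disk" for n
    unfolding fs_def by (intro test_function_holomorphic h h1 \<xi>)
  have fs_mod: "orlicz_modular \<Psi> (fs n) 22 \<le> 1" for n
    unfolding fs_def by (intro test_function_modular h h1 \<xi>)
  have fs_bo: "fs n \<in> bergman_orlicz \<Psi>" for n
  proof -
    have "orlicz_modular \<Psi> (fs n) 22 < \<infinity>" by (rule order_le_less_trans[OF fs_mod]) simp
    then have "\<exists>C>0. orlicz_modular \<Psi> (fs n) C < \<infinity>" by (intro exI[of _ 22]) simp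
    then show ?thesis using fs_hol by (simp add: bergman_orlicz_def)
  qed
  have fs_bdd: "bounded (range (\<lambda>n. bo_norm \<Psi> (fs n)))"
    unfolding bounded_iff using bo_norm_le[OF _ fs_mod] bo_norm_nonneg[OF _ fs_mod]
    by (intro exI[of _ 22]) auto
  obtain r g where r: "strict_mono r" and g: "g \<in> bergman_orlicz \<Psi>"
    and lim: "(\<lambda>n. bo_norm \<Psi> (\<lambda>z. fs (r n) (\<phi> z) - g z)) \<longlonglongrightarrow> 0"
    using compact[unfolded compact_comp_op_def, rule_format, OF conjI[OF allI[OF fs_bo] fs_bdd]] by blast
  obtain C where C: "C > 0" "orlicz_modular \<Psi> g C < \<infinity>" and g_hol: "g holomorphic_on unit_disk"
    using g by (auto simp: bergman_orlicz_def)
  have [measurable]: "g \<in> borel_measurable areaD" by (rule borel_measurable_areaD_holomorphic[OF g_hol])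
  have fs\<phi> [measurable]: "(\<lambda>z. fs n (\<phi> z)) \<in> borel_measurable areaD" for n
    by (rule borel_measurable_comp_areaD[OF \<phi> fs_hol])
  have \<phi>1: "norm (\<phi> z) < 1" if "z \<in> unit_disk" for z
    using \<phi>(2) that by (auto simp: unit_disk_def image_subset_iff)
  \<comment> \<open>\<open>bo_norm\<close> is a real infimum, so convergence of norms yields modular
    bounds only once some admissible constant is known to exist.\<close>
  have ex: "\<exists>C'>0. orlicz_modular \<Psi> (\<lambda>z. fs n (\<phi> z) - g z) C' \<le> 1" for n
  proof (rule modular_le_1_exists)
    show "2 * C > 0" using C by simp
    have "orlicz_modular \<Psi> (\<lambda>z. fs n (\<phi> z)) C \<le> (\<integral>\<^sup>+z. ennreal (\<Psi> (s (h n) / C)) \<partial>areaD)"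
      unfolding orlicz_modular_def
    proof (rule nn_integral_mono)
      fix z assume "z \<in> space areaD"
      then have "norm (bump (h n) (\<xi> n) (\<phi> z)) \<le> 1"
        using \<phi>1 by (intro bump_bounds h h1 \<xi>) auto
      then have "norm (fs n (\<phi> z)) \<le> s (h n)"
        using sp[of n] by (simp add: fs_def norm_test_function[OF h(1)] s_def mult_left_le)
      then show "ennreal (\<Psi> (norm (fs n (\<phi> z)) / C)) \<le> ennreal (\<Psi> (s (h n) / C))"
        using C by (intro ennreal_leI mono divide_right_mono) auto
    qed
    also have "\<dots> < \<infinity>" by (simp add: emeasure_areaD_unit_disk)
    finally have "ennreal (1 / 2) * orlicz_modular \<Psi> (\<lambda>z. fs n (\<phi> z)) C + ennreal (1 / 2) * orlicz_modular \<Psi> g C < \<infinity>"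
      using C(2) by (simp add: ennreal_mult_less_top del: ennreal_half)
    then show "orlicz_modular \<Psi> (\<lambda>z. fs n (\<phi> z) - g z) (2 * C) < \<infinity>"
      using C by (intro order_le_less_trans[OF modular_diff]) auto
  qed measurable
  have ev: "\<forall>\<^sub>F n in sequentially. orlicz_modular \<Psi> (\<lambda>z. fs (r n) (\<phi> z) - g z) \<delta> \<le> 1" if "\<delta> > 0" for \<delta>
  proof -
    have "\<forall>\<^sub>F n in sequentially. bo_norm \<Psi> (\<lambda>z. fs (r n) (\<phi> z) - g z) < \<delta>"
      using that by (intro order_tendstoD[OF lim])
    then show ?thesis
    proof eventually_elim
      case (elim n)
      obtain C' where "C' > 0" "orlicz_modular \<Psi> (\<lambda>z. fs (r n) (\<phi> z) - g z) C' \<le> 1" using ex by blast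
      then show ?case using elim by (rule modular_le_1_of_bo_norm_less)
    qed
  qed
  have "AE x in areaD. g x = 0"
  proof (rule AE_zero_of_modular_le_1)
    fix \<delta> :: real assume \<delta>: "\<delta> > 0"
    \<comment> \<open>The images tend to 0 pointwise, so Fatou's lemma identifies the norm limit
      \<open>g\<close> as zero almost everywhere.\<close>
    have "orlicz_modular \<Psi> (\<lambda>z. 0 - g z) \<delta> \<le> 1"
    proof (rule modular_liminf[OF _ \<delta> ev[OF \<delta>]])
      fix z assume z: "z \<in> unit_disk"
      have "(\<lambda>n. fs n (\<phi> z)) \<longlonglongrightarrow> 0"
        unfolding fs_def using h h1 h0 \<xi> \<phi>1[OF z] by (intro test_function_tendsto_0) auto
      then have "(\<lambda>n. fs (r n) (\<phi> z)) \<longlonglongrightarrow> 0"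
        using LIMSEQ_subseq_LIMSEQ[of "\<lambda>n. fs n (\<phi> z)" 0 r] r by (simp add: o_def)
      then show "(\<lambda>n. fs (r n) (\<phi> z) - g z) \<longlonglongrightarrow> 0 - g z" by (intro tendsto_intros)
    qed measurable
    then show "orlicz_modular \<Psi> g \<delta> \<le> 1" by (simp add: orlicz_modular_def)
  qed measurable
  then have same: "orlicz_modular \<Psi> (\<lambda>z. fs n (\<phi> z)) \<delta> = orlicz_modular \<Psi> (\<lambda>z. fs n (\<phi> z) - g z) \<delta>" for n \<delta>
    unfolding orlicz_modular_def by (intro nn_integral_cong_AE) auto
  \<comment> \<open>On the window the test function is at least s / 1296, so dividing by this
    constant gives at least A s.\<close>
  define \<delta> where "\<delta> = 1 / (1296 * A)"
  have \<delta>: "\<delta> > 0" using A by (simp add: \<delta>_def)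
  obtain n where "orlicz_modular \<Psi> (\<lambda>z. fs (r n) (\<phi> z) - g z) \<delta> \<le> 1"
    using eventually_happens[OF ev[OF \<delta>]] by auto
  then have le1: "orlicz_modular \<Psi> (\<lambda>z. fs (r n) (\<phi> z)) \<delta> \<le> 1" by (simp add: same)
  define m where "m = r n"
  define W where "W = \<phi> -` carleson_window (\<xi> m) (h m) \<inter> unit_disk"
  have [measurable]: "W \<in> sets areaD"
    unfolding W_def by (intro pullback_window_sets \<phi> h h1 \<xi>)
  have "ennreal (\<Psi> (A * s (h m)) * pullback_area \<phi> (carleson_window (\<xi> m) (h m))) = ennreal (\<Psi> (A * s (h m))) * emeasure areaD W"
    using nonneg[of "A * s (h m)"] A sp[of m]
    by (simp add: pullback_area_def W_def areaD.emeasure_eq_measure ennreal_mult)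
  also have "\<dots> = (\<integral>\<^sup>+x. ennreal (\<Psi> (A * s (h m))) * indicator W x \<partial>areaD)"
    by (rule nn_integral_cmult_indicator[symmetric]) simp
  also have "\<dots> \<le> orlicz_modular \<Psi> (\<lambda>z. fs m (\<phi> z)) \<delta>"
    unfolding orlicz_modular_def
  proof (rule nn_integral_mono)
    fix x assume "x \<in> space areaD"
    show "ennreal (\<Psi> (A * s (h m))) * indicator W x \<le> ennreal (\<Psi> (norm (fs m (\<phi> x)) / \<delta>))"
    proof (cases "x \<in> W")
      case True
      then have "1 / 1296 \<le> norm (bump (h m) (\<xi> m) (\<phi> x))"
        by (intro bump_bounds h h1 \<xi>) (simp add: W_def)
      then have "s (h m) * (1 / 1296) \<le> norm (fs m (\<phi> x))"
        using sp[of m] unfolding fs_def norm_test_function[OF h(1)] s_def[symmetric] by (intro mult_left_mono) auto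
      then have "A * s (h m) \<le> norm (fs m (\<phi> x)) / \<delta>" using A by (simp add: \<delta>_def field_simps)
      then show ?thesis using True A sp[of m] by (auto intro!: ennreal_leI mono)
    qed simp
  qed
  also have "\<dots> \<le> 1" using le1 by (simp add: m_def)
  finally have "\<Psi> (A * s (h m)) * pullback_area \<phi> (carleson_window (\<xi> m) (h m)) \<le> 1" by simp
  then show False using \<xi>(2)[of m] by (simp add: mult.commute)
qed

end

theorem theorem3p2:
  fixes \<phi> :: "complex \<Rightarrow> complex" and \<Psi> :: "real \<Rightarrow> real"
  assumes "\<phi> holomorphic_on unit_disk" and "\<phi> ` unit_disk \<subseteq> unit_disk"
    and "orlicz_function \<Psi>"
  shows "compact_comp_op \<Psi> \<phi> \<longleftrightarrow> (compactness_ratio \<Psi> \<phi> \<longlongrightarrow> 0) (at_right 0)"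
proof -
  interpret orlicz \<Psi> by unfold_locales (rule assms(3))
  show ?thesis
    unfolding compactness_ratio_iff
    using compact_necessary[OF assms(1,2)] compact_sufficient[OF assms(1,2)] by blast
qed

end
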